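(* Let the scalar field be $\mathbb{K}=\mathbb{R}$ or $\mathbb{C}$. Let $w$ be an admissible sequence such that $w\in\ell_m$ for some $m\in\mathbb{N}$, and let $M$ be the smallest natural number such that $w\in\ell_M$. Then the (polynomial) Lindenstrauss-Bollobás theorem does not hold in the following cases: (a) for $\mathcal{P}(^Nd_*(w,1))$, for all $N\ge M$; (b) for $\mathcal{P}(^Nd_*(w,1);\ell_M)$, for all $N\in\mathbb{N}$.
   Context: A sequence $w=(w_i)_{i\in\mathbb{N}}$ is admissible if it is a decreasing (non-increasing) sequence of nonnegative real numbers with $w_1=1$, $\lim_i w_i=0$ and $\sum_i w_i=\infty$. Put $W(n)=\sum_{i=1}^nw_i$. For a bounded scalar sequence $x=(x(i))_i$, $x^*=(x^*(i))_i$ denotes the decreasing rearrangement of $(|x(i)|)_i$. The space $d^*(w,1)$ consists of all bounded sequences $x$ of scalars with $\|x\|_W:=\sup_n\frac{\sum_{i=1}^nx^*(i)}{W(n)}<\infty$, with norm $\|\cdot\|_W$; $d_*(w,1)$ (the predual of the Lorentz sequence space $d(w,1)$) is the closed subspace of those $x$ with $\lim_{n\to\infty}\frac{\sum_{i=1}^nx^*(i)}{W(n)}=0$. $S_X$ and $B_X$ are the unit sphere and closed unit ball of $X$, and $X$ is regarded as a subspace of its bidual $X''$. $\mathcal{P}(^NX;Y)$ is the Banach space of continuous $N$-homogeneous polynomials $P:X\to Y$ (i.e. $P(x)=\Phi(x,\dots,x)$ for some continuous $N$-linear $\Phi:X\times\cdots\times X\to Y$) with norm $\|P\|=\sup_{x\in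 B_X}\|P(x)\|$; $\mathcal{P}(^NX)=\mathcal{P}(^NX;\mathbb{K})$. Aron-Berner extension: for $P\in\mathcal{P}(^NX;Y)$ with associated symmetric $N$-linear map $\Phi$, $\overline P\in\mathcal{P}(^NX'';Y'')$ is defined by $\overline P(x'')=\overline\Phi(x'',\dots,x'')$, where $\overline{\Phi}(x_1'',\dots,x_N'')=w^*\text{-}\lim_{\alpha_1}\cdots\lim_{\alpha_N}\Phi(x_{1,\alpha_1},\dots,x_{N,\alpha_N})$ (iterated limits) and $(x_{j,\alpha_j})_{\alpha_j}\subset X$ is a net $w^*$-convergent to $x_j''$. One has $\|\overline P\|=\|P\|$. The Lindenstrauss-Bollobás theorem is said to hold for $\mathcal{P}(^NX;Y)$ if for every $\varepsilon>0$ there are $\eta(\varepsilon),\beta(\varepsilon)>0$, with $\beta(t)\to0$ as $t\to0$, such that: given $Q\in\mathcal{P}(^NX;Y)$ with $\|Q\|=1$ and $\tilde x\in S_X$ with $\|Q(\tilde x)\|>1-\eta(\varepsilon)$, there exist $P\in\mathcal{P}(^NX;Y)$ with $\|P\|=1$ and $a\in S_{X''}$ such that $\|\overline P(a)\|=1$, $\|a-\tilde x\|<\beta(\varepsilon)$ and $\|P-Q\|<\varepsilon$. *)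

theory Defs
  imports "HOL-Analysis.Analysis" "HOL-Library.Function_Algebras"
begin

text \<open>
  The spaces below depend on the weight \<open>w\<close>, and their biduals are needed, so a normed space over
  the field \<open>'k\<close> is given by a carrier set in an additive group together with a scalar
  multiplication and a norm. Sequences and functionals carry the pointwise operations of
  \<^theory>\<open>HOL-Library.Function_Algebras\<close>. Functions on a space are arbitrary off its carrier, except
  that functionals are normalised to be 0 there, so that they form an additive group.
\<close>

record ('k, 'v) nspace =
  carrier :: "'v set"
  scale :: "'k \<Rightarrow> 'v \<Rightarrow> 'v"
  nrm :: "'v \<Rightarrow> real"

definition unit_ball :: "('k, 'v) nspace \<Rightarrow> 'v set" where
  "unit_ball X = {x \<in> carrier X. nrm X x \<le> 1}"

definition unit_sphere :: "('k, 'v) nspace \<Rightarrow> 'v set" where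
  "unit_sphere X = {x \<in> carrier X. nrm X x = 1}"

definition scalar_space :: "('k::real_normed_field, 'k) nspace" where
  "scalar_space = \<lparr>carrier = UNIV, scale = (*), nrm = norm\<rparr>"

definition dual :: "('k::real_normed_field, 'v::ab_group_add) nspace \<Rightarrow> ('k, 'v \<Rightarrow> 'k) nspace" where
  "dual X = \<lparr>
     carrier = {f. (\<forall>x\<in>carrier X. \<forall>y\<in>carrier X. f (x + y) = f x + f y) \<and>
                   (\<forall>c. \<forall>x\<in>carrier X. f (scale X c x) = c * f x) \<and>
                   (\<forall>x\<in>carrier X. \<forall>e>0. \<exists>d>0. \<forall>y\<in>carrier X.
                      nrm X (y - x) < d \<longrightarrow> norm (f y - f x) < e) \<and>
                   (\<forall>x. x \<notin> carrier X \<longrightarrow> f x = 0)},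
     scale = (\<lambda>c f x. c * f x),
     nrm = (\<lambda>f. SUP x\<in>unit_ball X. norm (f x))\<rparr>"

abbreviation bidual ::
  "('k::real_normed_field, 'v::ab_group_add) nspace \<Rightarrow> ('k, ('v \<Rightarrow> 'k) \<Rightarrow> 'k) nspace" where
  "bidual X \<equiv> dual (dual X)"

definition canon ::
  "('k::real_normed_field, 'v::ab_group_add) nspace \<Rightarrow> 'v \<Rightarrow> (('v \<Rightarrow> 'k) \<Rightarrow> 'k)" where
  "canon X x = (\<lambda>f. if f \<in> carrier (dual X) then f x else 0)"

subsection \<open>Multilinear maps and homogeneous polynomials\<close>

text \<open>Elements of \<open>X \<times> \<cdots> \<times> X\<close> (\<open>N\<close> factors) are lists of length \<open>N\<close>.\<close>

definition tuples :: "nat \<Rightarrow> ('k, 'v) nspace \<Rightarrow> 'v list set" where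
  "tuples N X = {xs. length xs = N \<and> set xs \<subseteq> carrier X}"

definition multilinear ::
  "nat \<Rightarrow> ('k, 'v::ab_group_add) nspace \<Rightarrow> ('k, 'y::ab_group_add) nspace \<Rightarrow> ('v list \<Rightarrow> 'y) \<Rightarrow> bool" where
  "multilinear N X Y \<Phi> \<longleftrightarrow>
     (\<forall>xs\<in>tuples N X. \<Phi> xs \<in> carrier Y \<and>
        (\<forall>i<N. \<forall>u\<in>carrier X. \<forall>v\<in>carrier X. \<Phi> (xs[i := u + v]) = \<Phi> (xs[i := u]) + \<Phi> (xs[i := v])) \<and>
        (\<forall>i<N. \<forall>c. \<forall>u\<in>carrier X. \<Phi> (xs[i := scale X c u]) = scale Y c (\<Phi> (xs[i := u]))))"

definition continuous_multi ::
  "nat \<Rightarrow> ('k, 'v::ab_group_add) nspace \<Rightarrow> ('k, 'y::ab_group_add) nspace \<Rightarrow> ('v list \<Rightarrow> 'y) \<Rightarrow> bool" where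
  "continuous_multi N X Y \<Phi> \<longleftrightarrow>
     (\<forall>xs\<in>tuples N X. \<forall>e>0. \<exists>d>0. \<forall>ys\<in>tuples N X.
        (\<forall>i<N. nrm X (ys ! i - xs ! i) < d) \<longrightarrow> nrm Y (\<Phi> ys - \<Phi> xs) < e)"

definition symmetric_multi :: "nat \<Rightarrow> ('k, 'v) nspace \<Rightarrow> ('v list \<Rightarrow> 'y) \<Rightarrow> bool" where
  "symmetric_multi N X \<Phi> \<longleftrightarrow>
     (\<forall>xs\<in>tuples N X. \<forall>ys\<in>tuples N X. mset xs = mset ys \<longrightarrow> \<Phi> xs = \<Phi> ys)"

definition polys ::
  "nat \<Rightarrow> ('k, 'v::ab_group_add) nspace \<Rightarrow> ('k, 'y::ab_group_add) nspace \<Rightarrow> ('v \<Rightarrow> 'y) set" where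
  "polys N X Y = {P. \<exists>\<Phi>. multilinear N X Y \<Phi> \<and> continuous_multi N X Y \<Phi> \<and>
                       (\<forall>x\<in>carrier X. P x = \<Phi> (replicate N x))}"

definition poly_norm :: "('k, 'v) nspace \<Rightarrow> ('k, 'y) nspace \<Rightarrow> ('v \<Rightarrow> 'y) \<Rightarrow> real" where
  "poly_norm X Y P = (SUP x\<in>unit_ball X. nrm Y (P x))"

text \<open>The symmetric map associated to \<open>P\<close> is unique on \<^term>\<open>tuples N X\<close>, by polarization; its values
  elsewhere do not affect the Aron--Berner extension.\<close>

definition assoc_sym ::
  "nat \<Rightarrow> ('k, 'v::ab_group_add) nspace \<Rightarrow> ('k, 'y::ab_group_add) nspace \<Rightarrow> ('v \<Rightarrow> 'y) \<Rightarrow> ('v list \<Rightarrow> 'y)" where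
  "assoc_sym N X Y P = (SOME \<Phi>. multilinear N X Y \<Phi> \<and> continuous_multi N X Y \<Phi> \<and>
      symmetric_multi N X \<Phi> \<and> (\<forall>x\<in>carrier X. P x = \<Phi> (replicate N x)))"

subsection \<open>The Aron--Berner extension\<close>

text \<open>The trace on \<open>X\<close> of the weak-star neighbourhoods of \<open>z \<in> X''\<close>. It is a proper filter (Goldstine),
  and a net in \<open>X\<close> is weak-star convergent to \<open>z\<close> iff its filter of tails is finer than this one.
  So a limit along this filter is the common limit along all such nets.\<close>

definition wstar_filter ::
  "('k::real_normed_field, 'v::ab_group_add) nspace \<Rightarrow> (('v \<Rightarrow> 'k) \<Rightarrow> 'k) \<Rightarrow> 'v filter" where
  "wstar_filter X z =
     inf (principal (carrier X)) (INF f\<in>carrier (dual X). filtercomap f (nhds (z f)))"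

definition wstar_lim ::
  "('k::real_normed_field, 'y::ab_group_add) nspace \<Rightarrow> 'v filter \<Rightarrow> ('v \<Rightarrow> (('y \<Rightarrow> 'k) \<Rightarrow> 'k)) \<Rightarrow>
     (('y \<Rightarrow> 'k) \<Rightarrow> 'k)" where
  "wstar_lim Y F g = (THE z. z \<in> carrier (bidual Y) \<and>
     (\<forall>f\<in>carrier (dual Y). ((\<lambda>x. g x f) \<longlongrightarrow> z f) F))"

text \<open>The first entry of the list belongs to the outermost limit.\<close>

primrec iter_lim ::
  "('k::real_normed_field, 'v::ab_group_add) nspace \<Rightarrow> ('k, 'y::ab_group_add) nspace \<Rightarrow>
     (('v \<Rightarrow> 'k) \<Rightarrow> 'k) list \<Rightarrow> ('v list \<Rightarrow> 'y) \<Rightarrow> (('y \<Rightarrow> 'k) \<Rightarrow> 'k)" where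
  "iter_lim X Y [] \<Phi> = canon Y (\<Phi> [])"
| "iter_lim X Y (z # zs) \<Phi> =
     wstar_lim Y (wstar_filter X z) (\<lambda>x. iter_lim X Y zs (\<lambda>xs. \<Phi> (x # xs)))"

definition aron_berner ::
  "nat \<Rightarrow> ('k::real_normed_field, 'v::ab_group_add) nspace \<Rightarrow> ('k, 'y::ab_group_add) nspace \<Rightarrow>
     ('v \<Rightarrow> 'y) \<Rightarrow> (('v \<Rightarrow> 'k) \<Rightarrow> 'k) \<Rightarrow> (('y \<Rightarrow> 'k) \<Rightarrow> 'k)" where
  "aron_berner N X Y P z = iter_lim X Y (replicate N z) (assoc_sym N X Y P)"

definition lindenstrauss_bollobas ::
  "nat \<Rightarrow> ('k::real_normed_field, 'v::ab_group_add) nspace \<Rightarrow> ('k, 'y::ab_group_add) nspace \<Rightarrow> bool" where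
  "lindenstrauss_bollobas N X Y \<longleftrightarrow>
     (\<exists>\<eta> \<beta> :: real \<Rightarrow> real.
        (\<forall>\<epsilon>>0. \<eta> \<epsilon> > 0 \<and> \<beta> \<epsilon> > 0) \<and> (\<beta> \<longlongrightarrow> 0) (at_right 0) \<and>
        (\<forall>\<epsilon>>0. \<forall>Q\<in>polys N X Y. \<forall>x\<in>unit_sphere X.
           poly_norm X Y Q = 1 \<and> nrm Y (Q x) > 1 - \<eta> \<epsilon> \<longrightarrow>
           (\<exists>P\<in>polys N X Y. \<exists>a\<in>unit_sphere (bidual X).
              poly_norm X Y P = 1 \<and>
              nrm (bidual Y) (aron_berner N X Y P a) = 1 \<and>
              nrm (bidual X) (a - canon X x) < \<beta> \<epsilon> \<and>
              poly_norm X Y (\<lambda>u. P u - Q u) < \<epsilon>)))"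

subsection \<open>Sequence spaces\<close>

text \<open>Sequences are indexed from 0: the term \<open>w\<^sub>i\<close> (\<open>i \<ge> 1\<close>) of the usual notation is \<open>w (i - 1)\<close>.\<close>

definition admissible :: "(nat \<Rightarrow> real) \<Rightarrow> bool" where
  "admissible w \<longleftrightarrow> decseq w \<and> (\<forall>i. w i \<ge> 0) \<and> w 0 = 1 \<and> w \<longlonglongrightarrow> 0 \<and> \<not> summable w"

text \<open>The usual decreasing rearrangement \<open>x\<^sup>*(n) = inf {t \<ge> 0. #{i. |x(i)| > t} < n}\<close>, shifted to
  indices starting at 0.\<close>

definition decr_rearr :: "(nat \<Rightarrow> 'k::real_normed_field) \<Rightarrow> nat \<Rightarrow> real" where
  "decr_rearr x n = Inf {t. t \<ge> 0 \<and> finite {i. norm (x i) > t} \<and> card {i. norm (x i) > t} \<le> n}"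

definition lorentz_quot :: "(nat \<Rightarrow> real) \<Rightarrow> (nat \<Rightarrow> 'k::real_normed_field) \<Rightarrow> nat \<Rightarrow> real" where
  "lorentz_quot w x n = (\<Sum>i<n. decr_rearr x i) / (\<Sum>i<n. w i)"

definition d_upper :: "(nat \<Rightarrow> real) \<Rightarrow> ('k::real_normed_field, nat \<Rightarrow> 'k) nspace" where
  "d_upper w = \<lparr>
     carrier = {x. bounded (range x) \<and> bdd_above (lorentz_quot w x ` {1..})},
     scale = (\<lambda>c x i. c * x i),
     nrm = (\<lambda>x. SUP n\<in>{1..}. lorentz_quot w x n)\<rparr>"

definition d_lower :: "(nat \<Rightarrow> real) \<Rightarrow> ('k::real_normed_field, nat \<Rightarrow> 'k) nspace" where
  "d_lower w = (d_upper w)\<lparr>carrier := {x \<in> carrier (d_upper w). lorentz_quot w x \<longlonglongrightarrow> 0}\<rparr>"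

definition ell :: "nat \<Rightarrow> ('k::real_normed_field, nat \<Rightarrow> 'k) nspace" where
  "ell m = \<lparr>
     carrier = {x. summable (\<lambda>i. norm (x i) ^ m)},
     scale = (\<lambda>c x i. c * x i),
     nrm = (\<lambda>x. root m (\<Sum>i. norm (x i) ^ m))\<rparr>"

end

theory Submission
  imports Defs "HOL-Combinatorics.Permutations"
begin

text \<open>
  In \<open>d\<^sub>*(w,1)\<close> a point \<open>a\<close> of the unit sphere of the bidual that is close to the space stays in the
  unit ball when it is moved by a small multiple, bounded independently of \<open>k\<close>, of any unit vector
  \<open>e\<^sub>k\<close> with \<open>k\<close> large. Approximating \<open>a\<close> by averages \<open>y\<close> of its truncations (as in the Davie--Gamelin
  theorem), one may replace the value of the Aron--Berner extension of \<open>P\<close> at \<open>a\<close> by \<open>P(y)\<close> with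
  \<open>\<parallel>P(y)\<parallel> > 1 - \<eta>\<close>, while \<open>\<parallel>y + t e\<^sub>k\<parallel> \<le> 1\<close> holds for \<open>0 \<le> t \<le> \<delta>\<close> with \<open>\<delta>\<close> independent of \<open>\<eta>\<close>.
  Let \<open>Q(x) = x\<^sub>1\<^sup>N\<^sup>-\<^sup>M \<Sum>\<^sub>i x\<^sub>i\<^sup>M\<close> in the scalar case and \<open>Q(x) = x\<^sub>1\<^sup>N\<^sup>-\<^sup>1 x\<close> in the \<open>\<ell>\<^sub>M\<close>-valued case,
  normalised, with the truncations of \<open>w\<close> as almost maximal points. If \<open>P\<close> is close to \<open>Q\<close>, then
  \<open>P(y + t e\<^sub>k)\<close> is a polynomial in \<open>t\<close> whose coefficients of degree \<open>1 \<le> j < M\<close>, apart from the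
  explicit ones of \<open>Q\<close>, tend to \<open>0\<close> (weakly) as \<open>k \<rightarrow> \<infinity>\<close>, because \<open>w \<notin> \<ell>\<^sub>j\<close>; the remaining ones are of
  size \<open>\<parallel>P - Q\<parallel>\<close>. So \<open>\<parallel>P(y + t e\<^sub>k)\<parallel>\<close> exceeds \<open>1\<close> by a multiple of \<open>t\<^sup>M\<close> for \<open>\<eta>\<close> small and \<open>k\<close> large.
  Only positive real \<open>t\<close> occur, so real and complex scalars are treated alike.
\<close>

section \<open>Normed spaces given by carriers\<close>

text \<open>The Aron--Berner extension is in general not weak-star continuous, so the values of
  \<open>P\<close> at truncations of \<open>a\<close> need not approach its value at
  \<open>a\<close>. Averaging repairs this: \<open>a\<close> is exchanged for \<open>L\<close>
  truncations in steps of size \<open>1 / L\<close>. In one step the linear term is made small by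
  weak-star convergence and the rest is of order \<open>1 / L^2\<close>, so all \<open>L\<close>
  steps cost only order \<open>1 / L\<close>. The expansion behind a step needs a symmetric
  extension; symmetry may fail on the bidual but holds on the span of \<open>X\<close> and
  \<open>a\<close>. That truncations converge weak-star rests on the unit vector basis being
  shrinking, which a gliding hump shows. The order of choices carries the contradiction: the slack
  \<open>\<delta>\<close> depends on the coordinates of \<open>a\<close> alone, then
  \<open>t\<close> is fixed, and only then \<open>\<eta>\<close> is taken as a small multiple of
  \<open>t ^ M\<close>. Every \<open>y\<close> is dominated coordinatewise by \<open>a\<close> and
  so inherits \<open>\<delta>\<close>. For values in \<open>ell M\<close> the new coordinate has
  size of order \<open>t\<close>; it is disjoint from the coordinates that carry almost all of
  \<open>P y\<close>, so it enters the norm through its \<open>M\<close>-th power.\<close>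

locale normed_space =
  fixes X :: "('k::real_normed_field, 'v::ab_group_add) nspace"
  assumes zero_closed [simp]: "0 \<in> carrier X"
    and add_closed [simp]: "x \<in> carrier X \<Longrightarrow> y \<in> carrier X \<Longrightarrow> x + y \<in> carrier X"
    and scale_closed [simp]: "x \<in> carrier X \<Longrightarrow> scale X c x \<in> carrier X"
    and scale_add_right: "x \<in> carrier X \<Longrightarrow> y \<in> carrier X \<Longrightarrow> scale X c (x + y) = scale X c x + scale X c y"
    and scale_add_left: "x \<in> carrier X \<Longrightarrow> scale X (c + d) x = scale X c x + scale X d x"
    and scale_scale: "x \<in> carrier X \<Longrightarrow> scale X c (scale X d x) = scale X (c * d) x"
    and scale_one [simp]: "x \<in> carrier X \<Longrightarrow> scale X 1 x = x"
    and nrm_scale: "x \<in> carrier X \<Longrightarrow> nrm X (scale X c x) = norm c * nrm X x"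
    and nrm_add: "x \<in> carrier X \<Longrightarrow> y \<in> carrier X \<Longrightarrow> nrm X (x + y) \<le> nrm X x + nrm X y"
begin

lemma scale_zero_left [simp]: "x \<in> carrier X \<Longrightarrow> scale X 0 x = 0"
  using scale_add_left[of x 0 0] by simp

lemma scale_minus_one: "x \<in> carrier X \<Longrightarrow> scale X (- 1) x = - x"
  using scale_add_left[of x "-1" 1] by (simp add: eq_neg_iff_add_eq_0)

lemma uminus_closed [simp]: "x \<in> carrier X \<Longrightarrow> - x \<in> carrier X"
  using scale_closed scale_minus_one by metis

lemma diff_closed [simp]: "x \<in> carrier X \<Longrightarrow> y \<in> carrier X \<Longrightarrow> x - y \<in> carrier X"
  using add_closed[of x "- y"] by simp

lemma scale_zero_right [simp]: "scale X c 0 = 0"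
  using scale_add_right[of 0 0 c] by simp

lemma scale_minus_right: "x \<in> carrier X \<Longrightarrow> scale X c (- x) = - scale X c x"
  using scale_add_right[of x "- x" c] by (simp add: eq_neg_iff_add_eq_0 add.commute)

lemma scale_diff_right:
  "x \<in> carrier X \<Longrightarrow> y \<in> carrier X \<Longrightarrow> scale X c (x - y) = scale X c x - scale X c y"
  using scale_add_right[of x "- y" c] by (simp add: scale_minus_right)

lemma scale_diff_left: "x \<in> carrier X \<Longrightarrow> scale X (c - d) x = scale X c x - scale X d x"
  using scale_add_left[of x "c - d" d] by simp

lemma nrm_zero [simp]: "nrm X 0 = 0"
  using nrm_scale[of 0 0] by simp

lemma nrm_minus: "x \<in> carrier X \<Longrightarrow> nrm X (- x) = nrm X x"
  using nrm_scale[of x "-1"] by (simp add: scale_minus_one)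

lemma nrm_nonneg [simp]: "x \<in> carrier X \<Longrightarrow> 0 \<le> nrm X x"
  using nrm_add[of x "- x"] by (simp add: nrm_minus)

lemma nrm_diff: "x \<in> carrier X \<Longrightarrow> y \<in> carrier X \<Longrightarrow> nrm X (x - y) \<le> nrm X x + nrm X y"
  using nrm_add[of x "- y"] by (simp add: nrm_minus)

lemma nrm_diff_ge: "x \<in> carrier X \<Longrightarrow> y \<in> carrier X \<Longrightarrow> nrm X x - nrm X y \<le> nrm X (x + y)"
  using nrm_diff[of "x + y" y] by simp

lemma sum_closed [simp]: "(\<And>i. i \<in> A \<Longrightarrow> f i \<in> carrier X) \<Longrightarrow> sum f A \<in> carrier X"
  by (induction A rule: infinite_finite_induct) auto

lemma nrm_sum: "(\<And>i. i \<in> A \<Longrightarrow> f i \<in> carrier X) \<Longrightarrow> nrm X (sum f A) \<le> (\<Sum>i\<in>A. nrm X (f i))"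
proof (induction A rule: infinite_finite_induct)
  case (insert a A)
  then show ?case using nrm_add[of "f a" "sum f A"] by auto
qed auto

lemma scale_sum:
  "(\<And>i. i \<in> A \<Longrightarrow> f i \<in> carrier X) \<Longrightarrow> scale X c (sum f A) = (\<Sum>i\<in>A. scale X c (f i))"
  by (induction A rule: infinite_finite_induct) (auto simp: scale_add_right)

lemma unit_ball_iff: "x \<in> unit_ball X \<longleftrightarrow> x \<in> carrier X \<and> nrm X x \<le> 1"
  by (simp add: unit_ball_def)

lemma zero_in_unit_ball [simp]: "0 \<in> unit_ball X"
  by (simp add: unit_ball_iff)

lemma unit_ball_nonempty [simp]: "unit_ball X \<noteq> {}"
  using zero_in_unit_ball by blast

text \<open>Dividing by an upper bound \<open>r > 0\<close> instead of the norm covers vectors of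
  norm 0. Bounds known on the unit ball are carried to other vectors in this way.\<close>

lemma rescale:
  assumes "x \<in> carrier X" "nrm X x \<le> r" "r > 0"
  shows "scale X (of_real (1 / r)) x \<in> unit_ball X"
    and "scale X (of_real r) (scale X (of_real (1 / r)) x) = x"
proof -
  show "scale X (of_real (1 / r)) x \<in> unit_ball X"
    using assms by (simp add: unit_ball_iff nrm_scale norm_divide)
  have "of_real r * of_real (1 / r) = (1 :: 'k)"
    using assms(3) by (simp flip: of_real_mult)
  then show "scale X (of_real r) (scale X (of_real (1 / r)) x) = x"
    using assms by (simp add: scale_scale)
qed

end

lemma normed_space_scalar: "normed_space (scalar_space :: ('k::real_normed_field, 'k) nspace)"
  by unfold_locales (auto simp: scalar_space_def algebra_simps norm_mult norm_triangle_ineq)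

lemma carrier_scalar [simp]: "carrier scalar_space = UNIV"
  and scale_scalar [simp]: "scale scalar_space = (*)"
  and nrm_scalar [simp]: "nrm scalar_space = norm"
  by (simp_all add: scalar_space_def)

section \<open>Duals\<close>

context normed_space
begin

lemma dual_add: "f \<in> carrier (dual X) \<Longrightarrow> x \<in> carrier X \<Longrightarrow> y \<in> carrier X \<Longrightarrow> f (x + y) = f x + f y"
  by (simp add: dual_def)

lemma dual_scale: "f \<in> carrier (dual X) \<Longrightarrow> x \<in> carrier X \<Longrightarrow> f (scale X c x) = c * f x"
  by (simp add: dual_def)

lemma dual_outside: "f \<in> carrier (dual X) \<Longrightarrow> x \<notin> carrier X \<Longrightarrow> f x = 0"
  by (simp add: dual_def)

lemma dual_zero: "f \<in> carrier (dual X) \<Longrightarrow> f 0 = 0"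
  using dual_add[of f 0 0] by simp

lemma dual_diff:
  assumes "f \<in> carrier (dual X)" "x \<in> carrier X" "y \<in> carrier X"
  shows "f (x - y) = f x - f y"
  using dual_add[OF assms(1), of "x - y" y] assms by simp

lemma dual_sum:
  assumes "f \<in> carrier (dual X)" "\<And>i. i \<in> A \<Longrightarrow> g i \<in> carrier X"
  shows "f (sum g A) = (\<Sum>i\<in>A. f (g i))"
  using assms(2)
  by (induction A rule: infinite_finite_induct) (auto simp: dual_add[OF assms(1)] dual_zero[OF assms(1)])

lemma dual_bound_exists:
  assumes "f \<in> carrier (dual X)"
  shows "\<exists>C>0. \<forall>x\<in>unit_ball X. norm (f x) \<le> C"
proof -
  have "\<forall>x\<in>carrier X. \<forall>e>0. \<exists>d>0. \<forall>y\<in>carrier X. nrm X (y - x) < d \<longrightarrow> norm (f y - f x) < e"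
    using assms by (simp add: dual_def)
  then obtain d where d: "d > 0" "\<And>y. y \<in> carrier X \<Longrightarrow> nrm X (y - 0) < d \<Longrightarrow> norm (f y - f 0) < 1"
    by (meson zero_closed zero_less_one)
  have "norm (f x) \<le> 2 / d" if x: "x \<in> unit_ball X" for x
  proof -
    have xc: "x \<in> carrier X" "nrm X x \<le> 1" using x by (auto simp: unit_ball_iff)
    have "nrm X (scale X (of_real (d / 2)) x) \<le> d / 2 * 1"
      unfolding nrm_scale[OF xc(1)] norm_of_real using d(1) xc by (intro mult_mono) auto
    then have "norm (f (scale X (of_real (d / 2)) x)) < 1"
      using d(2)[of "scale X (of_real (d / 2)) x"] d(1) xc by (simp add: dual_zero[OF assms])
    then have "norm (of_real (d / 2) * f x) < 1"
      using dual_scale[OF assms xc(1)] by simp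
    then show ?thesis using d(1) unfolding norm_mult norm_of_real by (simp add: field_simps)
  qed
  then show ?thesis using d(1) by (intro exI[of _ "2 / d"]) auto
qed

lemma dual_bdd_above: "f \<in> carrier (dual X) \<Longrightarrow> bdd_above ((\<lambda>x. norm (f x)) ` unit_ball X)"
  using dual_bound_exists by (auto simp: bdd_above_def)

lemma dual_nrm_eq: "nrm (dual X) f = (SUP x\<in>unit_ball X. norm (f x))"
  by (simp add: dual_def)

lemma dual_nrm_leI: "(\<And>x. x \<in> unit_ball X \<Longrightarrow> norm (f x) \<le> r) \<Longrightarrow> nrm (dual X) f \<le> r"
  unfolding dual_nrm_eq by (intro cSUP_least) auto

lemma dual_nrm_upper: "f \<in> carrier (dual X) \<Longrightarrow> x \<in> unit_ball X \<Longrightarrow> norm (f x) \<le> nrm (dual X) f"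
  unfolding dual_nrm_eq using dual_bdd_above by (intro cSUP_upper) auto

lemma dual_bound_scaled:
  assumes "f \<in> carrier (dual X)" "\<And>x. x \<in> unit_ball X \<Longrightarrow> norm (f x) \<le> C"
    "x \<in> carrier X" "nrm X x \<le> r" "r > 0"
  shows "norm (f x) \<le> C * r"
proof -
  let ?y = "scale X (of_real (1 / r)) x"
  have "f x = of_real r * f ?y"
    using rescale[OF assms(3-5)] dual_scale[OF assms(1), of ?y "of_real r"] assms(3) by auto
  then have "norm (f x) = r * norm (f ?y)" using assms(5) by (simp add: norm_mult)
  also have "\<dots> \<le> r * C" using assms(2)[OF rescale(1)[OF assms(3-5)]] assms(5) by simp
  finally show ?thesis by (simp add: mult.commute)
qed

lemma dual_le:
  assumes "f \<in> carrier (dual X)" "x \<in> carrier X"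
  shows "norm (f x) \<le> nrm (dual X) f * nrm X x"
proof -
  have n: "nrm (dual X) f \<ge> 0"
    using dual_nrm_upper[OF assms(1) zero_in_unit_ball] norm_ge_zero order_trans by blast
  \<comment> \<open>\<open>nrm X x\<close> may vanish, so the scaling uses the positive number
    \<open>nrm X x + e\<close>; the surplus is removed afterwards.\<close>
  have "norm (f x) \<le> nrm (dual X) f * nrm X x + nrm (dual X) f * e" if "e > 0" for e
    using dual_bound_scaled[OF assms(1) dual_nrm_upper[OF assms(1)] assms(2), of "nrm X x + e"] that
      nrm_nonneg[OF assms(2)] by (simp add: algebra_simps)
  note * = this
  show ?thesis
  proof (cases "nrm (dual X) f = 0")
    case True
    then show ?thesis using *[of 1] by simp
  next
    case False
    show ?thesis
    proof (rule field_le_epsilon)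
      fix e :: real assume "e > 0"
      then show "norm (f x) \<le> nrm (dual X) f * nrm X x + e"
        using *[of "e / nrm (dual X) f"] False n by simp
    qed
  qed
qed

text \<open>A linear map bounded on the unit ball is Lipschitz, which gives the continuity clause of
  \<open>dual\<close>. Functionals built below all come with such a bound.\<close>

lemma dualI:
  assumes add: "\<And>x y. x \<in> carrier X \<Longrightarrow> y \<in> carrier X \<Longrightarrow> f (x + y) = f x + f y"
    and scale: "\<And>c x. x \<in> carrier X \<Longrightarrow> f (scale X c x) = c * f x"
    and bound: "\<And>x. x \<in> unit_ball X \<Longrightarrow> norm (f x) \<le> C"
    and out: "\<And>x. x \<notin> carrier X \<Longrightarrow> f x = 0"
  shows "f \<in> carrier (dual X)"
proof -
  have "\<exists>d>0. \<forall>y\<in>carrier X. nrm X (y - x) < d \<longrightarrow> norm (f y - f x) < e"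
    if x: "x \<in> carrier X" and e: "e > 0" for x e
  proof -
    have C: "C \<ge> 0" using bound[OF zero_in_unit_ball] norm_ge_zero order_trans by blast
    let ?d = "e / (C + 1)"
    have d: "?d > 0" using C e by simp
    have "norm (f y - f x) < e" if y: "y \<in> carrier X" "nrm X (y - x) < ?d" for y
    proof -
      have yx: "y - x \<in> carrier X" using x y by simp
      have r: "nrm X (y - x) \<le> ?d" using y by simp
      let ?z = "scale X (of_real (1 / ?d)) (y - x)"
      have "f y = f (y - x) + f x" using add[OF yx x] by simp
      then have "f y - f x = f (y - x)" by simp
      also have "\<dots> = of_real ?d * f ?z"
        using rescale(2)[OF yx r d] scale[of ?z "of_real ?d"] yx by (metis scale_closed)
      finally have "norm (f y - f x) = ?d * norm (f ?z)"
        using d by (simp only: norm_mult norm_of_real abs_of_pos)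
      also have "\<dots> \<le> ?d * C" by (rule mult_left_mono[OF bound[OF rescale(1)[OF yx r d]]]) (use d in simp)
      also have "\<dots> < e" using e C by (simp add: field_simps)
      finally show ?thesis .
    qed
    then show ?thesis using d by blast
  qed
  then show ?thesis using add scale out by (simp add: dual_def)
qed

lemma normed_space_dual: "normed_space (dual X)"
proof
  let ?D = "dual X"
  have sc: "scale ?D c f = (\<lambda>x. c * f x)" for c f by (simp add: dual_def)
  show "0 \<in> carrier ?D" by (rule dualI[where C = 0]) auto
  fix f assume f: "f \<in> carrier ?D"
  obtain C where C: "\<And>x. x \<in> unit_ball X \<Longrightarrow> norm (f x) \<le> C" using dual_bound_exists[OF f] by auto
  show scf: "scale ?D c f \<in> carrier ?D" for c
    by (rule dualI[where C = "norm c * C"])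
       (auto simp: sc distrib_left mult.left_commute dual_add[OF f] dual_scale[OF f] dual_outside[OF f]
         norm_mult intro!: mult_left_mono C)
  show "scale ?D (c + d) f = scale ?D c f + scale ?D d f" for c d
    by (auto simp: sc algebra_simps)
  show "scale ?D c (scale ?D d f) = scale ?D (c * d) f" for c d
    by (auto simp: sc algebra_simps)
  show "scale ?D 1 f = f" by (simp add: sc)
  have le: "nrm ?D (scale ?D c g) \<le> norm c * nrm ?D g" if "g \<in> carrier ?D" for c g
    using dual_nrm_upper[OF that]
    by (intro dual_nrm_leI) (auto simp: sc norm_mult intro!: mult_left_mono)
  show "nrm ?D (scale ?D c f) = norm c * nrm ?D f" for c
  proof (cases "c = 0")
    case True
    have "nrm ?D (scale ?D 0 f) = 0"
      unfolding dual_nrm_eq sc by simp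
    then show ?thesis using True by simp
  next
    case False
    have "nrm ?D f \<le> norm (inverse c) * nrm ?D (scale ?D c f)"
      using le[OF scf, of "inverse c" c] False by (simp add: sc flip: mult.assoc)
    then have "norm c * nrm ?D f \<le> nrm ?D (scale ?D c f)"
      using False by (simp add: norm_inverse norm_divide field_simps)
    then show ?thesis using le[OF f, of c] by simp
  qed
  fix g assume g: "g \<in> carrier ?D"
  obtain C' where C': "\<And>x. x \<in> unit_ball X \<Longrightarrow> norm (g x) \<le> C'" using dual_bound_exists[OF g] by auto
  show "f + g \<in> carrier ?D"
  proof (rule dualI[where C = "C + C'"])
    show "norm ((f + g) x) \<le> C + C'" if "x \<in> unit_ball X" for x
      using norm_triangle_mono[OF C[OF that] C'[OF that]] by simp
  qed (simp_all add: algebra_simps dual_add[OF f] dual_scale[OF f] dual_outside[OF f]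
        dual_add[OF g] dual_scale[OF g] dual_outside[OF g])
  show "scale ?D c (f + g) = scale ?D c f + scale ?D c g" for c
    by (auto simp: sc algebra_simps)
  show "nrm ?D (f + g) \<le> nrm ?D f + nrm ?D g"
    using dual_nrm_upper[OF f] dual_nrm_upper[OF g]
    by (intro dual_nrm_leI) (auto intro!: norm_triangle_mono)
qed

lemma scale_dual [simp]: "scale (dual X) c f = (\<lambda>x. c * f x)"
  by (simp add: dual_def)

lemma canon_apply [simp]: "f \<in> carrier (dual X) \<Longrightarrow> canon X x f = f x"
  by (simp add: canon_def)

lemma canon_bidual:
  assumes "x \<in> carrier X"
  shows "canon X x \<in> carrier (bidual X)"
proof -
  interpret D: normed_space "dual X" by (rule normed_space_dual)
  show ?thesis
  proof (rule D.dualI[where C = "nrm X x"])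
    fix f assume f: "f \<in> unit_ball (dual X)"
    then have "norm (f x) \<le> nrm (dual X) f * nrm X x" "nrm (dual X) f \<le> 1"
      using dual_le assms by (auto simp: D.unit_ball_iff)
    then show "norm (canon X x f) \<le> nrm X x"
      using f mult_right_mono[of "nrm (dual X) f" 1 "nrm X x"] assms
      by (auto simp: D.unit_ball_iff)
  next
    fix f g assume "f \<in> carrier (dual X)" "g \<in> carrier (dual X)"
    then show "canon X x (f + g) = canon X x f + canon X x g"
      using D.add_closed[of f g] by simp
  next
    fix c f assume "f \<in> carrier (dual X)"
    then show "canon X x (scale (dual X) c f) = c * canon X x f"
      using D.scale_closed[of f c] by simp
  qed (simp add: canon_def)
qed

lemma nrm_canon_le:
  assumes "x \<in> carrier X"
  shows "nrm (bidual X) (canon X x) \<le> nrm X x"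
proof -
  interpret D: normed_space "dual X" by (rule normed_space_dual)
  show ?thesis
  proof (rule D.dual_nrm_leI)
    fix f assume f: "f \<in> unit_ball (dual X)"
    then have "norm (f x) \<le> nrm (dual X) f * nrm X x" "nrm (dual X) f \<le> 1"
      using dual_le assms by (auto simp: D.unit_ball_iff)
    then show "norm (canon X x f) \<le> nrm X x"
      using f mult_right_mono[of "nrm (dual X) f" 1 "nrm X x"] assms
      by (auto simp: D.unit_ball_iff)
  qed
qed

end

section \<open>Bounded symmetric multilinear maps\<close>

lemma tuples_Nil [simp]: "[] \<in> tuples N X \<longleftrightarrow> N = 0"
  by (auto simp: tuples_def)

lemma tuples_Cons [simp]: "x # xs \<in> tuples (Suc N) X \<longleftrightarrow> x \<in> carrier X \<and> xs \<in> tuples N X"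
  by (auto simp: tuples_def)

lemma tuples_update: "xs \<in> tuples N X \<Longrightarrow> u \<in> carrier X \<Longrightarrow> xs[i := u] \<in> tuples N X"
  using set_update_subset_insert[of xs i u] by (auto simp: tuples_def)

text \<open>The quantitative form of continuity: unlike \<open>continuous_multi\<close> it carries a
  constant, which can be followed when arguments are fixed, symmetrized or extended to the
  bidual.\<close>

definition ball_bounded ::
  "nat \<Rightarrow> ('k, 'v) nspace \<Rightarrow> ('k, 'y) nspace \<Rightarrow> real \<Rightarrow> ('v list \<Rightarrow> 'y) \<Rightarrow> bool" where
  "ball_bounded N X Y C \<Phi> \<longleftrightarrow> (\<forall>xs. length xs = N \<and> set xs \<subseteq> unit_ball X \<longrightarrow> nrm Y (\<Phi> xs) \<le> C)"

lemma ball_boundedD: "ball_bounded N X Y C \<Phi> \<Longrightarrow> length xs = N \<Longrightarrow> set xs \<subseteq> unit_ball X \<Longrightarrow> nrm Y (\<Phi> xs) \<le> C"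
  by (simp add: ball_bounded_def)

lemma multilinear_closed: "multilinear N X Y \<Phi> \<Longrightarrow> xs \<in> tuples N X \<Longrightarrow> \<Phi> xs \<in> carrier Y"
  by (simp add: multilinear_def)

lemma multilinear_add:
  assumes "multilinear N X Y \<Phi>" "xs @ u # ys \<in> tuples N X" "v \<in> carrier X"
  shows "\<Phi> (xs @ (u + v) # ys) = \<Phi> (xs @ u # ys) + \<Phi> (xs @ v # ys)"
proof -
  have "length xs < N" "u \<in> carrier X" using assms(2) by (auto simp: tuples_def)
  then have "\<Phi> ((xs @ u # ys)[length xs := u + v]) =
      \<Phi> ((xs @ u # ys)[length xs := u]) + \<Phi> ((xs @ u # ys)[length xs := v])"
    using assms unfolding multilinear_def by blast
  then show ?thesis by simp
qed

lemma multilinear_scale: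
  assumes "multilinear N X Y \<Phi>" "xs @ u # ys \<in> tuples N X"
  shows "\<Phi> (xs @ scale X c u # ys) = scale Y c (\<Phi> (xs @ u # ys))"
proof -
  have "length xs < N" "u \<in> carrier X" using assms(2) by (auto simp: tuples_def)
  then have "\<Phi> ((xs @ u # ys)[length xs := scale X c u]) = scale Y c (\<Phi> ((xs @ u # ys)[length xs := u]))"
    using assms unfolding multilinear_def by blast
  then show ?thesis by simp
qed

text \<open>Splitting a list at the varying slot behaves better under \<open>#\<close> and
  \<open>@\<close> than the list update in \<open>multilinear\<close>.\<close>

lemma multilinearI:
  assumes closed: "\<And>xs. xs \<in> tuples N X \<Longrightarrow> \<Phi> xs \<in> carrier Y"
    and add: "\<And>xs ys u v. xs @ u # ys \<in> tuples N X \<Longrightarrow> v \<in> carrier X \<Longrightarrow>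
      \<Phi> (xs @ (u + v) # ys) = \<Phi> (xs @ u # ys) + \<Phi> (xs @ v # ys)"
    and scale: "\<And>xs ys u c. xs @ u # ys \<in> tuples N X \<Longrightarrow>
      \<Phi> (xs @ scale X c u # ys) = scale Y c (\<Phi> (xs @ u # ys))"
  shows "multilinear N X Y \<Phi>"
  unfolding multilinear_def
proof (intro ballI conjI allI impI)
  fix xs i u assume *: "xs \<in> tuples N X" "i < N" "u \<in> carrier X"
  have eq: "xs[i := z] = take i xs @ z # drop (Suc i) xs" for z
    using * by (simp add: tuples_def upd_conv_take_nth_drop)
  have t: "take i xs @ u # drop (Suc i) xs \<in> tuples N X"
    using tuples_update[OF *(1,3), of i] by (simp add: eq)
  show "\<Phi> (xs[i := u + v]) = \<Phi> (xs[i := u]) + \<Phi> (xs[i := v])" if "v \<in> carrier X" for v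
    unfolding eq using add[OF t that] .
  show "\<Phi> (xs[i := scale X c u]) = scale Y c (\<Phi> (xs[i := u]))" for c
    unfolding eq using scale[OF t] .
qed (use closed in auto)

lemma multilinear_one:
  assumes "\<And>x. x \<in> carrier X \<Longrightarrow> f x \<in> carrier Y"
    and "\<And>x y. x \<in> carrier X \<Longrightarrow> y \<in> carrier X \<Longrightarrow> f (x + y) = f x + f y"
    and "\<And>c x. x \<in> carrier X \<Longrightarrow> f (scale X c x) = scale Y c (f x)"
  shows "multilinear (Suc 0) X Y (\<lambda>xs. f (hd xs))"
  by (rule multilinearI)
     (auto simp: tuples_def length_Suc_conv append_eq_Cons_conv Cons_eq_append_conv assms)

lemma multilinear_Cons:
  assumes "multilinear (Suc N) X Y \<Phi>" "x \<in> carrier X"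
  shows "multilinear N X Y (\<lambda>xs. \<Phi> (x # xs))"
  using multilinear_closed[OF assms(1), of "x # _"] multilinear_add[OF assms(1), of "x # _"]
    multilinear_scale[OF assms(1), of "x # _"] assms(2)
  by (intro multilinearI) auto

lemma multilinear_append:
  assumes "multilinear (length us + N) X Y \<Phi>" "set us \<subseteq> carrier X"
  shows "multilinear N X Y (\<lambda>xs. \<Phi> (us @ xs))"
  using assms
proof (induction us arbitrary: \<Phi>)
  case (Cons u us)
  then have "multilinear (length us + N) X Y (\<lambda>xs. \<Phi> (u # xs))"
    using multilinear_Cons[of "length us + N" X Y \<Phi> u] by simp
  from Cons.IH[OF this] Cons.prems show ?case by simp
qed auto

lemma ball_bounded_append:
  assumes "ball_bounded (length us + N) X Y C \<Phi>" "set us \<subseteq> unit_ball X"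
  shows "ball_bounded N X Y C (\<lambda>xs. \<Phi> (us @ xs))"
  using assms by (auto simp: ball_bounded_def)

locale normed_pair = X: normed_space X + Y: normed_space Y
  for X :: "('k::real_normed_field, 'v::ab_group_add) nspace"
    and Y :: "('k, 'y::ab_group_add) nspace"
begin

text \<open>The untouched prefix \<open>us\<close> drives the induction, and it later holds the base
  point while only the copies of the increment are scaled.\<close>

lemma multilinear_scale_map:
  assumes "multilinear N X Y \<Phi>" "us @ xs \<in> tuples N X"
  shows "\<Phi> (us @ map (scale X c) xs) = scale Y (c ^ length xs) (\<Phi> (us @ xs))"
  using assms(2)
proof (induction xs arbitrary: us)
  case Nil
  then show ?case using multilinear_closed[OF assms(1)] by simp
next
  case (Cons x xs)
  then have "us @ scale X c x # xs \<in> tuples N X" by (auto simp: tuples_def)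
  then have "\<Phi> (us @ map (scale X c) (x # xs)) = scale Y (c ^ length xs) (\<Phi> (us @ scale X c x # xs))"
    using Cons.IH[of "us @ [scale X c x]"] by simp
  also have "\<dots> = scale Y (c ^ length (x # xs)) (\<Phi> (us @ x # xs))"
    using multilinear_scale[OF assms(1) Cons.prems] multilinear_closed[OF assms(1) Cons.prems]
    by (simp add: Y.scale_scale mult.commute)
  finally show ?case .
qed

lemma multilinear_diff:
  assumes "multilinear N X Y \<Phi>" "xs @ u # ys \<in> tuples N X" "v \<in> carrier X"
  shows "\<Phi> (xs @ (u - v) # ys) = \<Phi> (xs @ u # ys) - \<Phi> (xs @ v # ys)"
proof -
  have "xs @ (u - v) # ys \<in> tuples N X" using assms(2,3) by (auto simp: tuples_def)
  from multilinear_add[OF assms(1) this assms(3)] show ?thesis by simp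
qed

lemma ball_bounded_Cons:
  assumes "multilinear (Suc N) X Y \<Phi>" "ball_bounded (Suc N) X Y C \<Phi>"
    "x \<in> carrier X" "nrm X x \<le> r" "r > 0"
  shows "ball_bounded N X Y (C * r) (\<lambda>xs. \<Phi> (x # xs))"
  unfolding ball_bounded_def
proof (intro allI impI)
  fix xs assume xs: "length xs = N \<and> set xs \<subseteq> unit_ball X"
  let ?y = "scale X (of_real (1 / r)) x"
  have t: "?y # xs \<in> tuples (Suc N) X"
    using xs assms(3) by (auto simp: tuples_def X.unit_ball_iff)
  have "\<Phi> (x # xs) = scale Y (of_real r) (\<Phi> (?y # xs))"
    using multilinear_scale[OF assms(1), of "[]" ?y xs "of_real r"] t X.rescale(2)[OF assms(3-5)] by simp
  then have "nrm Y (\<Phi> (x # xs)) = r * nrm Y (\<Phi> (?y # xs))"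
    using Y.nrm_scale multilinear_closed[OF assms(1) t] assms(5) by simp
  also have "\<dots> \<le> r * C"
    using X.rescale(1)[OF assms(3-5)] xs assms(5)
    by (intro mult_left_mono ball_boundedD[OF assms(2)]) auto
  finally show "nrm Y (\<Phi> (x # xs)) \<le> C * r" by (simp add: mult.commute)
qed

lemma ball_bounded_scaled:
  assumes "multilinear N X Y \<Phi>" "ball_bounded N X Y C \<Phi>"
    "xs \<in> tuples N X" "\<And>x. x \<in> set xs \<Longrightarrow> nrm X x \<le> r" "r > 0"
  shows "nrm Y (\<Phi> xs) \<le> C * r ^ N"
proof -
  let ?ys = "map (scale X (of_real (1 / r))) xs"
  have sub: "set xs \<subseteq> carrier X" and len: "length xs = N" using assms(3) by (auto simp: tuples_def)
  have ys: "?ys \<in> tuples N X" using sub len by (auto simp: tuples_def)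
  have "map (scale X (of_real r)) ?ys = xs"
    using sub assms(4,5) X.rescale(2) by (auto simp del: of_real_divide intro!: map_idI)
  then have "\<Phi> xs = scale Y (of_real r ^ N) (\<Phi> ?ys)"
    using multilinear_scale_map[OF assms(1), of "[]" ?ys "of_real r"] ys len by simp
  then have "nrm Y (\<Phi> xs) = r ^ N * nrm Y (\<Phi> ?ys)"
    using Y.nrm_scale multilinear_closed[OF assms(1) ys] assms(5) by (simp add: norm_power)
  also have "\<dots> \<le> r ^ N * C"
    using X.rescale(1) sub assms(4,5) len
    by (intro mult_left_mono ball_boundedD[OF assms(2)]) (auto simp del: of_real_divide)
  finally show ?thesis by (simp add: mult.commute)
qed

lemma continuous_imp_ball_bounded:
  assumes m: "multilinear N X Y \<Phi>" and "continuous_multi N X Y \<Phi>"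
  shows "\<exists>C\<ge>0. ball_bounded N X Y C \<Phi>"
proof -
  let ?z = "replicate N (0 :: 'v)"
  have z: "?z \<in> tuples N X" by (auto simp: tuples_def)
  then obtain d where d: "d > 0" "\<And>ys. ys \<in> tuples N X \<Longrightarrow> (\<forall>i<N. nrm X (ys ! i - ?z ! i) < d) \<Longrightarrow>
      nrm Y (\<Phi> ys - \<Phi> ?z) < 1"
    using assms(2) unfolding continuous_multi_def by (meson zero_less_one)
  \<comment> \<open>For \<open>N = 0\<close> the value at the tuple of zeros need not be 0, so it is
    kept in the bound.\<close>
  define K where "K = nrm Y (\<Phi> ?z) + 1"
  have K: "K \<ge> 0" using Y.nrm_nonneg[OF multilinear_closed[OF m z]] by (simp add: K_def)
  have "nrm Y (\<Phi> xs) \<le> K / (d / 2) ^ N" if xs: "length xs = N" "set xs \<subseteq> unit_ball X" for xs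
  proof -
    let ?ys = "map (scale X (of_real (d / 2))) xs"
    have xt: "xs \<in> tuples N X" using xs by (auto simp: tuples_def X.unit_ball_iff)
    have yt: "?ys \<in> tuples N X" using xt by (auto simp: tuples_def)
    have "nrm X (?ys ! i - ?z ! i) < d" if "i < N" for i
    proof -
      have "xs ! i \<in> unit_ball X" using that xs by auto
      then have "xs ! i \<in> carrier X" "d / 2 * nrm X (xs ! i) \<le> d / 2 * 1"
        using d(1) by (auto simp: X.unit_ball_iff)
      then show ?thesis using that xs(1) d(1) by (simp add: X.nrm_scale)
    qed
    then have "nrm Y (\<Phi> ?ys - \<Phi> ?z) < 1" using d(2)[OF yt] by blast
    then have "nrm Y (\<Phi> ?ys) \<le> K"
      using Y.nrm_add[of "\<Phi> ?ys - \<Phi> ?z" "\<Phi> ?z"] multilinear_closed[OF m yt] multilinear_closed[OF m z]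
      by (simp add: K_def)
    moreover have "nrm Y (\<Phi> ?ys) = (d / 2) ^ N * nrm Y (\<Phi> xs)"
      using multilinear_scale_map[OF m, of "[]" xs "of_real (d / 2)"] xt xs(1) d(1)
        Y.nrm_scale multilinear_closed[OF m xt] by (simp add: norm_power norm_divide)
    ultimately have "nrm Y (\<Phi> xs) * (d / 2) ^ N \<le> K" by (simp only: mult.commute)
    then show ?thesis using d(1) by (subst pos_le_divide_eq) auto
  qed
  then show ?thesis using K d(1) by (intro exI[of _ "K / (d / 2) ^ N"]) (auto simp: ball_bounded_def)
qed

text \<open>Telescoping: arguments are exchanged one at a time, and each of the \<open>N\<close>
  differences is the form at a tuple with one entry of norm at most \<open>d\<close>.\<close>

lemma multilinear_lipschitz:
  assumes "multilinear N X Y \<Phi>" "ball_bounded N X Y C \<Phi>" "C \<ge> 0" "r \<ge> 1" "d > 0"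
    "xs \<in> tuples N X" "ys \<in> tuples N X"
    "\<And>x. x \<in> set xs \<Longrightarrow> nrm X x \<le> r" "\<And>y. y \<in> set ys \<Longrightarrow> nrm X y \<le> r"
    "\<And>i. i < N \<Longrightarrow> nrm X (ys ! i - xs ! i) \<le> d"
  shows "nrm Y (\<Phi> ys - \<Phi> xs) \<le> N * C * r ^ N * d"
  using assms
proof (induction N arbitrary: \<Phi> C xs ys)
  case 0
  then show ?case by (simp add: tuples_def)
next
  case (Suc N)
  obtain x xs' where xs: "xs = x # xs'" using Suc.prems(6) by (cases xs) auto
  obtain y ys' where ys: "ys = y # ys'" using Suc.prems(7) by (cases ys) auto
  note m = Suc.prems(1) and b = Suc.prems(2)
  have x: "x \<in> carrier X" "xs' \<in> tuples N X" "y \<in> carrier X" "ys' \<in> tuples N X"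
    using Suc.prems(6,7) xs ys by auto
  have xr: "nrm X x \<le> r" "nrm X (y - x) \<le> d"
    using Suc.prems(8)[of x] Suc.prems(10)[of 0] xs ys by auto
  have r: "r > 0" using Suc.prems(4) by simp
  have yx: "y - x \<in> carrier X" using x by simp
  have 1: "nrm Y (\<Phi> ((y - x) # ys')) \<le> C * d * r ^ N"
    using ball_bounded_scaled[OF multilinear_Cons[OF m yx] ball_bounded_Cons[OF m b yx xr(2) Suc.prems(5)] x(4) _ r]
      Suc.prems(9) ys by auto
  have 2: "nrm Y (\<Phi> (x # ys') - \<Phi> (x # xs')) \<le> N * (C * r) * r ^ N * d"
    using Suc.prems(3-5) Suc.prems(8,9) Suc.prems(10)[of "Suc _"] xs ys x r
    by (intro Suc.IH[OF multilinear_Cons[OF m x(1)] ball_bounded_Cons[OF m b x(1) xr(1) r]]) auto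
  have c: "\<Phi> (y # ys') \<in> carrier Y" "\<Phi> (x # ys') \<in> carrier Y" "\<Phi> (x # xs') \<in> carrier Y"
    "\<Phi> ((y - x) # ys') \<in> carrier Y"
    using multilinear_closed[OF m] x by auto
  have "\<Phi> ys - \<Phi> xs = \<Phi> ((y - x) # ys') + (\<Phi> (x # ys') - \<Phi> (x # xs'))"
    using multilinear_diff[OF m, of "[]" y ys' x] x xs ys by simp
  then have "nrm Y (\<Phi> ys - \<Phi> xs) \<le> C * d * r ^ N + N * (C * r) * r ^ N * d"
    using Y.nrm_add[OF c(4) Y.diff_closed[OF c(2,3)]] 1 2 by simp
  also have "\<dots> \<le> C * d * r ^ Suc N + N * (C * r) * r ^ N * d"
    using Suc.prems(3-5) by (intro add_right_mono mult_left_mono power_increasing) auto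
  also have "\<dots> = Suc N * C * r ^ Suc N * d" by (simp add: algebra_simps)
  finally show ?case .
qed

lemma ball_bounded_imp_continuous:
  assumes m: "multilinear N X Y \<Phi>" and b: "ball_bounded N X Y C \<Phi>" and C: "C \<ge> 0"
  shows "continuous_multi N X Y \<Phi>"
  unfolding continuous_multi_def
proof (intro ballI allI impI)
  fix xs and e :: real assume xs: "xs \<in> tuples N X" and e: "e > 0"
  have sub: "set xs \<subseteq> carrier X" and len: "length xs = N" using xs by (auto simp: tuples_def)
  define r where "r = 1 + (\<Sum>x\<in>set xs. nrm X x)"
  have le: "nrm X x \<le> (\<Sum>x\<in>set xs. nrm X x)" if "x \<in> set xs" for x
    using that sub by (intro member_le_sum) auto
  have s0: "(\<Sum>x\<in>set xs. nrm X x) \<ge> 0" using sub by (intro sum_nonneg) auto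
  have r: "r \<ge> 1" using s0 by (simp add: r_def)
  define K where "K = N * C * r ^ N"
  have K: "K \<ge> 0" using C r by (simp add: K_def)
  define d where "d = min 1 (e / (K + 1))"
  have d: "d > 0" "d \<le> 1" using e K by (auto simp: d_def)
  show "\<exists>d>0. \<forall>ys\<in>tuples N X. (\<forall>i<N. nrm X (ys ! i - xs ! i) < d) \<longrightarrow> nrm Y (\<Phi> ys - \<Phi> xs) < e"
  proof (intro exI[of _ d] conjI ballI impI)
    fix ys assume ys: "ys \<in> tuples N X" "\<forall>i<N. nrm X (ys ! i - xs ! i) < d"
    have yr: "nrm X y \<le> r" if y: "y \<in> set ys" for y
    proof -
      obtain i where i: "i < N" "y = ys ! i" using y ys(1) by (auto simp: tuples_def in_set_conv_nth)
      have mem: "xs ! i \<in> carrier X" "ys ! i \<in> carrier X"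
        using i xs ys(1) by (auto simp: tuples_def subset_iff)
      have "nrm X y \<le> nrm X (ys ! i - xs ! i) + nrm X (xs ! i)"
        using X.nrm_add[of "ys ! i - xs ! i" "xs ! i"] mem i by simp
      then show ?thesis using ys(2) i d le[of "xs ! i"] len unfolding r_def by fastforce
    qed
    have "nrm Y (\<Phi> ys - \<Phi> xs) \<le> K * d"
      unfolding K_def using le r d xs ys yr unfolding r_def
      by (intro multilinear_lipschitz[OF m b C]) (auto intro: less_imp_le add_increasing)
    also have "\<dots> \<le> K * (e / (K + 1))" using K by (intro mult_left_mono) (auto simp: d_def)
    also have "\<dots> < e" using K e by (simp add: field_simps)
    finally show "nrm Y (\<Phi> ys - \<Phi> xs) < e" .
  qed (use d in auto)
qed

subsection \<open>Symmetrization\<close>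

text \<open>After a permutation the marked entry is still a single slot, now at position
  \<open>inv p (length xs)\<close>. Hence linearity in a slot survives permuting the
  arguments.\<close>

lemma permute_list_append_Cons:
  assumes "p permutes {..<N}" "length (xs @ u # ys) = N"
  shows "permute_list p (xs @ z # ys) = (permute_list p (xs @ u # ys))[inv p (length xs) := z]"
proof (rule nth_equalityI)
  have len: "length (xs @ z # ys) = N" using assms(2) by simp
  fix i assume "i < length (permute_list p (xs @ z # ys))"
  then have i: "i < N" using len by simp
  have pi: "p i < N" using permutes_in_image[OF assms(1)] i by auto
  have "inv p (length xs) = i \<longleftrightarrow> p i = length xs"
    using permutes_inv_eq[OF assms(1)] by metis
  then show "permute_list p (xs @ z # ys) ! i = (permute_list p (xs @ u # ys))[inv p (length xs) := z] ! i"
    using i pi len assms by (auto simp: permute_list_nth nth_append nth_list_update nth_Cons')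
qed simp

text \<open>The average of a form over all permutations of its slots. It shows that the choice made
  in \<open>assoc_sym\<close> is a choice from a nonempty set.\<close>

lemma polys_symmetric:
  assumes "P \<in> polys N X Y"
  shows "\<exists>\<Phi>. multilinear N X Y \<Phi> \<and> continuous_multi N X Y \<Phi> \<and>
      symmetric_multi N X \<Phi> \<and> (\<forall>x\<in>carrier X. P x = \<Phi> (replicate N x))"
proof -
  obtain \<Psi> where \<Psi>: "multilinear N X Y \<Psi>" "continuous_multi N X Y \<Psi>" "\<forall>x\<in>carrier X. P x = \<Psi> (replicate N x)"
    using assms by (auto simp: polys_def)
  obtain C where C: "C \<ge> 0" "ball_bounded N X Y C \<Psi>"
    using continuous_imp_ball_bounded[OF \<Psi>(1,2)] by blast
  define A where "A = {p. p permutes {..<N}}"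
  have A: "finite A" "card A = fact N" by (auto simp: A_def finite_permutations card_permutations)
  define \<Phi> where "\<Phi> xs = scale Y (1 / fact N) (\<Sum>p\<in>A. \<Psi> (permute_list p xs))" for xs
  have tup: "permute_list p xs \<in> tuples N X" if "p \<in> A" "xs \<in> tuples N X" for p xs
    using that by (auto simp: A_def tuples_def)
  have cl: "\<Psi> (permute_list p xs) \<in> carrier Y" if "p \<in> A" "xs \<in> tuples N X" for p xs
    using multilinear_closed[OF \<Psi>(1) tup[OF that]] .
  have upd: "\<exists>xs' ys'. \<forall>z. permute_list p (xs @ z # ys) = xs' @ z # ys'"
    if "p \<in> A" "xs @ u # ys \<in> tuples N X" for p xs ys u
  proof -
    have p: "p permutes {..<N}" and l: "length (xs @ u # ys) = N"
      using that by (auto simp: A_def tuples_def)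
    let ?i = "inv p (length xs)" and ?l = "permute_list p (xs @ u # ys)"
    have "?i < length ?l" using permutes_in_image[OF permutes_inv[OF p], of "length xs"] l by simp
    then show ?thesis
      using permute_list_append_Cons[OF p l] upd_conv_take_nth_drop[of ?i ?l] by metis
  qed
  have m: "multilinear N X Y \<Phi>"
  proof (rule multilinearI)
    fix xs assume "xs \<in> tuples N X"
    then show "\<Phi> xs \<in> carrier Y" using cl by (auto simp: \<Phi>_def)
  next
    fix xs ys u v assume t: "xs @ u # ys \<in> tuples N X" and v: "v \<in> carrier X"
    have t': "xs @ v # ys \<in> tuples N X" using t v by (auto simp: tuples_def)
    have "\<Psi> (permute_list p (xs @ (u + v) # ys)) =
        \<Psi> (permute_list p (xs @ u # ys)) + \<Psi> (permute_list p (xs @ v # ys))" if p: "p \<in> A" for p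
    proof -
      obtain xs' ys' where e: "\<And>z. permute_list p (xs @ z # ys) = xs' @ z # ys'" using upd[OF p t] by blast
      show ?thesis using multilinear_add[OF \<Psi>(1), of xs' u ys' v] tup[OF p t] v by (simp add: e)
    qed
    then show "\<Phi> (xs @ (u + v) # ys) = \<Phi> (xs @ u # ys) + \<Phi> (xs @ v # ys)"
      using cl[OF _ t] cl[OF _ t'] by (simp add: \<Phi>_def sum.distrib Y.scale_add_right)
  next
    fix xs ys u c assume t: "xs @ u # ys \<in> tuples N X"
    have "\<Psi> (permute_list p (xs @ scale X c u # ys)) = scale Y c (\<Psi> (permute_list p (xs @ u # ys)))"
      if p: "p \<in> A" for p
    proof -
      obtain xs' ys' where e: "\<And>z. permute_list p (xs @ z # ys) = xs' @ z # ys'" using upd[OF p t] by blast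
      show ?thesis using multilinear_scale[OF \<Psi>(1), of xs' u ys' c] tup[OF p t] by (simp add: e)
    qed
    then show "\<Phi> (xs @ scale X c u # ys) = scale Y c (\<Phi> (xs @ u # ys))"
      using cl[OF _ t] by (simp add: \<Phi>_def Y.scale_scale mult.commute flip: Y.scale_sum)
  qed
  have "ball_bounded N X Y C \<Phi>"
    unfolding ball_bounded_def
  proof (intro allI impI)
    fix xs assume xs: "length xs = N \<and> set xs \<subseteq> unit_ball X"
    then have t: "xs \<in> tuples N X" by (auto simp: tuples_def X.unit_ball_iff)
    have "nrm Y (\<Sum>p\<in>A. \<Psi> (permute_list p xs)) \<le> (\<Sum>p\<in>A. C)"
      using xs cl[OF _ t]
      by (intro order_trans[OF Y.nrm_sum] sum_mono ball_boundedD[OF C(2)]) (auto simp: A_def)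
    then show "nrm Y (\<Phi> xs) \<le> C"
      using cl[OF _ t] A(2) by (simp add: \<Phi>_def Y.nrm_scale norm_divide field_simps)
  qed
  then have "continuous_multi N X Y \<Phi>" using ball_bounded_imp_continuous[OF m] C(1) by blast
  moreover have "symmetric_multi N X \<Phi>"
    unfolding symmetric_multi_def
  proof (intro ballI impI)
    fix xs ys assume "xs \<in> tuples N X" "ys \<in> tuples N X" "mset xs = mset ys"
    then obtain q where q: "q permutes {..<length ys}" "permute_list q ys = xs" and l: "length ys = N"
      using mset_eq_permutation[of xs ys] by (auto simp: tuples_def)
    \<comment> \<open>Tuples with equal multisets differ by a permutation \<open>q\<close>, and
      composition with \<open>q\<close> only reindexes the average.\<close>
    have "(\<Sum>p\<in>A. \<Psi> (permute_list p xs)) = (\<Sum>p\<in>A. \<Psi> (permute_list (q \<circ> p) ys))"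
      using q l by (intro sum.cong refl) (auto simp: A_def permute_list_compose)
    also have "\<dots> = (\<Sum>p\<in>A. \<Psi> (permute_list p ys))"
      unfolding A_def using setum_permutations_compose_left[of q "{..<N}" "\<lambda>p. \<Psi> (permute_list p ys)"] q l
      by simp
    finally show "\<Phi> xs = \<Phi> ys" by (simp add: \<Phi>_def)
  qed
  moreover have "P x = \<Phi> (replicate N x)" if x: "x \<in> carrier X" for x
  proof -
    have t: "replicate N x \<in> tuples N X" using x by (auto simp: tuples_def)
    have e: "permute_list p (replicate N x) = replicate N x" if "p \<in> A" for p
      using that permutes_in_image[of p "{..<N}"] by (intro nth_equalityI) (auto simp: A_def permute_list_nth)
    have "(\<Sum>p\<in>A. \<Psi> (permute_list p (replicate N x))) = (\<Sum>p\<in>A. scale Y 1 (\<Psi> (replicate N x)))"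
      using e multilinear_closed[OF \<Psi>(1) t] by (intro sum.cong) auto
    also have "\<dots> = scale Y (\<Sum>p\<in>A. 1) (\<Psi> (replicate N x))"
      using A(1) multilinear_closed[OF \<Psi>(1) t]
      by (induction A rule: finite_induct) (auto simp: Y.scale_add_left)
    also have "\<dots> = scale Y (fact N) (\<Psi> (replicate N x))" using A(2) by simp
    finally show ?thesis
      using \<Psi>(3) x multilinear_closed[OF \<Psi>(1) t] by (simp add: \<Phi>_def Y.scale_scale)
  qed
  ultimately show ?thesis using m by blast
qed

lemma assoc_sym:
  assumes "P \<in> polys N X Y"
  shows "multilinear N X Y (assoc_sym N X Y P)" "continuous_multi N X Y (assoc_sym N X Y P)"
    "symmetric_multi N X (assoc_sym N X Y P)"
    "\<And>x. x \<in> carrier X \<Longrightarrow> P x = assoc_sym N X Y P (replicate N x)"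
  using someI_ex[OF polys_symmetric[OF assms]] unfolding assoc_sym_def[symmetric] by auto

end

text \<open>The mean of \<open>s k * s l\<close> over independent signs is 1 for
  \<open>k = l\<close> and 0 otherwise, so the diagonal sum is an average of signed double sums. The
  signs are removed one index at a time; \<open>c\<close> collects the diagonal terms already
  freed.\<close>

lemma sign_average:
  fixes b :: "'i \<Rightarrow> 'i \<Rightarrow> 'k::real_normed_field"
  assumes "finite A"
    "\<And>s. (\<And>k. k \<in> A \<Longrightarrow> s k = 1 \<or> s k = -1) \<Longrightarrow>
      norm (c + (\<Sum>k\<in>A. \<Sum>l\<in>A. s k * s l * b k l)) \<le> C"
  shows "norm (c + (\<Sum>k\<in>A. b k k)) \<le> C"
  using assms
proof (induction A arbitrary: c rule: finite_induct)
  case empty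
  then show ?case by simp
next
  case (insert a A)
  have "norm ((c + b a a) + (\<Sum>k\<in>A. \<Sum>l\<in>A. s k * s l * b k l)) \<le> C"
    if s: "\<And>k. k \<in> A \<Longrightarrow> s k = 1 \<or> s k = -1" for s
  proof -
    let ?S = "\<lambda>s. c + (\<Sum>k\<in>insert a A. \<Sum>l\<in>insert a A. s k * s l * b k l)"
    define D where "D = (\<Sum>k\<in>A. \<Sum>l\<in>A. s k * s l * b k l)"
    define R where "R = (\<Sum>l\<in>A. s l * b a l) + (\<Sum>k\<in>A. s k * b k a)"
    have ex: "?S (s(a := t)) = c + t * t * b a a + t * R + D" for t
    proof -
      have "(\<Sum>k\<in>A. \<Sum>l\<in>A. (s(a := t)) k * (s(a := t)) l * b k l) = D"
        unfolding D_def using insert.hyps by (intro sum.cong refl) auto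
      moreover have "(\<Sum>l\<in>A. (s(a := t)) a * (s(a := t)) l * b a l) = t * (\<Sum>l\<in>A. s l * b a l)"
        using insert.hyps by (auto simp: sum_distrib_left mult.assoc intro!: sum.cong)
      moreover have "(\<Sum>k\<in>A. (s(a := t)) k * (s(a := t)) a * b k a) = t * (\<Sum>k\<in>A. s k * b k a)"
        using insert.hyps by (auto simp: sum_distrib_left mult_ac intro!: sum.cong)
      ultimately show ?thesis
        using insert.hyps by (simp add: sum.distrib algebra_simps R_def)
    qed
    have b: "norm (?S (s(a := t))) \<le> C" if "t = 1 \<or> t = -1" for t
      using that s by (intro insert.prems) auto
    \<comment> \<open>The cross terms \<open>R\<close> are linear in the sign at \<open>a\<close>
      and cancel, while the diagonal term sees only the square of that sign.\<close>
    have "?S (s(a := 1)) + ?S (s(a := -1)) = 2 * ((c + b a a) + D)"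
      unfolding ex by (simp add: algebra_simps)
    then have "2 * norm ((c + b a a) + D) = norm (?S (s(a := 1)) + ?S (s(a := -1)))"
      by (simp only: norm_mult norm_numeral)
    also have "\<dots> \<le> C + C" using b by (intro norm_triangle_mono) auto
    finally show ?thesis by (simp add: D_def)
  qed
  from insert.IH[OF this] show ?case using insert.hyps by (simp add: add_ac)
qed

section \<open>Binomial expansion, bounds for coefficients and diagonal sums\<close>

context normed_pair
begin

lemma multilinear_zero:
  assumes "multilinear (Suc N) X Y \<Phi>" "xs \<in> tuples N X"
  shows "\<Phi> (0 # xs) = 0"
  using multilinear_add[OF assms(1), of "[]" 0 xs 0] assms(2) by simp

lemma multilinear_sum:
  assumes "multilinear (Suc N) X Y \<Phi>" "xs \<in> tuples N X" "\<And>k. k \<in> A \<Longrightarrow> g k \<in> carrier X"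
  shows "\<Phi> (sum g A # xs) = (\<Sum>k\<in>A. \<Phi> (g k # xs))"
  using assms(3)
proof (induction A rule: infinite_finite_induct)
  case (insert a A)
  then show ?case using multilinear_add[OF assms(1), of "[]" "g a" xs "sum g A"] assms(2) by simp
qed (use multilinear_zero[OF assms(1,2)] in auto)

text \<open>Pascal's rule, splitting off one sum \<open>u + v\<close> at a time. The spectators
  \<open>ws\<close> receive the \<open>u\<close> or \<open>v\<close> that was split off, and
  symmetry moves it to its block.\<close>

lemma symmetric_binomial:
  assumes "multilinear N X Y \<Phi>" "symmetric_multi N X \<Phi>" "u \<in> carrier X" "v \<in> carrier X"
    "set ws \<subseteq> carrier X" "n + length ws = N"
  shows "\<Phi> (replicate n (u + v) @ ws) =
    (\<Sum>j\<le>n. scale Y (of_nat (n choose j)) (\<Phi> (replicate (n - j) u @ replicate j v @ ws)))"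
  using assms(5,6)
proof (induction n arbitrary: ws)
  case 0
  then show ?case using multilinear_closed[OF assms(1)] by (auto simp: tuples_def)
next
  case (Suc n)
  have uv: "u + v \<in> carrier X" using assms by simp
  have sym: "\<Phi> xs = \<Phi> ys" if "mset xs = mset ys" "set xs \<subseteq> carrier X" "length xs = N" for xs ys
  proof -
    have "xs \<in> tuples N X" "ys \<in> tuples N X"
      using that mset_eq_setD[OF that(1)] mset_eq_length[OF that(1)] by (simp_all add: tuples_def)
    then show ?thesis using assms(2) that(1) unfolding symmetric_multi_def by blast
  qed
  define T where "T j = \<Phi> (replicate (Suc n - j) u @ replicate j v @ ws)" for j
  define c where "c k j = (of_nat (k choose j) :: 'k)" for k j
  have Tc: "T j \<in> carrier Y" if "j \<le> Suc n" for j
    unfolding T_def using that Suc.prems assms(3,4)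
    by (intro multilinear_closed[OF assms(1)]) (auto simp: tuples_def)
  have A: "\<Phi> (replicate n (u + v) @ u # ws) = (\<Sum>j\<le>n. scale Y (c n j) (T j))"
  proof -
    have "\<Phi> (replicate (n - j) u @ replicate j v @ u # ws) = T j" if "j \<le> n" for j
      unfolding T_def using that Suc.prems assms(3,4) by (intro sym) (auto simp: Suc_diff_le)
    then show ?thesis using Suc.IH[of "u # ws"] Suc.prems assms(3) by (simp add: c_def)
  qed
  have B: "\<Phi> (replicate n (u + v) @ v # ws) = (\<Sum>j\<le>n. scale Y (c n j) (T (Suc j)))"
  proof -
    have "\<Phi> (replicate (n - j) u @ replicate j v @ v # ws) = T (Suc j)" if "j \<le> n" for j
      unfolding T_def using that Suc.prems assms(3,4) by (intro sym) auto
    then show ?thesis using Suc.IH[of "v # ws"] Suc.prems assms(4) by (simp add: c_def)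
  qed
  have "\<Phi> (replicate (Suc n) (u + v) @ ws) = \<Phi> (replicate n (u + v) @ (u + v) # ws)"
    using Suc.prems uv by (intro sym) auto
  also have "\<dots> = \<Phi> (replicate n (u + v) @ u # ws) + \<Phi> (replicate n (u + v) @ v # ws)"
    using Suc.prems uv assms(3,4) by (intro multilinear_add[OF assms(1)]) (auto simp: tuples_def)
  also have "\<dots> = (\<Sum>j\<le>Suc n. scale Y (c n j) (T j)) + (\<Sum>j\<le>n. scale Y (c n j) (T (Suc j)))"
    unfolding A B using Tc[of "Suc n"] by (simp add: c_def binomial_eq_0)
  also have "\<dots> = scale Y (c n 0) (T 0) +
      (\<Sum>j\<le>n. scale Y (c n (Suc j)) (T (Suc j)) + scale Y (c n j) (T (Suc j)))"
    by (simp add: sum.atMost_Suc_shift sum.distrib del: sum.atMost_Suc)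
  also have "\<dots> = scale Y (c (Suc n) 0) (T 0) + (\<Sum>j\<le>n. scale Y (c (Suc n) (Suc j)) (T (Suc j)))"
  proof -
    have "scale Y (c n (Suc j)) (T (Suc j)) + scale Y (c n j) (T (Suc j)) =
        scale Y (c (Suc n) (Suc j)) (T (Suc j))" if "j \<le> n" for j
      using Y.scale_add_left[OF Tc, of "Suc j" "c n (Suc j)" "c n j"] that by (simp add: c_def add.commute)
    then show ?thesis by (simp add: c_def)
  qed
  also have "\<dots> = (\<Sum>j\<le>Suc n. scale Y (c (Suc n) j) (T j))"
    by (simp add: sum.atMost_Suc_shift del: sum.atMost_Suc)
  finally show ?case by (simp add: T_def c_def)
qed

end

text \<open>All norms on polynomials of degree at most \<open>N\<close> are equivalent. The constant
  is chosen before the coefficients, so it serves every point, direction and polynomial at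
  once.\<close>

lemma (in normed_space) coefficient_bound:
  "\<exists>C\<ge>0. \<forall>b E. (\<forall>j\<le>N. b j \<in> carrier X) \<longrightarrow>
     (\<forall>t\<in>{0..1}. nrm X (\<Sum>j\<le>N. scale X (of_real (t ^ j)) (b j)) \<le> E) \<longrightarrow>
     (\<forall>j\<le>N. nrm X (b j) \<le> C * E)"
proof (induction N)
  case 0
  show ?case by (intro exI[of _ 1]) (auto dest: bspec[of _ _ 1])
next
  case (Suc N)
  then obtain C where C0: "C \<ge> 0" "\<forall>b E. (\<forall>j\<le>N. b j \<in> carrier X) \<longrightarrow>
     (\<forall>t\<in>{0..1}. nrm X (\<Sum>j\<le>N. scale X (of_real (t ^ j)) (b j)) \<le> E) \<longrightarrow>
     (\<forall>j\<le>N. nrm X (b j) \<le> C * E)" by blast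
  note C = C0(1) C0(2)[rule_format]
  define C' where "C' = C * (1 + 2 ^ Suc N)"
  have C': "C' \<ge> 0" using C(1) by (simp add: C'_def)
  define D where "D = C' + (1 + real (Suc N) * C')"
  show ?case
  proof (intro exI[of _ D] conjI allI impI)
    show "D \<ge> 0" using C' by (simp add: D_def)
    fix b E j assume b: "\<forall>j\<le>Suc N. b j \<in> carrier X"
      and E: "\<forall>t\<in>{0..1}. nrm X (\<Sum>j\<le>Suc N. scale X (of_real (t ^ j)) (b j)) \<le> E" and j: "j \<le> Suc N"
    define p where "p t = (\<Sum>j\<le>Suc N. scale X (of_real (t ^ j)) (b j))" for t :: real
    have pc: "p t \<in> carrier X" for t unfolding p_def using b by (intro sum_closed scale_closed) auto
    have pE: "nrm X (p t) \<le> E" if "t \<in> {0..1}" for t using E that by (simp add: p_def)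
    have E0: "E \<ge> 0" using pE[of 1] nrm_nonneg[OF pc, of 1] by simp
    define c where "c j = 1 - 2 ^ Suc N / (2 :: real) ^ j" for j
    text \<open>\<open>p t - 2 ^ Suc N * p (t / 2)\<close> has degree at most \<open>N\<close>, and its coefficients dominate those of \<open>p\<close>.\<close>
    have q: "p t - scale X (of_real (2 ^ Suc N)) (p (t / 2)) =
        (\<Sum>j\<le>N. scale X (of_real (t ^ j)) (scale X (of_real (c j)) (b j)))" for t
    proof -
      have *: "scale X (of_real (t ^ j)) (b j) - scale X (of_real (2 ^ Suc N)) (scale X (of_real ((t / 2) ^ j)) (b j))
          = scale X (of_real (t ^ j)) (scale X (of_real (c j)) (b j))" if "j \<le> Suc N" for j
      proof -
        have "of_real (t ^ j) - of_real (2 ^ Suc N) * of_real ((t / 2) ^ j) = (of_real (t ^ j) * of_real (c j) :: 'k)"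
          unfolding of_real_mult[symmetric] of_real_diff[symmetric] c_def
          by (simp add: power_divide right_diff_distrib)
        moreover have "b j \<in> carrier X" using b that by simp
        ultimately show ?thesis
          using scale_diff_left[of "b j" "of_real (t ^ j)" "of_real (2 ^ Suc N) * of_real ((t / 2) ^ j)"]
          by (simp only: scale_scale)
      qed
      have "p t - scale X (of_real (2 ^ Suc N)) (p (t / 2)) =
         (\<Sum>j\<le>Suc N. scale X (of_real (t ^ j)) (b j) -
            scale X (of_real (2 ^ Suc N)) (scale X (of_real ((t / 2) ^ j)) (b j)))"
        unfolding p_def sum_subtractf by (subst scale_sum) (use b in auto)
      also have "\<dots> = (\<Sum>j\<le>Suc N. scale X (of_real (t ^ j)) (scale X (of_real (c j)) (b j)))"
        using * by (intro sum.cong) auto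
      also have "\<dots> = (\<Sum>j\<le>N. scale X (of_real (t ^ j)) (scale X (of_real (c j)) (b j)))"
        using b by (simp add: c_def)
      finally show ?thesis .
    qed
    have qE: "nrm X (\<Sum>j\<le>N. scale X (of_real (t ^ j)) (scale X (of_real (c j)) (b j))) \<le> (1 + 2 ^ Suc N) * E"
      if t: "t \<in> {0..1}" for t
    proof -
      have "nrm X (p t - scale X (of_real (2 ^ Suc N)) (p (t / 2))) \<le> E + 2 ^ Suc N * E"
        using t pE[of t] pE[of "t / 2"] pc
        by (intro order_trans[OF nrm_diff] add_mono) (auto simp: nrm_scale norm_power norm_mult)
      then show ?thesis by (simp only: q) (simp add: algebra_simps)
    qed
    have low: "nrm X (b i) \<le> C' * E" if i: "i \<le> N" for i
    proof -
      have bi: "b i \<in> carrier X" using b i by simp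
      have "(2 :: real) ^ Suc i \<le> 2 ^ Suc N" using i by (intro power_increasing) auto
      then have "2 \<le> (2 :: real) ^ Suc N / 2 ^ i" by (subst pos_le_divide_eq) auto
      then have "\<bar>c i\<bar> \<ge> 1" unfolding c_def by linarith
      then have "nrm X (b i) \<le> \<bar>c i\<bar> * nrm X (b i)" using mult_right_mono[of 1 "\<bar>c i\<bar>"] bi by simp
      also have "\<dots> = nrm X (scale X (of_real (c i)) (b i))" using bi by (simp add: nrm_scale)
      also have "\<dots> \<le> C * ((1 + 2 ^ Suc N) * E)"
        by (rule C(2)[of "\<lambda>j. scale X (of_real (c j)) (b j)", OF _ qE i]) (use b in auto)
      finally show ?thesis by (simp add: C'_def mult.assoc)
    qed
    have "p 1 = (\<Sum>j\<le>N. b j) + b (Suc N)" unfolding p_def using b by simp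
    then have "b (Suc N) = p 1 - (\<Sum>j\<le>N. b j)" by simp
    then have "nrm X (b (Suc N)) \<le> nrm X (p 1) + nrm X (\<Sum>j\<le>N. b j)"
      using nrm_diff[OF pc sum_closed, of "{..N}" b 1] b by simp
    also have "\<dots> \<le> E + (\<Sum>j\<le>N. C' * E)"
      using b pE low by (intro add_mono order_trans[OF nrm_sum] sum_mono) auto
    finally have "nrm X (b (Suc N)) \<le> (1 + real (Suc N) * C') * E" by (simp add: algebra_simps)
    also have "\<dots> \<le> D * E" unfolding D_def using C' E0 by (intro mult_right_mono) auto
    finally have top: "nrm X (b (Suc N)) \<le> D * E" .
    have "C' * E \<le> D * E" unfolding D_def using C' E0 by (intro mult_right_mono) auto
    then show "nrm X (b j) \<le> D * E" using low[of j] top j by (cases "j = Suc N") auto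
  qed
qed

text \<open>\<open>sign_average\<close> uncouples the first argument from the others and thereby
  replaces it by a signed sum of the \<open>y k\<close>. The signs left over are absorbed into
  \<open>\<theta>\<close> for the form of lower degree, which is why the statement allows unimodular
  factors; in degree 1 these factors form the argument itself.\<close>

lemma (in normed_space) diagonal_sum_bound:
  fixes F :: "'v list \<Rightarrow> 'k" and y :: "'i \<Rightarrow> 'v"
  assumes "multilinear (Suc n) X scalar_space F" "finite A" "\<And>k. k \<in> A \<Longrightarrow> y k \<in> carrier X"
    and bound: "\<And>xs. length xs = Suc n \<Longrightarrow>
      (\<And>x. x \<in> set xs \<Longrightarrow> \<exists>s. (\<forall>k\<in>A. norm (s k) = 1) \<and> x = (\<Sum>k\<in>A. scale X (s k) (y k))) \<Longrightarrow>
      norm (F xs) \<le> C"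
    and "\<And>k. k \<in> A \<Longrightarrow> norm (\<theta> k) = 1"
  shows "norm (\<Sum>k\<in>A. \<theta> k * F (replicate (Suc n) (y k))) \<le> C"
proof -
  interpret S: normed_space "scalar_space :: ('k, 'k) nspace" by (rule normed_space_scalar)
  interpret normed_pair X "scalar_space :: ('k, 'k) nspace" ..
  note y = assms(3)
  have lin: "G ((\<Sum>k\<in>A. scale X (s k) (y k)) # xs) = (\<Sum>k\<in>A. s k * G (y k # xs))"
    if "multilinear (Suc n) X scalar_space G" "xs \<in> tuples n X" for s G n xs
    using multilinear_sum[OF that, of A "\<lambda>k. scale X (s k) (y k)"]
      multilinear_scale[OF that(1), of "[]" _ xs] that(2) y by simp
  show ?thesis
    using assms(1) bound assms(5)
  proof (induction n arbitrary: F \<theta>)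
    case 0
    have "(\<Sum>k\<in>A. \<theta> k * F [y k]) = F [(\<Sum>k\<in>A. scale X (\<theta> k) (y k))]"
      using lin[OF 0(1), of "[]" \<theta>] by simp
    also have "norm \<dots> \<le> C" using 0(3) by (intro 0(2)) auto
    finally show ?case by simp
  next
    case (Suc n)
    let ?b = "\<lambda>k l. \<theta> l * F (y k # replicate (Suc n) (y l))"
    have "norm (0 + (\<Sum>k\<in>A. ?b k k)) \<le> C"
    proof (rule sign_average[OF assms(2), where b = ?b])
      fix s :: "'i \<Rightarrow> 'k" assume s: "\<And>k. k \<in> A \<Longrightarrow> s k = 1 \<or> s k = -1"
      define v where "v = (\<Sum>k\<in>A. scale X (s k) (y k))"
      have v: "v \<in> carrier X" unfolding v_def using y by simp
      have s1: "norm (s k) = 1" if "k \<in> A" for k using s[OF that] by auto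
      have "(\<Sum>k\<in>A. \<Sum>l\<in>A. s k * s l * ?b k l) = (\<Sum>l\<in>A. \<Sum>k\<in>A. s k * s l * ?b k l)"
        by (rule sum.swap)
      also have "\<dots> = (\<Sum>l\<in>A. (\<theta> l * s l) * F (v # replicate (Suc n) (y l)))"
        unfolding v_def using y
        by (intro sum.cong refl, subst lin[OF Suc.prems(1)])
           (auto simp: tuples_def sum_distrib_left mult_ac intro!: sum.cong)
      also have "norm \<dots> \<le> C"
      proof (rule Suc.IH)
        show "multilinear (Suc n) X scalar_space (\<lambda>xs. F (v # xs))"
          using multilinear_Cons[OF Suc.prems(1) v] .
        show "norm (F (v # xs)) \<le> C" if "length xs = Suc n"
          "\<And>x. x \<in> set xs \<Longrightarrow> \<exists>s. (\<forall>k\<in>A. norm (s k) = 1) \<and> x = (\<Sum>k\<in>A. scale X (s k) (y k))" for xs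
          using that s1 by (intro Suc.prems(2)) (auto simp: v_def)
      qed (use Suc.prems(3) s1 in \<open>auto simp: norm_mult\<close>)
      finally show "norm (0 + (\<Sum>k\<in>A. \<Sum>l\<in>A. s k * s l * ?b k l)) \<le> C" by simp
    qed
    then show ?case by simp
  qed
qed

section \<open>The Aron--Berner extension of a scalar multilinear form\<close>

text \<open>The iterated limit of a scalar form, written without limits: as a function of the
  outermost variable the inner extension is a continuous functional, and its limit along points
  converging weak-star to \<open>z\<close> is the value of \<open>z\<close> at it. The value 0 off
  the carrier is the normalisation built into \<open>dual\<close>.\<close>

primrec bidual_ext ::
  "('k::real_normed_field, 'v::ab_group_add) nspace \<Rightarrow> (('v \<Rightarrow> 'k) \<Rightarrow> 'k) list \<Rightarrow> ('v list \<Rightarrow> 'k) \<Rightarrow> 'k" where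
  "bidual_ext X [] \<phi> = \<phi> []"
| "bidual_ext X (z # zs) \<phi> = z (\<lambda>x. if x \<in> carrier X then bidual_ext X zs (\<lambda>xs. \<phi> (x # xs)) else 0)"

lemma bidual_ext_cong:
  "(\<And>xs. xs \<in> tuples (length zs) X \<Longrightarrow> \<phi> xs = \<psi> xs) \<Longrightarrow> bidual_ext X zs \<phi> = bidual_ext X zs \<psi>"
proof (induction zs arbitrary: \<phi> \<psi>)
  case (Cons z zs)
  have "bidual_ext X zs (\<lambda>xs. \<phi> (x # xs)) = bidual_ext X zs (\<lambda>xs. \<psi> (x # xs))" if "x \<in> carrier X" for x
    using that Cons.prems by (intro Cons.IH) auto
  then show ?case by (simp cong: if_cong)
qed simp

locale normed_bidual = normed_space X for X :: "('k::real_normed_field, 'v::ab_group_add) nspace"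
begin

sublocale D: normed_space "dual X" by (rule normed_space_dual)
sublocale B: normed_space "bidual X" by (rule D.normed_space_dual)
sublocale S: normed_space "scalar_space :: ('k, 'k) nspace" by (rule normed_space_scalar)
sublocale XS: normed_pair X "scalar_space :: ('k, 'k) nspace" ..
sublocale BS: normed_pair "bidual X" "scalar_space :: ('k, 'k) nspace" ..

abbreviation form :: "nat \<Rightarrow> real \<Rightarrow> ('v list \<Rightarrow> 'k) \<Rightarrow> bool" where
  "form N C \<phi> \<equiv> multilinear N X scalar_space \<phi> \<and> ball_bounded N X scalar_space C \<phi>"

abbreviation slice :: "(('v \<Rightarrow> 'k) \<Rightarrow> 'k) list \<Rightarrow> ('v list \<Rightarrow> 'k) \<Rightarrow> 'v \<Rightarrow> 'k" where
  "slice zs \<phi> \<equiv> \<lambda>x. if x \<in> carrier X then bidual_ext X zs (\<lambda>xs. \<phi> (x # xs)) else 0"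

lemma form_Cons:
  assumes "form (Suc N) C \<phi>" "x \<in> carrier X"
  shows "\<exists>C'. form N C' (\<lambda>xs. \<phi> (x # xs))"
  using multilinear_Cons[of N X scalar_space \<phi> x]
    XS.ball_bounded_Cons[of N \<phi> C x "nrm X x + 1"] assms nrm_nonneg[OF assms(2)]
  by (intro exI[of _ "C * (nrm X x + 1)"]) auto

lemma form_Cons_ball:
  assumes "form (Suc N) C \<phi>" "x \<in> unit_ball X"
  shows "form N C (\<lambda>xs. \<phi> (x # xs))"
  using multilinear_Cons[of N X scalar_space \<phi> x]
    XS.ball_bounded_Cons[of N \<phi> C x 1] assms by (auto simp: unit_ball_iff)

text \<open>The claims depend on one another: bound and linearity for \<open>zs\<close> make the
  slice a functional, and applying \<open>z\<close> to slices then yields bound and linearity for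
  \<open>z # zs\<close>.\<close>

lemma bidual_ext_props:
  assumes "set zs \<subseteq> carrier (bidual X)"
  shows "(\<forall>C \<phi>. form (length zs) C \<phi> \<longrightarrow> norm (bidual_ext X zs \<phi>) \<le> C * (\<Prod>z\<leftarrow>zs. nrm (bidual X) z)) \<and>
    (\<forall>C C' \<phi> \<psi> c. form (length zs) C \<phi> \<longrightarrow> form (length zs) C' \<psi> \<longrightarrow>
       bidual_ext X zs (\<lambda>xs. c * \<phi> xs + \<psi> xs) = c * bidual_ext X zs \<phi> + bidual_ext X zs \<psi>) \<and>
    (\<forall>C \<phi>. form (Suc (length zs)) C \<phi> \<longrightarrow> slice zs \<phi> \<in> carrier (dual X) \<and>
       (\<forall>x\<in>unit_ball X. norm (slice zs \<phi> x) \<le> C * (\<Prod>z\<leftarrow>zs. nrm (bidual X) z)))"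
    (is "?A zs \<and> ?B zs \<and> ?D zs")
proof -
  have D: "?D zs" if A: "?A zs" and B: "?B zs" for zs
  proof (intro allI impI)
    fix C \<phi> assume f: "form (Suc (length zs)) C \<phi>"
    let ?K = "C * (\<Prod>z\<leftarrow>zs. nrm (bidual X) z)"
    have bound: "norm (slice zs \<phi> x) \<le> ?K" if "x \<in> unit_ball X" for x
      using A form_Cons_ball[OF f that] that by (simp add: unit_ball_iff)
    have lin: "slice zs \<phi> (scale X c x + y) = c * slice zs \<phi> x + slice zs \<phi> y"
      if x: "x \<in> carrier X" and y: "y \<in> carrier X" for c x y
    proof -
      have "\<phi> ((scale X c x + y) # xs) = c * \<phi> (x # xs) + \<phi> (y # xs)" if "xs \<in> tuples (length zs) X" for xs
        using multilinear_add[of _ X scalar_space \<phi> "[]" "scale X c x" xs y]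
          multilinear_scale[of _ X scalar_space \<phi> "[]" x xs c] f x y that by auto
      then have "bidual_ext X zs (\<lambda>xs. \<phi> ((scale X c x + y) # xs)) =
          bidual_ext X zs (\<lambda>xs. c * \<phi> (x # xs) + \<phi> (y # xs))"
        by (rule bidual_ext_cong)
      then show ?thesis using B form_Cons[OF f x] form_Cons[OF f y] x y by auto
    qed
    have "slice zs \<phi> \<in> carrier (dual X)"
    proof (rule dualI[where C = ?K])
      show "slice zs \<phi> (x + y) = slice zs \<phi> x + slice zs \<phi> y" if "x \<in> carrier X" "y \<in> carrier X" for x y
        using lin[OF that, of 1] that by simp
      have z: "slice zs \<phi> 0 = 0" using lin[of 0 0 1] by simp
      show "slice zs \<phi> (scale X c x) = c * slice zs \<phi> x" if "x \<in> carrier X" for c x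
        using lin[OF that zero_closed, of c] z that by simp
    qed (use bound in auto)
    then show "slice zs \<phi> \<in> carrier (dual X) \<and> (\<forall>x\<in>unit_ball X. norm (slice zs \<phi> x) \<le> ?K)"
      using bound by blast
  qed
  have "?A zs \<and> ?B zs"
    using assms
  proof (induction zs)
    case Nil
    show ?case by (auto simp: ball_bounded_def)
  next
    case (Cons z zs)
    have A: "?A zs" and B: "?B zs" and z: "z \<in> carrier (bidual X)" using Cons by auto
    note D = D[OF A B]
    have "?A (z # zs)"
    proof (intro allI impI)
      fix C \<phi> assume f: "form (length (z # zs)) C \<phi>"
      let ?K = "C * (\<Prod>z\<leftarrow>zs. nrm (bidual X) z)"
      have g: "slice zs \<phi> \<in> carrier (dual X)" "nrm (dual X) (slice zs \<phi>) \<le> ?K"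
        using D f by (auto intro!: dual_nrm_leI)
      have "norm (z (slice zs \<phi>)) \<le> nrm (bidual X) z * nrm (dual X) (slice zs \<phi>)"
        using D.dual_le[OF z g(1)] .
      also have "\<dots> \<le> nrm (bidual X) z * ?K" using g(2) B.nrm_nonneg[OF z] by (intro mult_left_mono)
      finally show "norm (bidual_ext X (z # zs) \<phi>) \<le> C * (\<Prod>z\<leftarrow>z # zs. nrm (bidual X) z)"
        by (simp add: mult_ac)
    qed
    moreover have "?B (z # zs)"
    proof (intro allI impI)
      fix C C' \<phi> \<psi> c assume f: "form (length (z # zs)) C \<phi>" "form (length (z # zs)) C' \<psi>"
      have g: "slice zs \<phi> \<in> carrier (dual X)" "slice zs \<psi> \<in> carrier (dual X)" using D f by auto
      have "slice zs (\<lambda>xs. c * \<phi> xs + \<psi> xs) = (\<lambda>x. c * slice zs \<phi> x) + slice zs \<psi>"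
      proof
        fix x
        show "slice zs (\<lambda>xs. c * \<phi> xs + \<psi> xs) x = ((\<lambda>x. c * slice zs \<phi> x) + slice zs \<psi>) x"
          using B form_Cons[of "length zs" \<phi> C x] form_Cons[of "length zs" \<psi> C' x] f by auto
      qed
      then show "bidual_ext X (z # zs) (\<lambda>xs. c * \<phi> xs + \<psi> xs) = c * bidual_ext X (z # zs) \<phi> + bidual_ext X (z # zs) \<psi>"
        using D.dual_add[OF z D.scale_closed[OF g(1), of c] g(2)] D.dual_scale[OF z g(1), of c] by simp
    qed
    ultimately show ?case by blast
  qed
  then show ?thesis using D by blast
qed

lemmas bidual_ext_bound = conjunct1[OF bidual_ext_props, rule_format]
  and bidual_ext_lincomb = conjunct1[OF conjunct2[OF bidual_ext_props], rule_format]
  and slice_props = conjunct2[OF conjunct2[OF bidual_ext_props], rule_format]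

lemma slice_dual: "set zs \<subseteq> carrier (bidual X) \<Longrightarrow> form (Suc (length zs)) C \<phi> \<Longrightarrow> slice zs \<phi> \<in> carrier (dual X)"
  using slice_props by blast

lemma bidual_ext_ball:
  assumes "set zs \<subseteq> unit_ball (bidual X)" "form (length zs) C \<phi>" "C \<ge> 0"
  shows "norm (bidual_ext X zs \<phi>) \<le> C"
proof -
  have "set zs \<subseteq> carrier (bidual X)" using assms(1) by (auto simp: B.unit_ball_iff)
  moreover have "(\<Prod>z\<leftarrow>zs. nrm (bidual X) z) \<le> 1 \<and> 0 \<le> (\<Prod>z\<leftarrow>zs. nrm (bidual X) z)"
    using assms(1) by (induction zs) (auto simp: B.unit_ball_iff intro: mult_le_one)
  ultimately show ?thesis
    using bidual_ext_bound[of zs \<phi> C] assms(2,3) mult_left_mono[of "\<Prod>z\<leftarrow>zs. nrm (bidual X) z" 1 C] by force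
qed

text \<open>By induction on the entries in front of the varying slot: the slice depends linearly on
  that slot, and the outer \<open>z\<close> is linear.\<close>

lemma bidual_ext_multilinear:
  assumes "form N C \<phi>"
  shows "multilinear N (bidual X) scalar_space (\<lambda>zs. bidual_ext X zs \<phi>)"
proof -
  have add: "bidual_ext X (zs @ (u + v) # ws) \<phi> = bidual_ext X (zs @ u # ws) \<phi> + bidual_ext X (zs @ v # ws) \<phi>"
    and scale: "bidual_ext X (zs @ scale (bidual X) c u # ws) \<phi> = c * bidual_ext X (zs @ u # ws) \<phi>"
    if "zs @ u # ws \<in> tuples N (bidual X)" "v \<in> carrier (bidual X)" "form N C \<phi>" for zs u v ws c N C \<phi>
    using that
  proof (induction zs arbitrary: N C \<phi>)
    case (Cons z zs)
    case 1
    then obtain N' where N: "N = Suc N'" by (cases N) (auto simp: tuples_def)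
    have t: "zs @ u # ws \<in> tuples N' (bidual X)" "z \<in> carrier (bidual X)" using 1 N by auto
    have f: "form (Suc (length (zs @ u # ws))) C \<phi>" "form (Suc (length (zs @ v # ws))) C \<phi>"
      using 1 N t by (auto simp: tuples_def)
    have g: "slice (zs @ u # ws) \<phi> \<in> carrier (dual X)" "slice (zs @ v # ws) \<phi> \<in> carrier (dual X)"
      using t(1) 1 by (auto intro!: slice_dual f simp: tuples_def)
    have eq: "slice (zs @ (u + v) # ws) \<phi> = slice (zs @ u # ws) \<phi> + slice (zs @ v # ws) \<phi>"
      using Cons.IH(1)[OF t(1) 1(2)] form_Cons[of N' \<phi> C] 1 N by fastforce
    show ?case unfolding append_Cons bidual_ext.simps eq by (rule D.dual_add[OF t(2) g])
  next
    case (Cons z zs)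
    case 2
    then obtain N' where N: "N = Suc N'" by (cases N) (auto simp: tuples_def)
    have t: "zs @ u # ws \<in> tuples N' (bidual X)" "z \<in> carrier (bidual X)" using 2 N by auto
    have f: "form (Suc (length (zs @ u # ws))) C \<phi>" using 2 N t by (auto simp: tuples_def)
    have g: "slice (zs @ u # ws) \<phi> \<in> carrier (dual X)"
      using t(1) 2 by (auto intro!: slice_dual f simp: tuples_def)
    have eq: "slice (zs @ scale (bidual X) c u # ws) \<phi> = scale (dual X) c (slice (zs @ u # ws) \<phi>)"
      using Cons.IH(2)[OF t(1) 2(2)] form_Cons[of N' \<phi> C] 2 N by fastforce
    show ?case unfolding append_Cons bidual_ext.simps eq by (rule D.dual_scale[OF t(2) g])
  qed simp_all
  show ?thesis
    using add[OF _ _ assms] scale[OF _ B.zero_closed assms] by (intro multilinearI) auto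
qed

lemma canon_ball: "x \<in> unit_ball X \<Longrightarrow> canon X x \<in> unit_ball (bidual X)"
  using canon_bidual nrm_canon_le by (force simp: unit_ball_iff B.unit_ball_iff)

lemma canon_add: "x \<in> carrier X \<Longrightarrow> y \<in> carrier X \<Longrightarrow> canon X (x + y) = canon X x + canon X y"
  by (auto simp: canon_def dual_add)

lemma canon_scale: "x \<in> carrier X \<Longrightarrow> canon X (scale X c x) = scale (bidual X) c (canon X x)"
  by (auto simp: canon_def dual_scale D.scale_dual)

lemma bidual_ext_canon_Cons:
  assumes "x \<in> carrier X" "set zs \<subseteq> carrier (bidual X)" "form (Suc (length zs)) C \<phi>"
  shows "bidual_ext X (canon X x # zs) \<phi> = bidual_ext X zs (\<lambda>xs. \<phi> (x # xs))"
  using slice_dual[OF assms(2,3)] assms(1) by simp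

lemma bidual_ext_canon:
  assumes "set xs \<subseteq> carrier X" "form (length xs) C \<phi>"
  shows "bidual_ext X (map (canon X) xs) \<phi> = \<phi> xs"
  using assms
proof (induction xs arbitrary: C \<phi>)
  case (Cons x xs)
  have "set (map (canon X) xs) \<subseteq> carrier (bidual X)" using Cons.prems canon_bidual by auto
  then have "bidual_ext X (map (canon X) (x # xs)) \<phi> = bidual_ext X (map (canon X) xs) (\<lambda>xs. \<phi> (x # xs))"
    using Cons.prems bidual_ext_canon_Cons[of x "map (canon X) xs" \<phi> C] by simp
  then show ?case using Cons form_Cons[of "length xs" \<phi> C x] by auto
qed simp

end

section \<open>Symmetry of the extension on the span of the space and one bidual point\<close>

lemma (in normed_space) subspace_normed_space:
  assumes "S \<subseteq> carrier X" "0 \<in> S" "\<And>x y. x \<in> S \<Longrightarrow> y \<in> S \<Longrightarrow> x + y \<in> S" "\<And>c x. x \<in> S \<Longrightarrow> scale X c x \<in> S"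
  shows "normed_space (X\<lparr>carrier := S\<rparr>)"
  using assms subsetD[OF assms(1)]
  by unfold_locales (simp_all add: scale_add_right scale_add_left scale_scale nrm_scale nrm_add)

lemma symmetric_multi_Cons:
  assumes "symmetric_multi (Suc N) X \<phi>" "x \<in> carrier X"
  shows "symmetric_multi N X (\<lambda>xs. \<phi> (x # xs))"
  unfolding symmetric_multi_def
proof (intro ballI impI)
  fix xs ys assume "xs \<in> tuples N X" "ys \<in> tuples N X" "mset xs = mset ys"
  then have "x # xs \<in> tuples (Suc N) X" "x # ys \<in> tuples (Suc N) X" "mset (x # xs) = mset (x # ys)"
    using assms(2) by auto
  then show "\<phi> (x # xs) = \<phi> (x # ys)" using assms(1) unfolding symmetric_multi_def by blast
qed

text \<open>Adjacent transpositions bring the head of one list to the front of the other, and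
  induction treats the tails; the prefix \<open>pre\<close> stores the matched entries.\<close>

lemma adjacent_swaps_imp_symmetric:
  assumes swap: "\<And>zs u v ws. set (zs @ u # v # ws) \<subseteq> Z \<Longrightarrow> length (zs @ u # v # ws) = N \<Longrightarrow>
      f (zs @ u # v # ws) = f (zs @ v # u # ws)"
    and "mset xs = mset ys" "set xs \<subseteq> Z" "length xs = N"
  shows "f xs = f ys"
proof -
  have move: "f (pre @ as @ x # bs) = f (pre @ x # as @ bs)"
    if "set (pre @ as @ x # bs) \<subseteq> Z" "length (pre @ as @ x # bs) = N" for pre as x bs
    using that
  proof (induction as arbitrary: pre)
    case (Cons c cs)
    have "f ((pre @ [c]) @ cs @ x # bs) = f ((pre @ [c]) @ x # cs @ bs)"
      using Cons.prems by (intro Cons.IH) auto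
    also have "\<dots> = f (pre @ x # c # cs @ bs)" using swap[of pre c x "cs @ bs"] Cons.prems by simp
    finally show ?case by simp
  qed simp
  have "f (pre @ xs) = f (pre @ ys)"
    if "mset xs = mset ys" "set (pre @ xs) \<subseteq> Z" "length (pre @ xs) = N" for pre
    using that
  proof (induction xs arbitrary: pre ys)
    case (Cons x xs)
    have "x \<in> set ys" using mset_eq_setD[OF Cons.prems(1)] by auto
    then obtain as bs where ys: "ys = as @ x # bs" by (auto simp: in_set_conv_decomp)
    have "set ys = set (x # xs)" "length ys = length (x # xs)"
      using mset_eq_setD[OF Cons.prems(1)] mset_eq_length[OF Cons.prems(1)] by auto
    then have "f (pre @ ys) = f (pre @ x # as @ bs)"
      using Cons.prems ys move[of pre as x bs] by auto
    moreover have "f ((pre @ [x]) @ xs) = f ((pre @ [x]) @ as @ bs)"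
      using Cons.prems ys by (intro Cons.IH) auto
    ultimately show ?case by simp
  qed simp
  from this[of "[]"] show ?thesis using assms(2-4) by simp
qed

context normed_bidual
begin

text \<open>A canonical argument merely fixes a slot of \<open>\<phi>\<close>, and inside
  \<open>\<phi>\<close> the symmetry on \<open>X\<close> is available. So it commutes with every
  element of the bidual.\<close>

lemma bidual_ext_swap_canon:
  assumes "x \<in> carrier X" "b \<in> carrier (bidual X)" "set ws \<subseteq> carrier (bidual X)"
    "form (Suc (Suc (length ws))) C \<phi>" "symmetric_multi (Suc (Suc (length ws))) X \<phi>"
  shows "bidual_ext X (canon X x # b # ws) \<phi> = bidual_ext X (b # canon X x # ws) \<phi>"
proof -
  have "bidual_ext X ws (\<lambda>xs. \<phi> (x # y # xs)) = bidual_ext X (canon X x # ws) (\<lambda>xs. \<phi> (y # xs))"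
    if y: "y \<in> carrier X" for y
  proof -
    have "bidual_ext X ws (\<lambda>xs. \<phi> (x # y # xs)) = bidual_ext X ws (\<lambda>xs. \<phi> (y # x # xs))"
    proof (rule bidual_ext_cong)
      fix xs assume "xs \<in> tuples (length ws) X"
      then have "x # y # xs \<in> tuples (Suc (Suc (length ws))) X" "y # x # xs \<in> tuples (Suc (Suc (length ws))) X"
        using assms(1) y by auto
      moreover have "mset (x # y # xs) = mset (y # x # xs)" by simp
      ultimately show "\<phi> (x # y # xs) = \<phi> (y # x # xs)"
        using assms(5) unfolding symmetric_multi_def by blast
    qed
    also have "\<dots> = bidual_ext X (canon X x # ws) (\<lambda>xs. \<phi> (y # xs))"
      using form_Cons[OF assms(4) y] bidual_ext_canon_Cons[OF assms(1,3), of "\<lambda>xs. \<phi> (y # xs)"] by fastforce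
    finally show ?thesis .
  qed
  then have "slice ws (\<lambda>xs. \<phi> (x # xs)) = slice (canon X x # ws) \<phi>" by auto
  moreover have "bidual_ext X (canon X x # b # ws) \<phi> = b (slice ws (\<lambda>xs. \<phi> (x # xs)))"
    using bidual_ext_canon_Cons[OF assms(1), of "b # ws" \<phi> C] assms(2-4) by simp
  ultimately show ?thesis by (simp only: bidual_ext.simps)
qed

text \<open>The span of \<open>X\<close> and \<open>a\<close>. Two general elements of the bidual
  need not commute in the extension of a symmetric form; here only the pair of \<open>a\<close> with
  itself involves no element of \<open>X\<close>, and it commutes trivially.\<close>

definition adjoin :: "(('v \<Rightarrow> 'k) \<Rightarrow> 'k) \<Rightarrow> (('v \<Rightarrow> 'k) \<Rightarrow> 'k) set" where
  "adjoin a = {canon X x + scale (bidual X) t a |x t. x \<in> carrier X}"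

lemma bidual_ext_swap:
  assumes a: "a \<in> carrier (bidual X)" and uv: "u \<in> adjoin a" "v \<in> adjoin a"
    and ws: "set ws \<subseteq> carrier (bidual X)"
  shows "set zs \<subseteq> carrier (bidual X) \<Longrightarrow> form (length (zs @ u # v # ws)) C \<phi> \<Longrightarrow>
    symmetric_multi (length (zs @ u # v # ws)) X \<phi> \<Longrightarrow>
    bidual_ext X (zs @ u # v # ws) \<phi> = bidual_ext X (zs @ v # u # ws) \<phi>"
proof (induction zs arbitrary: C \<phi>)
  case Nil
  let ?N = "Suc (Suc (length ws))"
  obtain x t y r where xy: "x \<in> carrier X" "u = canon X x + scale (bidual X) t a"
    "y \<in> carrier X" "v = canon X y + scale (bidual X) r a" using uv by (auto simp: adjoin_def)
  define G where "G b c = bidual_ext X (b # c # ws) \<phi>" for b c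
  have m: "multilinear ?N (bidual X) scalar_space (\<lambda>zs. bidual_ext X zs \<phi>)"
    using bidual_ext_multilinear[of ?N \<phi> C] Nil by simp
  have t: "b # c # ws \<in> tuples ?N (bidual X)" if "b \<in> carrier (bidual X)" "c \<in> carrier (bidual X)" for b c
    using that ws by (auto simp: tuples_def)
  have add: "G (b + b') c = G b c + G b' c" "G c (b + b') = G c b + G c b'"
    and sc: "G (scale (bidual X) k b) c = k * G b c" "G c (scale (bidual X) k b) = k * G c b"
    if "b \<in> carrier (bidual X)" "b' \<in> carrier (bidual X)" "c \<in> carrier (bidual X)" for b b' c k
    using multilinear_add[OF m, of "[]" b "c # ws" b'] multilinear_add[OF m, of "[c]" b ws b']
      multilinear_scale[OF m, of "[]" b "c # ws" k] multilinear_scale[OF m, of "[c]" b ws k] t that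
    unfolding G_def by (simp_all del: D.scale_dual bidual_ext.simps)
  have cn: "canon X x \<in> carrier (bidual X)" "canon X y \<in> carrier (bidual X)"
    "scale (bidual X) t a \<in> carrier (bidual X)" "scale (bidual X) r a \<in> carrier (bidual X)"
    using canon_bidual xy a B.scale_closed by blast+
  have sw: "G (canon X z) b = G b (canon X z)" if "z \<in> carrier X" "b \<in> carrier (bidual X)" for z b
    unfolding G_def using bidual_ext_swap_canon[OF that ws, of \<phi> C] Nil by simp
  \<comment> \<open>In the bilinear expansions of \<open>G u v\<close> and \<open>G v u\<close> the
    terms with \<open>G a a\<close> coincide, and every other term has a canonical argument and can
    be swapped.\<close>
  have "G u v = G (canon X x) (canon X y) + r * G (canon X x) a + (t * G a (canon X y) + t * (r * G a a))"
    unfolding xy using cn a by (simp add: add sc B.add_closed distrib_left del: D.scale_dual)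
  moreover have "G v u = G (canon X y) (canon X x) + t * G (canon X y) a + (r * G a (canon X x) + r * (t * G a a))"
    unfolding xy using cn a by (simp add: add sc B.add_closed distrib_left del: D.scale_dual)
  moreover have "G (canon X x) (canon X y) = G (canon X y) (canon X x)"
    "G (canon X x) a = G a (canon X x)" "G (canon X y) a = G a (canon X y)"
    using sw[OF xy(1) cn(2)] sw[OF xy(1) a] sw[OF xy(3) a] by blast+
  ultimately have "G u v = G v u" by (simp add: mult.left_commute add_ac)
  then show ?case by (simp add: G_def del: bidual_ext.simps)
next
  case (Cons z zs)
  have "slice (zs @ u # v # ws) \<phi> = slice (zs @ v # u # ws) \<phi>"
  proof
    fix x
    show "slice (zs @ u # v # ws) \<phi> x = slice (zs @ v # u # ws) \<phi> x"
    proof (cases "x \<in> carrier X")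
      case True
      obtain C' where C': "form (length (zs @ u # v # ws)) C' (\<lambda>xs. \<phi> (x # xs))"
        using form_Cons[of "length (zs @ u # v # ws)" \<phi> C x] Cons.prems(2) True by auto
      have "symmetric_multi (length (zs @ u # v # ws)) X (\<lambda>xs. \<phi> (x # xs))"
        using symmetric_multi_Cons[of "length (zs @ u # v # ws)" X \<phi> x] Cons.prems(3) True by auto
      then show ?thesis using Cons.IH[OF _ C'] Cons.prems(1) True by simp
    qed simp
  qed
  then show ?case by (simp only: append_Cons bidual_ext.simps)
qed

lemma adjoin_subset: "a \<in> carrier (bidual X) \<Longrightarrow> adjoin a \<subseteq> carrier (bidual X)"
  unfolding adjoin_def using canon_bidual B.scale_closed B.add_closed by blast

lemma canon_zero: "canon X 0 = 0"
  by (auto simp: canon_def dual_zero)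

lemma normed_space_adjoin:
  assumes a: "a \<in> carrier (bidual X)"
  shows "normed_space (bidual X\<lparr>carrier := adjoin a\<rparr>)"
proof (rule B.subspace_normed_space)
  have "0 = canon X 0 + scale (bidual X) 0 a" using canon_zero by (simp add: zero_fun_def)
  then show "0 \<in> adjoin a" unfolding adjoin_def using zero_closed by blast
next
  fix u v assume "u \<in> adjoin a" "v \<in> adjoin a"
  then obtain x t y r where xy: "x \<in> carrier X" "u = canon X x + scale (bidual X) t a"
    "y \<in> carrier X" "v = canon X y + scale (bidual X) r a" by (auto simp: adjoin_def)
  then have "u + v = canon X (x + y) + scale (bidual X) (t + r) a"
    by (auto simp: canon_add distrib_right)
  then show "u + v \<in> adjoin a" unfolding adjoin_def using xy add_closed by blast
next
  fix c u assume "u \<in> adjoin a"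
  then obtain x t where xy: "x \<in> carrier X" "u = canon X x + scale (bidual X) t a"
    by (auto simp: adjoin_def)
  then have "scale (bidual X) c u = canon X (scale X c x) + scale (bidual X) (c * t) a"
    by (auto simp: canon_scale distrib_left)
  then show "scale (bidual X) c u \<in> adjoin a" unfolding adjoin_def using xy scale_closed by blast
qed (rule adjoin_subset[OF a])

lemma canon_in_adjoin: 
  assumes "x \<in> carrier X" "a \<in> carrier (bidual X)"
  shows "canon X x \<in> adjoin a"
proof -
  have "canon X x = canon X x + scale (bidual X) 0 a" using B.scale_zero_left[OF assms(2)] by simp
  then show ?thesis unfolding adjoin_def using assms(1) by blast
qed

lemma self_in_adjoin: "a \<in> carrier (bidual X) \<Longrightarrow> a \<in> adjoin a"
proof -
  assume a: "a \<in> carrier (bidual X)"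
  have "a = canon X 0 + scale (bidual X) 1 a" using canon_zero by simp
  then show ?thesis unfolding adjoin_def using zero_closed by blast
qed

lemma bidual_ext_adjoin:
  assumes a: "a \<in> carrier (bidual X)" and f: "form N C \<phi>" "C \<ge> 0" "symmetric_multi N X \<phi>"
  defines "Z \<equiv> bidual X\<lparr>carrier := adjoin a\<rparr>"
  shows "multilinear N Z scalar_space (\<lambda>zs. bidual_ext X zs \<phi>)"
    and "ball_bounded N Z scalar_space C (\<lambda>zs. bidual_ext X zs \<phi>)"
    and "symmetric_multi N Z (\<lambda>zs. bidual_ext X zs \<phi>)"
proof -
  have sub: "zs \<in> tuples N (bidual X)" if "zs \<in> tuples N Z" for zs
    using that adjoin_subset[OF a] by (auto simp: tuples_def Z_def)
  have "multilinear N (bidual X) scalar_space (\<lambda>zs. bidual_ext X zs \<phi>)"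
    by (rule bidual_ext_multilinear[OF f(1)])
  then show "multilinear N Z scalar_space (\<lambda>zs. bidual_ext X zs \<phi>)"
    unfolding multilinear_def using sub adjoin_subset[OF a] by (auto simp: Z_def subset_iff)
  have "unit_ball Z \<subseteq> unit_ball (bidual X)"
    using adjoin_subset[OF a] by (auto simp: unit_ball_def Z_def)
  then show "ball_bounded N Z scalar_space C (\<lambda>zs. bidual_ext X zs \<phi>)"
    using bidual_ext_ball[of _ \<phi> C] f unfolding ball_bounded_def by auto
  show "symmetric_multi N Z (\<lambda>zs. bidual_ext X zs \<phi>)"
    unfolding symmetric_multi_def
  proof (intro ballI impI)
    fix xs ys assume t: "xs \<in> tuples N Z" "ys \<in> tuples N Z" and m: "mset xs = mset ys"
    show "bidual_ext X xs \<phi> = bidual_ext X ys \<phi>"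
    proof (rule adjacent_swaps_imp_symmetric[where Z = "adjoin a" and N = N])
      fix zs u v ws assume "set (zs @ u # v # ws) \<subseteq> adjoin a" "length (zs @ u # v # ws) = N"
      then show "bidual_ext X (zs @ u # v # ws) \<phi> = bidual_ext X (zs @ v # u # ws) \<phi>"
        using adjoin_subset[OF a] f by (intro bidual_ext_swap[OF a, where C = C]) auto
    qed (use t m in \<open>auto simp: tuples_def Z_def\<close>)
  qed
qed

text \<open>Exchange of the share \<open>1 / L\<close> of \<open>a\<close> for the same share of
  some \<open>s n\<close>. In the binomial expansion the linear term is a functional on
  \<open>X\<close> tested at \<open>s n\<close> minus its limit, hence small for large
  \<open>n\<close>; the terms of degree at least 2 are of order \<open>1 / L^2\<close> for every
  \<open>n\<close>.\<close>

lemma bidual_ext_step: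
  assumes a: "a \<in> unit_ball (bidual X)" and s: "\<And>n. s n \<in> unit_ball X"
    and lim: "\<And>f. f \<in> carrier (dual X) \<Longrightarrow> (\<lambda>n. f (s n)) \<longlonglongrightarrow> a f"
    and f: "form N C \<phi>" "C \<ge> 0" "symmetric_multi N X \<phi>"
    and v: "v \<in> adjoin a" "nrm (bidual X) v \<le> 1" and L: "L \<ge> (2::nat)" and \<tau>: "\<tau> > (0::real)"
  shows "\<exists>n. norm (bidual_ext X (replicate N (v + scale (bidual X) (of_real (1 / L)) (canon X (s n) - a))) \<phi>
     - bidual_ext X (replicate N v) \<phi>) \<le> 4 * 2 ^ N * C / (real L)\<^sup>2 + \<tau>"
proof (cases N)
  case 0
  then show ?thesis using f(2) \<tau> by auto
next
  case (Suc m)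
  note [simp del] = D.scale_dual bidual_ext.simps
  have ac: "a \<in> carrier (bidual X)" "nrm (bidual X) a \<le> 1" using a by (auto simp: B.unit_ball_iff)
  have vc: "v \<in> carrier (bidual X)" using v adjoin_subset[OF ac(1)] by auto
  define Z where "Z = bidual X\<lparr>carrier := adjoin a\<rparr>"
  interpret Z: normed_space Z unfolding Z_def by (rule normed_space_adjoin[OF ac(1)])
  interpret ZS: normed_pair Z "scalar_space :: ('k, 'k) nspace" ..
  define E where "E zs = bidual_ext X zs \<phi>" for zs
  have E: "multilinear N Z scalar_space E" "ball_bounded N Z scalar_space C E" "symmetric_multi N Z E"
    unfolding E_def Z_def using bidual_ext_adjoin[OF ac(1) f] by auto
  have Zs: "carrier Z = adjoin a" "scale Z = scale (bidual X)" "nrm Z = nrm (bidual X)"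
    by (simp_all add: Z_def)
  have vm: "set (replicate m v) \<subseteq> carrier (bidual X)" using vc by auto
  \<comment> \<open>The linear term as a function of its direction. With the direction in the
    outermost slot it is an element of \<open>dual X\<close>, so \<open>lim\<close> applies;
    symmetry is what moves the single increment into that slot.\<close>
  define g where "g = slice (replicate m v) \<phi>"
  have g: "g \<in> carrier (dual X)"
    unfolding g_def using slice_dual[OF vm, of \<phi> C] f Suc by simp
  have "\<forall>\<^sub>F n in sequentially. dist (g (s n)) (a g) < \<tau> / N"
    using lim[OF g] \<tau> Suc by (intro tendstoD) auto
  then obtain n where n: "norm (g (s n) - a g) < \<tau> / N"
    by (auto simp: eventually_sequentially dist_norm)
  define d where "d = canon X (s n) - a"
  have sn: "s n \<in> carrier X" "canon X (s n) \<in> unit_ball (bidual X)"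
    using s canon_ball by (auto simp: unit_ball_iff)
  have cs: "canon X (s n) \<in> carrier Z" "a \<in> carrier Z" "v \<in> carrier Z"
    using canon_in_adjoin[OF sn(1) ac(1)] self_in_adjoin[OF ac(1)] v by (auto simp: Zs)
  then have d: "d \<in> carrier Z" unfolding d_def by simp
  have "nrm Z d \<le> 2"
    unfolding d_def using Z.nrm_diff[OF cs(1,2)] sn(2) ac(2) by (simp add: Zs B.unit_ball_iff)
  \<comment> \<open>\<open>d\<close> has norm at most 2, so \<open>h'\<close> is in the unit ball,
    and \<open>j\<close> copies of the increment \<open>h\<close> contribute the factor
    \<open>(2 / L) ^ j\<close>.\<close>
  define h' where "h' = scale Z (of_real (1 / 2)) d"
  have h': "h' \<in> unit_ball Z" using Z.rescale(1)[OF d \<open>nrm Z d \<le> 2\<close>] by (simp add: h'_def)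
  then have h'c: "h' \<in> carrier Z" by (simp add: Z.unit_ball_iff)
  define h where "h = scale Z (of_real (1 / L)) d"
  have h: "h \<in> carrier Z" using d by (simp add: h_def)
  have hh': "h = scale Z (of_real (2 / L)) h'"
    unfolding h_def h'_def using d by (simp add: Z.scale_scale flip: of_real_mult)
  have Ed: "E (d # replicate m v) = g (s n) - a g"
  proof -
    have "E (d # replicate m v) = E (canon X (s n) # replicate m v) - E (a # replicate m v)"
      unfolding d_def using ZS.multilinear_diff[OF E(1), of "[]" "canon X (s n)" "replicate m v" a] cs Suc
        set_replicate_conv_if[of m v] by (simp add: tuples_def)
    then show ?thesis using g sn(1) by (simp add: E_def bidual_ext.simps g_def)
  qed
  define t where "t j = of_nat (N choose j) * E (replicate (N - j) v @ replicate j h)" for j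
  have "E (replicate N (v + h)) = (\<Sum>j\<le>N. t j)"
    using ZS.symmetric_binomial[OF E(1,3) cs(3) h, of "[]" N] by (simp add: t_def)
  also have "\<dots> = t 0 + (t 1 + (\<Sum>j<m. t (Suc (Suc j))))"
    by (simp add: Suc sum.atMost_shift lessThan_Suc_atMost)
  finally have diff: "E (replicate N (v + h)) - E (replicate N v) = t 1 + (\<Sum>j<m. t (Suc (Suc j)))"
    by (simp add: t_def)
  have t1: "norm (t 1) \<le> \<tau>"
  proof -
    have sym: "E xs = E ys" if "xs \<in> tuples N Z" "ys \<in> tuples N Z" "mset xs = mset ys" for xs ys
      using E(3) that unfolding symmetric_multi_def by blast
    have "E (replicate m v @ [h]) = E (h # replicate m v)"
      using cs(3) h Suc by (intro sym) (auto simp: tuples_def)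
    also have "\<dots> = of_real (1 / L) * E (d # replicate m v)"
      using multilinear_scale[OF E(1), of "[]" d "replicate m v" "of_real (1 / L)"] d cs(3) Suc
        set_replicate_conv_if[of m v] by (simp add: h_def tuples_def)
    finally have "norm (t 1) = N / L * norm (g (s n) - a g)"
      by (simp add: t_def Suc Ed norm_mult norm_divide del: of_nat_Suc)
    also have "\<dots> \<le> N / L * (\<tau> / N)" using n by (intro mult_left_mono) auto
    also have "\<dots> = \<tau> / L" using Suc by simp
    also have "\<dots> \<le> \<tau> / 1" using L \<tau> by (intro divide_left_mono) auto
    finally show ?thesis by simp
  qed
  have tj: "norm (t (Suc (Suc j))) \<le> real (N choose Suc (Suc j)) * (C * (2 / L)\<^sup>2)" if j: "j < m" for j
  proof -
    let ?j = "Suc (Suc j)"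
    have tup: "replicate (N - ?j) v @ replicate ?j h' \<in> tuples N Z"
      using cs(3) h'c j Suc by (auto simp: tuples_def)
    have "E (replicate (N - ?j) v @ replicate ?j h) =
        of_real (2 / L) ^ ?j * E (replicate (N - ?j) v @ replicate ?j h')"
      using ZS.multilinear_scale_map[OF E(1) tup, of "of_real (2 / L)"]
      by (simp only: hh' map_replicate length_replicate scale_scalar)
    moreover have "norm (E (replicate (N - ?j) v @ replicate ?j h')) \<le> C"
    proof -
      have "v \<in> unit_ball Z" using cs(3) v(2) by (simp add: Z.unit_ball_iff Zs)
      then have "set (replicate (N - ?j) v @ replicate ?j h') \<subseteq> unit_ball Z" using h' by auto
      then show ?thesis
        using ball_boundedD[OF E(2), of "replicate (N - ?j) v @ replicate ?j h'"] j Suc by simp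
    qed
    ultimately have "norm (E (replicate (N - ?j) v @ replicate ?j h)) \<le> (2 / L) ^ ?j * C"
      using L by (auto simp: norm_mult norm_power norm_divide intro!: mult_left_mono simp del: power_Suc)
    \<comment> \<open>\<open>L \<ge> 2\<close> gives \<open>2 / L \<le> 1\<close>, so among
      exponents at least 2 the square is the worst. Summing the binomial coefficients then produces
      \<open>4 * 2 ^ N\<close>.\<close>
    also have "\<dots> \<le> (2 / L) ^ 2 * C"
      using L f(2) by (intro mult_right_mono power_decreasing) auto
    finally show ?thesis
      by (auto simp: t_def norm_mult mult.commute intro!: mult_left_mono)
  qed
  have "norm (E (replicate N (v + h)) - E (replicate N v)) \<le>
      \<tau> + (\<Sum>j<m. real (N choose Suc (Suc j)) * (C * (2 / L)\<^sup>2))"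
    unfolding diff using tj by (intro norm_triangle_mono t1 order_trans[OF norm_sum] sum_mono) auto
  also have "(\<Sum>j<m. real (N choose Suc (Suc j)) * (C * (2 / L)\<^sup>2)) =
      real (\<Sum>j<m. N choose Suc (Suc j)) * (C * (2 / L)\<^sup>2)"
    by (simp add: sum_distrib_right)
  also have "\<dots> \<le> real (2 ^ N) * (C * (2 / L)\<^sup>2)"
  proof -
    have "(\<Sum>j\<le>N. N choose j) = 2 ^ N" by (rule choose_row_sum)
    then have "(\<Sum>j<m. N choose Suc (Suc j)) \<le> 2 ^ N"
      by (simp add: Suc sum.atMost_shift lessThan_Suc_atMost)
    then show ?thesis using f(2) by (intro mult_right_mono) (simp_all only: of_nat_le_iff, simp)
  qed
  finally show ?thesis
    unfolding E_def h_def Zs d_def by (intro exI[of _ n]) (simp add: power_divide algebra_simps)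
qed

text \<open>\<open>L\<close> steps lead from \<open>a\<close> to an average of \<open>L\<close>
  points \<open>s (ns i)\<close>, at cost \<open>K / L^2 + \<tau>\<close> each.\<close>

lemma bidual_ext_approx:
  assumes a: "a \<in> unit_ball (bidual X)" and s: "\<And>n. s n \<in> unit_ball X"
    and lim: "\<And>f. f \<in> carrier (dual X) \<Longrightarrow> (\<lambda>n. f (s n)) \<longlonglongrightarrow> a f"
    and f: "form N C \<phi>" "C \<ge> 0" "symmetric_multi N X \<phi>" and \<eta>: "\<eta> > 0"
  shows "\<exists>L\<ge>(1::nat). \<exists>ns. norm (\<phi> (replicate N (scale X (of_real (1 / L)) (\<Sum>i<L. s (ns i))))
     - bidual_ext X (replicate N a) \<phi>) < \<eta>"
proof -
  note [simp del] = D.scale_dual bidual_ext.simps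
  have ac: "a \<in> carrier (bidual X)" "nrm (bidual X) a \<le> 1" using a by (auto simp: B.unit_ball_iff)
  define Z where "Z = bidual X\<lparr>carrier := adjoin a\<rparr>"
  interpret Z: normed_space Z unfolding Z_def by (rule normed_space_adjoin[OF ac(1)])
  have Zs: "carrier Z = adjoin a" "scale Z = scale (bidual X)" "nrm Z = nrm (bidual X)"
    by (simp_all add: Z_def)
  define K where "K = 4 * 2 ^ N * C"
  have K: "K \<ge> 0" using f(2) by (simp add: K_def)
  obtain L0 :: nat where L0: "real L0 > 2 * K / \<eta>" using reals_Archimedean2 by blast
  \<comment> \<open>\<open>L0\<close> pushes the accumulated error \<open>K / L\<close> below
    \<open>\<eta> / 2\<close>, and the summand 2 secures the requirement \<open>L \<ge> 2\<close> of
    a single step.\<close>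
  define L where "L = L0 + 2"
  have L: "L \<ge> 2" "K / L < \<eta> / 2" using L0 \<eta> K by (auto simp: L_def field_simps)
  define \<tau> where "\<tau> = \<eta> / (4 * L)"
  have \<tau>: "\<tau> > 0" using \<eta> L by (simp add: \<tau>_def)
  define p where "p v = bidual_ext X (replicate N v) \<phi>" for v
  define c where "c n = canon X (s n)" for n
  have sc: "s n \<in> carrier X" for n using s by (simp add: unit_ball_iff)
  have cZ: "c n \<in> carrier Z" "nrm Z (c n) \<le> 1" for n
    using canon_in_adjoin[OF sc ac(1)] canon_ball[OF s] by (auto simp: Zs c_def B.unit_ball_iff)
  have aZ: "a \<in> carrier Z" "nrm Z a \<le> 1" using self_in_adjoin[OF ac(1)] ac(2) by (auto simp: Zs)
  \<comment> \<open>The hybrid in which \<open>r\<close> of the \<open>L\<close> equal shares of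
    \<open>a\<close> are already exchanged. The index for the next share is found only afterwards,
    since the functional that it has to treat depends on the current hybrid.\<close>
  define V where "V ns r = scale Z (of_real (1 / L)) ((\<Sum>i<r. c (ns i)) + scale Z (of_nat (L - r)) a)" for ns r
  have VZ: "V ns r \<in> carrier Z" for ns r unfolding V_def using cZ aZ by auto
  have Vn: "nrm Z (V ns r) \<le> 1" if "r \<le> L" for ns r
  proof -
    have "nrm Z ((\<Sum>i<r. c (ns i)) + scale Z (of_nat (L - r)) a) \<le> (\<Sum>i<r. 1) + real (L - r) * 1"
      using cZ aZ
      by (intro order_trans[OF Z.nrm_add] add_mono order_trans[OF Z.nrm_sum] sum_mono)
         (auto simp: Z.nrm_scale mult_left_le)
    also have "\<dots> = L" using that by simp
    finally have "(1 / L) * nrm Z ((\<Sum>i<r. c (ns i)) + scale Z (of_nat (L - r)) a) \<le> (1 / L) * L"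
      by (intro mult_left_mono) auto
    then show ?thesis unfolding V_def using cZ aZ L by (simp add: Z.nrm_scale norm_divide)
  qed
  have "\<exists>ns. norm (p (V ns r) - p a) \<le> r * (K / (real L)\<^sup>2 + \<tau>)" if "r \<le> L" for r
    using that
  proof (induction r)
    case 0
    have "V ns 0 = a" for ns
    proof -
      have "(of_real (1 / real L) * of_nat L :: 'k) = 1" using L by simp
      then show ?thesis using aZ by (simp add: V_def Z.scale_scale del: of_real_divide)
    qed
    then show ?case by simp
  next
    case (Suc r)
    then obtain ns where ns: "norm (p (V ns r) - p a) \<le> r * (K / (real L)\<^sup>2 + \<tau>)" by auto
    obtain n where n: "norm (p (V ns r + scale Z (of_real (1 / L)) (c n - a)) - p (V ns r))
        \<le> K / (real L)\<^sup>2 + \<tau>"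
      using bidual_ext_step[OF a s lim f _ _ L(1) \<tau>, of "V ns r"] VZ[of ns r] Vn[of r ns] Suc.prems
      unfolding p_def c_def K_def by (auto simp: Zs)
    have "V (ns(r := n)) (Suc r) = V ns r + scale Z (of_real (1 / L)) (c n - a)"
    proof -
      have "L - r = Suc (L - Suc r)" using Suc.prems by simp
      then have "scale Z (of_nat (L - r)) a = scale Z (of_nat (L - Suc r)) a + a"
        using Z.scale_add_left[OF aZ(1), of "of_nat (L - Suc r)" 1] aZ(1) by (simp add: add.commute)
      then have "(\<Sum>i<Suc r. c ((ns(r := n)) i)) + scale Z (of_nat (L - Suc r)) a =
          ((\<Sum>i<r. c (ns i)) + scale Z (of_nat (L - r)) a) + (c n - a)"
        by (simp add: add_ac)
      moreover have "(\<Sum>i<r. c (ns i)) + scale Z (of_nat (L - r)) a \<in> carrier Z" "c n - a \<in> carrier Z"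
        using cZ aZ by auto
      ultimately show ?thesis unfolding V_def using Z.scale_add_right by presburger
    qed
    then have "p (V (ns(r := n)) (Suc r)) - p a =
        (p (V ns r + scale Z (of_real (1 / L)) (c n - a)) - p (V ns r)) + (p (V ns r) - p a)" by simp
    also have "norm \<dots> \<le> (K / (real L)\<^sup>2 + \<tau>) + r * (K / (real L)\<^sup>2 + \<tau>)"
      by (rule norm_triangle_mono[OF n ns])
    also have "\<dots> = Suc r * (K / (real L)\<^sup>2 + \<tau>)"
      by (simp only: of_nat_Suc distrib_right mult_1_left)
    finally show ?case by (rule exI[of _ "ns(r := n)"])
  qed
  from this[of L] obtain ns where ns: "norm (p (V ns L) - p a) \<le> L * (K / (real L)\<^sup>2 + \<tau>)" by auto
  let ?y = "scale X (of_real (1 / L)) (\<Sum>i<L. s (ns i))"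
  have csum: "canon X (\<Sum>i\<in>A. s (ns i)) = (\<Sum>i\<in>A. c (ns i))" for A :: "nat set"
  proof (induction A rule: infinite_finite_induct)
    case (insert i A)
    then show ?case using canon_add[OF sc sum_closed, of A "\<lambda>i. s (ns i)" "ns i"] sc by (simp add: c_def)
  qed (simp_all add: canon_zero)
  have "V ns L = canon X ?y"
    unfolding V_def using aZ(1) Z.sum_closed[of "{..<L}" "\<lambda>i. c (ns i)"] cZ(1) sc
    B.scale_zero_left[OF ac(1)]
    by (simp add: canon_scale csum Zs)
  moreover have "p (canon X ?y) = \<phi> (replicate N ?y)"
  proof -
    have "?y \<in> carrier X" using sc by (intro scale_closed sum_closed) auto
    then have "set (replicate N ?y) \<subseteq> carrier X" by (simp add: set_replicate_conv_if)
    then show ?thesis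
      unfolding p_def using bidual_ext_canon[of "replicate N ?y" \<phi> C] f(1) by (simp add: map_replicate)
  qed
  moreover have "L * (K / (real L)\<^sup>2 + \<tau>) < \<eta>"
  proof -
    have "L * (K / (real L)\<^sup>2 + \<tau>) = K / L + \<eta> / 4"
      using L(1) by (simp add: \<tau>_def power2_eq_square field_simps)
    then show ?thesis using L(2) \<eta> by simp
  qed
  ultimately show ?thesis using ns L(1) unfolding p_def by (intro exI[of _ L] conjI exI[of _ ns]) auto
qed

text \<open>A sequence converging weak-star to \<open>z\<close> refines the filter. Properness is
  what makes the limits in \<open>wstar_lim\<close> unique.\<close>

lemma wstar_filter_nontrivial:
  assumes "\<And>n. s n \<in> carrier X" "\<And>f. f \<in> carrier (dual X) \<Longrightarrow> (\<lambda>n. f (s n)) \<longlonglongrightarrow> z f"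
  shows "wstar_filter X z \<noteq> bot"
proof -
  have "filterlim s (wstar_filter X z) sequentially"
    unfolding wstar_filter_def using assms
    by (auto simp: filterlim_inf filterlim_principal filterlim_INF filterlim_filtercomap_iff o_def)
  then show ?thesis
    by (metis filterlim_def filtermap_bot_iff le_bot sequentially_bot)
qed

end

section \<open>Vector-valued Aron--Berner extensions through scalar forms\<close>

locale normed_bidual_pair = normed_bidual X + Y: normed_bidual Y
  for X :: "('k::real_normed_field, 'v::ab_group_add) nspace"
    and Y :: "('k, 'y::ab_group_add) nspace"
begin

sublocale XY: normed_pair X Y ..

lemma compose_dual:
  assumes "multilinear N X Y \<Phi>" "ball_bounded N X Y C \<Phi>" "C \<ge> 0" "f \<in> carrier (dual Y)"
  shows "form N (nrm (dual Y) f * C) (\<lambda>xs. f (\<Phi> xs))"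
proof
  show "multilinear N X scalar_space (\<lambda>xs. f (\<Phi> xs))"
  proof (rule multilinearI)
    fix xs ys u v assume t: "xs @ u # ys \<in> tuples N X" and v: "v \<in> carrier X"
    then have t': "xs @ v # ys \<in> tuples N X" by (auto simp: tuples_def)
    show "f (\<Phi> (xs @ (u + v) # ys)) = f (\<Phi> (xs @ u # ys)) + f (\<Phi> (xs @ v # ys))"
      unfolding multilinear_add[OF assms(1) t v]
      by (rule Y.dual_add[OF assms(4) multilinear_closed[OF assms(1) t] multilinear_closed[OF assms(1) t']])
  next
    fix xs ys u c assume t: "xs @ u # ys \<in> tuples N X"
    show "f (\<Phi> (xs @ scale X c u # ys)) = scale scalar_space c (f (\<Phi> (xs @ u # ys)))"
      unfolding multilinear_scale[OF assms(1) t]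
      using Y.dual_scale[OF assms(4) multilinear_closed[OF assms(1) t]] by simp
  qed simp
  show "ball_bounded N X scalar_space (nrm (dual Y) f * C) (\<lambda>xs. f (\<Phi> xs))"
    unfolding ball_bounded_def
  proof (intro allI impI)
    fix xs assume xs: "length xs = N \<and> set xs \<subseteq> unit_ball X"
    then have t: "xs \<in> tuples N X" by (auto simp: tuples_def unit_ball_iff)
    have "norm (f (\<Phi> xs)) \<le> nrm (dual Y) f * nrm Y (\<Phi> xs)"
      by (rule Y.dual_le[OF assms(4) multilinear_closed[OF assms(1) t]])
    also have "\<dots> \<le> nrm (dual Y) f * C"
      using ball_boundedD[OF assms(2)] xs Y.D.nrm_nonneg[OF assms(4)] by (intro mult_left_mono) auto
    finally show "nrm scalar_space (f (\<Phi> xs)) \<le> nrm (dual Y) f * C" by simp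
  qed
qed

text \<open>Weak-star limits in the bidual of \<open>Y\<close> are tested by functionals
  \<open>f\<close>, and for each \<open>f\<close> the iterated limit is that of the scalar form
  \<open>f\<close> after \<open>\<Phi>\<close>. The resulting function of \<open>f\<close> is linear
  and bounded, so it is the element described by the definite choice in
  \<open>wstar_lim\<close>.\<close>

lemma iter_lim_eq_bidual_ext:
  assumes "multilinear (length zs) X Y \<Phi>" "ball_bounded (length zs) X Y C \<Phi>" "C \<ge> 0"
    "\<And>z. z \<in> set zs \<Longrightarrow> z \<in> carrier (bidual X) \<and> wstar_filter X z \<noteq> bot"
  shows "iter_lim X Y zs \<Phi> = (\<lambda>f. if f \<in> carrier (dual Y) then bidual_ext X zs (\<lambda>xs. f (\<Phi> xs)) else 0)"
  using assms
proof (induction zs arbitrary: \<Phi> C)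
  case Nil
  then show ?case by (auto simp: canon_def)
next
  case (Cons z zs)
  note m = Cons.prems(1) and b = Cons.prems(2)
  define R where "R = (\<lambda>f. if f \<in> carrier (dual Y) then bidual_ext X (z # zs) (\<lambda>xs. f (\<Phi> xs)) else 0)"
  have z: "z \<in> carrier (bidual X)" "wstar_filter X z \<noteq> bot" using Cons.prems(4) by auto
  have zs: "set zs \<subseteq> carrier (bidual X)" "set (z # zs) \<subseteq> carrier (bidual X)" using Cons.prems(4) by auto
  have inner: "iter_lim X Y zs (\<lambda>xs. \<Phi> (x # xs)) f = bidual_ext X zs (\<lambda>xs. f (\<Phi> (x # xs)))"
    if x: "x \<in> carrier X" and f: "f \<in> carrier (dual Y)" for x f
  proof -
    have r: "nrm X x \<le> nrm X x + 1" "nrm X x + 1 > 0" using nrm_nonneg[OF x] by auto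
    have "iter_lim X Y zs (\<lambda>xs. \<Phi> (x # xs)) =
        (\<lambda>f. if f \<in> carrier (dual Y) then bidual_ext X zs (\<lambda>xs. f (\<Phi> (x # xs))) else 0)"
      using multilinear_Cons[of "length zs" X Y \<Phi> x] XY.ball_bounded_Cons[OF _ _ x r, of "length zs" \<Phi> C]
        m b x Cons.prems(3,4) r by (intro Cons.IH[where C = "C * (nrm X x + 1)"]) auto
    then show ?thesis using f by simp
  qed
  have fm: "form (Suc (length zs)) (nrm (dual Y) f * C) (\<lambda>xs. f (\<Phi> xs))" if "f \<in> carrier (dual Y)" for f
    using compose_dual[OF m b Cons.prems(3) that] by simp
  have lim: "((\<lambda>x. iter_lim X Y zs (\<lambda>xs. \<Phi> (x # xs)) f) \<longlongrightarrow> R f) (wstar_filter X z)"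
    if f: "f \<in> carrier (dual Y)" for f
  proof -
    let ?g = "slice zs (\<lambda>xs. f (\<Phi> xs))"
    have g: "?g \<in> carrier (dual X)" using slice_dual[OF zs(1) fm[OF f]] .
    \<comment> \<open>The slice is itself one of the functionals that generate the filter, so
      convergence to \<open>z ?g\<close> is immediate.\<close>
    have "wstar_filter X z \<le> filtercomap ?g (nhds (z ?g))"
      unfolding wstar_filter_def using g by (intro le_infI2 INF_lower)
    then have "(?g \<longlongrightarrow> z ?g) (wstar_filter X z)"
      by (simp only: filterlim_iff_le_filtercomap)
    moreover have "eventually (\<lambda>x. x \<in> carrier X) (wstar_filter X z)"
      unfolding wstar_filter_def by (rule filter_leD[OF inf_le1]) (simp add: eventually_principal)
    then have "eventually (\<lambda>x. ?g x = iter_lim X Y zs (\<lambda>xs. \<Phi> (x # xs)) f) (wstar_filter X z)"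
      by eventually_elim (use inner f in auto)
    ultimately have "((\<lambda>x. iter_lim X Y zs (\<lambda>xs. \<Phi> (x # xs)) f) \<longlongrightarrow> z ?g) (wstar_filter X z)"
      by (rule Lim_transform_eventually)
    then show ?thesis using f by (simp add: R_def)
  qed
  have R: "R \<in> carrier (bidual Y)"
  proof (rule Y.D.dualI[where C = "C * (\<Prod>z\<leftarrow>z # zs. nrm (bidual X) z)"])
    have lc: "bidual_ext X (z # zs) (\<lambda>xs. c * f (\<Phi> xs) + g (\<Phi> xs)) = c * R f + R g"
      if "f \<in> carrier (dual Y)" "g \<in> carrier (dual Y)" for f g c
      using bidual_ext_lincomb[OF zs(2), of "\<lambda>xs. f (\<Phi> xs)" "nrm (dual Y) f * C"
          "\<lambda>xs. g (\<Phi> xs)" "nrm (dual Y) g * C" c] fm[OF that(1)] fm[OF that(2)] that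
      by (simp add: R_def del: bidual_ext.simps)
    show add: "R (f + g) = R f + R g" if "f \<in> carrier (dual Y)" "g \<in> carrier (dual Y)" for f g
      using lc[OF that, of 1] Y.D.add_closed[OF that] by (simp add: R_def del: bidual_ext.simps)
    have z0: "R 0 = 0" using add[of 0 0] by simp
    show "R (scale (dual Y) c f) = c * R f" if "f \<in> carrier (dual Y)" for c f
      using lc[OF that Y.D.zero_closed, of c] z0 Y.D.scale_closed[OF that, of c]
      by (simp add: R_def del: bidual_ext.simps)
    show "norm (R f) \<le> C * (\<Prod>z\<leftarrow>z # zs. nrm (bidual X) z)" if "f \<in> unit_ball (dual Y)" for f
    proof -
      have f: "f \<in> carrier (dual Y)" "nrm (dual Y) f \<le> 1" using that by (auto simp: Y.D.unit_ball_iff)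
      have p: "(\<Prod>z\<leftarrow>z # zs. nrm (bidual X) z) \<ge> 0" using zs(2) by (intro prod_list_nonneg) auto
      have "norm (R f) \<le> (nrm (dual Y) f * C) * (\<Prod>z\<leftarrow>z # zs. nrm (bidual X) z)"
        using bidual_ext_bound[OF zs(2)] fm[OF f(1)] f(1) by (simp add: R_def del: bidual_ext.simps)
      also have "\<dots> \<le> C * (\<Prod>z\<leftarrow>z # zs. nrm (bidual X) z)"
        using f(2) Cons.prems(3) p by (intro mult_right_mono) (simp_all add: mult_left_le_one_le f)
      finally show ?thesis .
    qed
  qed (simp add: R_def)
  have "wstar_lim Y (wstar_filter X z) (\<lambda>x. iter_lim X Y zs (\<lambda>xs. \<Phi> (x # xs))) = R"
    unfolding wstar_lim_def
  proof (rule the_equality)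
    fix R' assume R': "R' \<in> carrier (bidual Y) \<and>
      (\<forall>f\<in>carrier (dual Y). ((\<lambda>x. iter_lim X Y zs (\<lambda>xs. \<Phi> (x # xs)) f) \<longlongrightarrow> R' f) (wstar_filter X z))"
    show "R' = R"
    proof
      fix f
      show "R' f = R f"
      proof (cases "f \<in> carrier (dual Y)")
        case True
        then show ?thesis using tendsto_unique[OF z(2) _ lim[OF True]] R' by blast
      next
        case False
        then show ?thesis using Y.D.dual_outside[of R' f] R' by (simp add: R_def)
      qed
    qed
  qed (use R lim in auto)
  then show ?case by (simp add: R_def)
qed

text \<open>Composition with \<open>f\<close> reduces the claim to a scalar form; the number of
  averaged points and their indices may depend on \<open>f\<close> and
  \<open>\<eta>\<close>.\<close>

lemma aron_berner_approx:
  assumes P: "P \<in> polys N X Y" and a: "a \<in> unit_ball (bidual X)" and s: "\<And>n. s n \<in> unit_ball X"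
    and lim: "\<And>f. f \<in> carrier (dual X) \<Longrightarrow> (\<lambda>n. f (s n)) \<longlonglongrightarrow> a f"
    and f: "f \<in> carrier (dual Y)" and \<eta>: "\<eta> > 0"
  shows "\<exists>L\<ge>(1::nat). \<exists>ns. norm (f (P (scale X (of_real (1 / L)) (\<Sum>i<L. s (ns i)))) - aron_berner N X Y P a f) < \<eta>"
proof -
  let ?\<Phi> = "assoc_sym N X Y P"
  note \<Phi> = XY.assoc_sym[OF P]
  have sc: "s n \<in> carrier X" for n using s by (simp add: unit_ball_iff)
  obtain C where C: "C \<ge> 0" "ball_bounded N X Y C ?\<Phi>"
    using XY.continuous_imp_ball_bounded[OF \<Phi>(1,2)] by blast
  have "a \<in> carrier (bidual X)" "wstar_filter X a \<noteq> bot"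
    using a wstar_filter_nontrivial[of s a, OF sc lim] by (auto simp: B.unit_ball_iff)
  then have ab: "aron_berner N X Y P a f = bidual_ext X (replicate N a) (\<lambda>xs. f (?\<Phi> xs))"
    unfolding aron_berner_def using iter_lim_eq_bidual_ext[of "replicate N a" ?\<Phi> C] \<Phi>(1) C f by auto
  have fm: "form N (nrm (dual Y) f * C) (\<lambda>xs. f (?\<Phi> xs))" by (rule compose_dual[OF \<Phi>(1) C(2,1) f])
  have sym: "symmetric_multi N X (\<lambda>xs. f (?\<Phi> xs))"
    using \<Phi>(3) unfolding symmetric_multi_def by metis
  have "nrm (dual Y) f * C \<ge> 0" using Y.D.nrm_nonneg[OF f] C(1) by simp
  from bidual_ext_approx[OF a s lim fm this sym \<eta>] show ?thesis
    unfolding ab using \<Phi>(4) sc by simp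
qed

end

section \<open>The Lorentz sequence space\<close>

lemma decr_rearr_set_nonempty:
  fixes x :: "nat \<Rightarrow> 'k::real_normed_field"
  assumes "bounded (range x)"
  shows "{t. t \<ge> 0 \<and> finite {i. norm (x i) > t} \<and> card {i. norm (x i) > t} \<le> n} \<noteq> {}"
proof -
  obtain B where B: "\<And>i. norm (x i) \<le> B" using assms by (auto simp: bounded_iff)
  then have "{i. norm (x i) > B} = {}" by (simp add: not_less)
  moreover have "B \<ge> 0" using B[of 0] norm_ge_zero order_trans by blast
  ultimately have "B \<in> {t. t \<ge> 0 \<and> finite {i. norm (x i) > t} \<and> card {i. norm (x i) > t} \<le> n}"
    by simp
  then show ?thesis by blast
qed

lemma decr_rearr_nonneg: "bounded (range x) \<Longrightarrow> decr_rearr x n \<ge> 0"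
  unfolding decr_rearr_def using decr_rearr_set_nonempty[of x n] by (intro cInf_greatest) auto

text \<open>Remove the smallest entry from \<open>n + 1\<close> indices: a level below it is
  exceeded by all of them, so it cannot occur in the infimum that defines
  \<open>decr_rearr x n\<close>.\<close>

lemma sum_le_decr_rearr:
  assumes "bounded (range x)"
  shows "finite A \<Longrightarrow> (\<Sum>i\<in>A. norm (x i)) \<le> (\<Sum>i<card A. decr_rearr x i)"
proof (induction "card A" arbitrary: A)
  case (Suc n)
  then have ne: "A \<noteq> {}" by auto
  define a where "a = arg_min_on (\<lambda>i. norm (x i)) A"
  have a: "a \<in> A" "\<And>i. i \<in> A \<Longrightarrow> norm (x a) \<le> norm (x i)"
    unfolding a_def using arg_min_if_finite(1)[OF Suc.prems ne] arg_min_least[OF Suc.prems ne] by auto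
  have "norm (x a) \<le> decr_rearr x n"
    unfolding decr_rearr_def
  proof (rule cInf_greatest[OF decr_rearr_set_nonempty[OF assms]])
    fix t assume t: "t \<in> {t. t \<ge> 0 \<and> finite {i. norm (x i) > t} \<and> card {i. norm (x i) > t} \<le> n}"
    show "norm (x a) \<le> t"
    proof (rule ccontr)
      assume "\<not> norm (x a) \<le> t"
      then have "A \<subseteq> {i. norm (x i) > t}" using a by force
      then have "card A \<le> n" using card_mono[of "{i. norm (x i) > t}" A] t by simp
      then show False using Suc.hyps(2) by simp
    qed
  qed
  moreover have "(\<Sum>i\<in>A - {a}. norm (x i)) \<le> (\<Sum>i<n. decr_rearr x i)"
    using Suc.hyps(1)[of "A - {a}"] Suc.hyps(2)[symmetric] Suc.prems a(1) by simp
  ultimately show ?case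
    using Suc.hyps(2)[symmetric] sum.remove[OF Suc.prems a(1), of "\<lambda>i. norm (x i)"] by simp
qed auto

text \<open>Greedy choice: if all indices outside \<open>A\<close> stayed at or below
  \<open>decr_rearr x n - e\<close>, at most \<open>n\<close> indices would exceed that level,
  against the infimum. The loss \<open>e\<close> per index is there because suprema of a bounded
  sequence need not be attained.\<close>

lemma decr_rearr_sum_le:
  assumes "bounded (range x)" "(e :: real) > 0"
  shows "\<exists>A. finite A \<and> card A = n \<and> (\<Sum>i<n. decr_rearr x i) \<le> (\<Sum>i\<in>A. norm (x i)) + n * e"
proof (induction n)
  case 0
  show ?case by (intro exI[of _ "{}"]) auto
next
  case (Suc n)
  then obtain A where A: "finite A" "card A = n" "(\<Sum>i<n. decr_rearr x i) \<le> (\<Sum>i\<in>A. norm (x i)) + n * e"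
    by blast
  have "\<exists>a. a \<notin> A \<and> decr_rearr x n - e < norm (x a)"
  proof (rule ccontr)
    assume "\<nexists>a. a \<notin> A \<and> decr_rearr x n - e < norm (x a)"
    then have le: "norm (x a) \<le> decr_rearr x n - e" if "a \<notin> A" for a using that by force
    obtain b where "b \<notin> A" using A(1) by (meson ex_new_if_finite infinite_UNIV_nat)
    \<comment> \<open>Only nonnegative levels compete in the infimum; an index outside the finite
      set \<open>A\<close> shows that this one does.\<close>
    then have t0: "decr_rearr x n - e \<ge> 0" using le order_trans norm_ge_zero by blast
    have sub: "{i. norm (x i) > decr_rearr x n - e} \<subseteq> A" using le by force
    then have "decr_rearr x n \<le> decr_rearr x n - e"
      unfolding decr_rearr_def[of x n]
      using t0 A(1,2) finite_subset[OF sub] card_mono[OF A(1) sub]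
      by (intro cInf_lower) (auto simp: decr_rearr_def[of x n] intro: bdd_belowI[of _ 0])
    then show False using assms(2) by simp
  qed
  then obtain a where "a \<notin> A" "decr_rearr x n - e < norm (x a)" by blast
  then show ?case using A by (intro exI[of _ "insert a A"]) (auto simp: algebra_simps)
qed

lemma carrier_d_lower: "carrier (d_lower w) = {x \<in> carrier (d_upper w). lorentz_quot w x \<longlonglongrightarrow> 0}"
  and nrm_d_lower: "nrm (d_lower w) x = (SUP n\<in>{1..}. lorentz_quot w x n)"
  and scale_d_lower: "scale (d_lower w) c x = (\<lambda>i. c * x i)"
  and carrier_d_upper: "carrier (d_upper w) = {x. bounded (range x) \<and> bdd_above (lorentz_quot w x ` {1..})}"
  by (simp_all add: d_lower_def d_upper_def)

definition unit_seq :: "nat \<Rightarrow> nat \<Rightarrow> 'k::real_normed_field" where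
  "unit_seq k = (\<lambda>i. if i = k then 1 else 0)"

definition trunc :: "nat \<Rightarrow> (nat \<Rightarrow> 'k::real_normed_field) \<Rightarrow> nat \<Rightarrow> 'k" where
  "trunc n x = (\<lambda>i. if i < n then x i else 0)"

lemma trunc_add: "trunc n (x + y) = trunc n x + trunc n y"
  by (auto simp: trunc_def)

lemma sum_fun_apply: "(\<Sum>i\<in>A. g i) x = (\<Sum>i\<in>A. g i x)"
  for g :: "'i \<Rightarrow> 'a \<Rightarrow> 'b::comm_monoid_add"
  by (induction A rule: infinite_finite_induct) auto

section \<open>Weights and the norm in terms of finite sums\<close>

locale weight =
  fixes w :: "nat \<Rightarrow> real"
  assumes admissible: "admissible w"
begin

definition W :: "nat \<Rightarrow> real" where
  "W n = (\<Sum>i<n. w i)"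

abbreviation X :: "('k::real_normed_field, nat \<Rightarrow> 'k) nspace" where
  "X \<equiv> d_lower w"

lemma w_nonneg: "w i \<ge> 0" and w_0: "w 0 = 1" and w_antimono: "i \<le> j \<Longrightarrow> w j \<le> w i"
  and w_tendsto: "w \<longlonglongrightarrow> 0" and w_not_summable: "\<not> summable w"
  using admissible by (auto simp: admissible_def decseq_def)

lemma w_le_1: "w i \<le> 1"
  using w_antimono[of 0 i] w_0 by simp

lemma w_pos: "w i > 0"
proof (rule ccontr)
  assume "\<not> w i > 0"
  then have "w j = 0" if "j \<notin> {..<i}" for j using that w_antimono[of i j] w_nonneg[of j] by auto
  then have "summable w" by (intro summable_finite[of "{..<i}"]) auto
  then show False using w_not_summable by simp
qed

lemma W_0 [simp]: "W 0 = 0" and W_Suc: "W (Suc n) = W n + w n"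
  by (simp_all add: W_def)

lemma W_mono: "m \<le> n \<Longrightarrow> W m \<le> W n"
  unfolding W_def using w_nonneg by (intro sum_mono2) auto

lemma W_nonneg [simp]: "W n \<ge> 0"
  unfolding W_def using w_nonneg by (intro sum_nonneg) auto

lemma W_ge_1: "n \<ge> 1 \<Longrightarrow> W n \<ge> 1"
  using W_mono[of 1 n] by (simp add: W_def w_0)

lemma W_unbounded: "\<exists>n\<ge>1. W n \<ge> B"
proof (rule ccontr)
  assume "\<not> (\<exists>n\<ge>1. W n \<ge> B)"
  then have lt: "W n < B" if "n \<ge> 1" for n using that by force
  have "W n \<le> max 0 B" for n
    using lt[of n] by (cases "n = 0") (simp_all add: le_max_iff_disj)
  then have "summable w"
    using w_nonneg unfolding W_def by (intro summableI_nonneg_bounded[of w "max 0 B"]) auto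
  then show False using w_not_summable by simp
qed

text \<open>The averages \<open>W n / n\<close> of a null sequence tend to 0. This limits the number
  of large coordinates of a point of the unit ball.\<close>

lemma W_sublinear:
  assumes "(\<mu> :: real) > 0"
  shows "\<exists>K. \<forall>n\<ge>K. W n < n * \<mu>"
proof -
  obtain m where m: "\<And>i. i \<ge> m \<Longrightarrow> w i \<le> \<mu> / 2"
    using order_tendstoD(2)[OF w_tendsto, of "\<mu> / 2"] assms
    by (auto simp: eventually_sequentially intro: less_imp_le)
  have le: "W n \<le> m + n * (\<mu> / 2)" for n
  proof (induction n)
    case (Suc n)
    show ?case
    proof (cases "n < m")
      case True
      have "W (Suc n) \<le> (\<Sum>i<Suc n. 1)" unfolding W_def by (intro sum_mono w_le_1)
      then show ?thesis using True assms by (simp add: add_increasing2)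
    next
      case False
      then show ?thesis using Suc m[of n] by (simp add: W_Suc field_simps)
    qed
  qed simp
  obtain K :: nat where K: "real K > 2 * m / \<mu>" using reals_Archimedean2 by blast
  have "W n < n * \<mu>" if "n \<ge> K" for n
  proof -
    have "real m < K * (\<mu> / 2)" using K assms by (simp add: field_simps)
    also have "\<dots> \<le> n * (\<mu> / 2)" using that assms by (intro mult_right_mono) auto
    finally have "real m < n * (\<mu> / 2)" .
    then show ?thesis using le[of n] by simp
  qed
  then show ?thesis by blast
qed

text \<open>\<open>lorentz_le x r\<close> expresses \<open>\<parallel>x\<parallel>\<^sub>W \<le> r\<close> without decreasing rearrangements:
  \<open>x\<^sup>*(1) + \<dots> + x\<^sup>*(n)\<close> is the supremum of the sums of \<open>n\<close> of the numbers \<open>\<bar>x(i)\<bar>\<close>.\<close>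

definition lorentz_le :: "(nat \<Rightarrow> 'k::real_normed_field) \<Rightarrow> real \<Rightarrow> bool" where
  "lorentz_le x r \<longleftrightarrow> (\<forall>A. finite A \<longrightarrow> (\<Sum>i\<in>A. norm (x i)) \<le> r * W (card A))"

lemma lorentz_leD: "lorentz_le x r \<Longrightarrow> finite A \<Longrightarrow> (\<Sum>i\<in>A. norm (x i)) \<le> r * W (card A)"
  by (simp add: lorentz_le_def)

lemma lorentz_le_coord: "lorentz_le x r \<Longrightarrow> norm (x i) \<le> r"
  using lorentz_leD[of x r "{i}"] by (simp add: W_Suc w_0)

lemma lorentz_le_bounded: "lorentz_le x r \<Longrightarrow> bounded (range x)"
  using lorentz_le_coord by (auto simp: bounded_iff)

lemma lorentz_le_mono: "lorentz_le x r \<Longrightarrow> r \<le> s \<Longrightarrow> lorentz_le x s"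
  unfolding lorentz_le_def by (meson W_nonneg mult_right_mono order_trans)

lemma lorentz_le_dominated:
  assumes "lorentz_le x r" "\<And>i. norm (y i) \<le> norm (x i)"
  shows "lorentz_le y r"
  unfolding lorentz_le_def
proof (intro allI impI)
  fix A :: "nat set" assume A: "finite A"
  have "(\<Sum>i\<in>A. norm (y i)) \<le> (\<Sum>i\<in>A. norm (x i))" by (intro sum_mono assms(2))
  then show "(\<Sum>i\<in>A. norm (y i)) \<le> r * W (card A)" using lorentz_leD[OF assms(1) A] by simp
qed

lemma lorentz_quot_le_sum:
  assumes "bounded (range x)" "n \<ge> 1" "\<And>A. finite A \<Longrightarrow> card A = n \<Longrightarrow> (\<Sum>i\<in>A. norm (x i)) \<le> r * W n"
  shows "lorentz_quot w x n \<le> r"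
proof -
  have Wn: "W n > 0" using W_ge_1[OF assms(2)] by simp
  have "(\<Sum>i<n. decr_rearr x i) \<le> r * W n"
  proof (rule field_le_epsilon)
    fix e :: real assume e: "e > 0"
    have "e / n > 0" using e assms(2) by simp
    from decr_rearr_sum_le[OF assms(1) this, of n]
    obtain A where A: "finite A" "card A = n" "(\<Sum>i<n. decr_rearr x i) \<le> (\<Sum>i\<in>A. norm (x i)) + n * (e / n)"
      by blast
    then show "(\<Sum>i<n. decr_rearr x i) \<le> r * W n + e" using assms(2) assms(3)[OF A(1,2)] by simp
  qed
  then show ?thesis using Wn by (simp add: lorentz_quot_def W_def[symmetric] field_simps)
qed

lemma sum_le_lorentz_quot:
  assumes "bounded (range x)" "finite A"
  shows "(\<Sum>i\<in>A. norm (x i)) \<le> lorentz_quot w x (card A) * W (card A)"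
proof (cases "card A = 0")
  case True
  then show ?thesis using assms(2) by simp
next
  case False
  then have "W (card A) > 0" using W_ge_1[of "card A"] by simp
  then show ?thesis
    using sum_le_decr_rearr[OF assms] by (simp add: lorentz_quot_def W_def[symmetric])
qed

lemma lorentz_quot_nonneg: "bounded (range x) \<Longrightarrow> lorentz_quot w x n \<ge> 0"
  unfolding lorentz_quot_def using decr_rearr_nonneg w_nonneg by (intro divide_nonneg_nonneg sum_nonneg) auto

lemma d_upper_iff: "x \<in> carrier (d_upper w) \<longleftrightarrow> (\<exists>r. lorentz_le x r)"
proof
  assume "x \<in> carrier (d_upper w)"
  then have b: "bounded (range x)" "bdd_above (lorentz_quot w x ` {1..})" by (auto simp: carrier_d_upper)
  obtain r where r: "\<And>n. n \<ge> 1 \<Longrightarrow> lorentz_quot w x n \<le> r" using b(2) by (auto simp: bdd_above_def)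
  have "lorentz_le x r"
    unfolding lorentz_le_def
  proof (intro allI impI)
    fix A :: "nat set" assume A: "finite A"
    show "(\<Sum>i\<in>A. norm (x i)) \<le> r * W (card A)"
      using sum_le_lorentz_quot[OF b(1) A] mult_right_mono[OF r[of "card A"], of "W (card A)"] A
      by (cases "card A = 0") auto
  qed
  then show "\<exists>r. lorentz_le x r" by blast
next
  assume "\<exists>r. lorentz_le x r"
  then obtain r where r: "lorentz_le x r" by blast
  have "lorentz_quot w x n \<le> r" if "n \<ge> 1" for n
    using lorentz_quot_le_sum[OF lorentz_le_bounded[OF r] that] lorentz_leD[OF r] by blast
  then show "x \<in> carrier (d_upper w)"
    using lorentz_le_bounded[OF r] by (auto simp: carrier_d_upper intro!: bdd_aboveI2)
qed

lemma mem_X_iff: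
  "x \<in> carrier X \<longleftrightarrow> (\<exists>r. lorentz_le x r) \<and>
    (\<forall>e>0. \<exists>n0. \<forall>A. finite A \<longrightarrow> card A \<ge> n0 \<longrightarrow> (\<Sum>i\<in>A. norm (x i)) \<le> e * W (card A))"
proof (cases "\<exists>r. lorentz_le x r")
  case True
  then have b: "bounded (range x)" using lorentz_le_bounded by blast
  have "lorentz_quot w x \<longlonglongrightarrow> 0 \<longleftrightarrow>
    (\<forall>e>0. \<exists>n0. \<forall>A. finite A \<longrightarrow> card A \<ge> n0 \<longrightarrow> (\<Sum>i\<in>A. norm (x i)) \<le> e * W (card A))"
  proof (intro iffI allI impI)
    fix e :: real assume l: "lorentz_quot w x \<longlonglongrightarrow> 0" and e: "e > 0"
    obtain n0 where n0: "\<And>n. n \<ge> n0 \<Longrightarrow> lorentz_quot w x n < e"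
      using order_tendstoD(2)[OF l e] by (auto simp: eventually_sequentially)
    have "(\<Sum>i\<in>A. norm (x i)) \<le> e * W (card A)" if "finite A" "card A \<ge> n0" for A
      using sum_le_lorentz_quot[OF b that(1)] mult_right_mono[OF less_imp_le[OF n0[OF that(2)]], of "W (card A)"]
      by simp
    then show "\<exists>n0. \<forall>A. finite A \<longrightarrow> card A \<ge> n0 \<longrightarrow> (\<Sum>i\<in>A. norm (x i)) \<le> e * W (card A)" by blast
  next
    assume *: "\<forall>e>0. \<exists>n0. \<forall>A. finite A \<longrightarrow> card A \<ge> n0 \<longrightarrow> (\<Sum>i\<in>A. norm (x i)) \<le> e * W (card A)"
    show "lorentz_quot w x \<longlonglongrightarrow> 0"
    proof (rule LIMSEQ_I)
      fix e :: real assume "e > 0"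
      then obtain n0 where n0: "\<And>A. finite A \<Longrightarrow> card A \<ge> n0 \<Longrightarrow> (\<Sum>i\<in>A. norm (x i)) \<le> e / 2 * W (card A)"
        using *[rule_format, of "e / 2"] by auto
      have "norm (lorentz_quot w x n - 0) < e" if "n \<ge> max 1 n0" for n
      proof -
        have "lorentz_quot w x n \<le> e / 2"
          using that n0 by (intro lorentz_quot_le_sum[OF b]) auto
        then show ?thesis using lorentz_quot_nonneg[OF b, of n] \<open>e > 0\<close> by simp
      qed
      then show "\<exists>n0. \<forall>n\<ge>n0. norm (lorentz_quot w x n - 0) < e" by blast
    qed
  qed
  then show ?thesis using True d_upper_iff by (auto simp: carrier_d_lower)
next
  case False
  then show ?thesis using d_upper_iff by (auto simp: carrier_d_lower)
qed

lemma nrm_X_le_iff: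
  assumes "x \<in> carrier X"
  shows "nrm X x \<le> r \<longleftrightarrow> lorentz_le x r"
proof -
  have b: "bounded (range x)" "bdd_above (lorentz_quot w x ` {1..})"
    using assms by (auto simp: carrier_d_lower carrier_d_upper)
  show ?thesis
  proof
    assume r: "nrm X x \<le> r"
    have q: "lorentz_quot w x n \<le> r" if "n \<ge> 1" for n
      using cSUP_upper[OF _ b(2), of n] that r by (auto simp: nrm_d_lower)
    show "lorentz_le x r"
      unfolding lorentz_le_def
    proof (intro allI impI)
      fix A :: "nat set" assume A: "finite A"
      show "(\<Sum>i\<in>A. norm (x i)) \<le> r * W (card A)"
        using sum_le_lorentz_quot[OF b(1) A] mult_right_mono[OF q[of "card A"], of "W (card A)"] A
        by (cases "card A = 0") auto
    qed
  next
    assume r: "lorentz_le x r"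
    show "nrm X x \<le> r"
      unfolding nrm_d_lower using lorentz_quot_le_sum[OF b(1)] lorentz_leD[OF r] by (intro cSUP_least) auto
  qed
qed

lemma lorentz_le_nrm: "x \<in> carrier X \<Longrightarrow> lorentz_le x (nrm X x)"
  using nrm_X_le_iff by blast

lemma lorentz_le_add:
  assumes "lorentz_le x r" "lorentz_le y s"
  shows "lorentz_le (x + y) (r + s)"
  unfolding lorentz_le_def
proof (intro allI impI)
  fix A :: "nat set" assume A: "finite A"
  have "(\<Sum>i\<in>A. norm ((x + y) i)) \<le> (\<Sum>i\<in>A. norm (x i)) + (\<Sum>i\<in>A. norm (y i))"
    unfolding sum.distrib[symmetric] by (intro sum_mono) (auto intro: norm_triangle_ineq)
  then show "(\<Sum>i\<in>A. norm ((x + y) i)) \<le> (r + s) * W (card A)"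
    using lorentz_leD[OF assms(1) A] lorentz_leD[OF assms(2) A] by (simp add: distrib_right)
qed

lemma lorentz_le_scale:
  assumes "lorentz_le x r"
  shows "lorentz_le (\<lambda>i. c * x i) (norm c * r)"
  unfolding lorentz_le_def
proof (intro allI impI)
  fix A :: "nat set" assume A: "finite A"
  show "(\<Sum>i\<in>A. norm (c * x i)) \<le> norm c * r * W (card A)"
    using mult_left_mono[OF lorentz_leD[OF assms A], of "norm c"]
    by (simp add: norm_mult sum_distrib_left mult.assoc)
qed

lemma normed_space_X: "normed_space (X :: ('k::real_normed_field, nat \<Rightarrow> 'k) nspace)"
proof
  show "(0 :: nat \<Rightarrow> 'k) \<in> carrier X"
    unfolding mem_X_iff by (auto simp: lorentz_le_def intro!: exI[of _ 0])
  fix x :: "nat \<Rightarrow> 'k" assume x: "x \<in> carrier X"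
  show sc: "scale X c x \<in> carrier X" for c
    unfolding mem_X_iff
  proof (intro conjI allI impI)
    show "\<exists>r. lorentz_le (scale X c x) r"
      unfolding scale_d_lower using lorentz_le_scale[OF lorentz_le_nrm[OF x]] by blast
    fix e :: real assume "e > 0"
    then have "e / (norm c + 1) > 0" by (simp add: add_nonneg_pos)
    then obtain n0 where n0: "\<And>A. finite A \<Longrightarrow> card A \<ge> n0 \<Longrightarrow>
        (\<Sum>i\<in>A. norm (x i)) \<le> e / (norm c + 1) * W (card A)"
      using x unfolding mem_X_iff by blast
    have "(\<Sum>i\<in>A. norm (scale X c x i)) \<le> e * W (card A)" if "finite A" "card A \<ge> n0" for A
    proof -
      have "(\<Sum>i\<in>A. norm (scale X c x i)) \<le> (norm c + 1) * (\<Sum>i\<in>A. norm (x i))"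
        unfolding scale_d_lower sum_distrib_left by (intro sum_mono) (simp add: norm_mult mult_right_mono)
      also have "\<dots> \<le> (norm c + 1) * (e / (norm c + 1) * W (card A))"
        using n0[OF that] by (intro mult_left_mono) auto
      also have "\<dots> = e * W (card A)"
        using norm_ge_zero[of c] by (simp add: add_nonneg_eq_0_iff)
      finally show ?thesis .
    qed
    then show "\<exists>n0. \<forall>A. finite A \<longrightarrow> card A \<ge> n0 \<longrightarrow> (\<Sum>i\<in>A. norm (scale X c x i)) \<le> e * W (card A)"
      by blast
  qed
  show "scale X (c + d) x = scale X c x + scale X d x" for c d
    by (auto simp: scale_d_lower algebra_simps)
  show "scale X c (scale X d x) = scale X (c * d) x" for c d by (auto simp: scale_d_lower algebra_simps)
  show "scale X 1 x = x" by (simp add: scale_d_lower)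
  have le: "nrm X (scale X c y) \<le> norm c * nrm X y" if "y \<in> carrier X" "scale X c y \<in> carrier X"
    for c and y :: "nat \<Rightarrow> 'k"
    unfolding nrm_X_le_iff[OF that(2)] unfolding scale_d_lower
    by (rule lorentz_le_scale[OF lorentz_le_nrm[OF that(1)]])
  show "nrm X (scale X c x) = norm c * nrm X x" for c
  proof (cases "c = 0")
    case True
    have z: "lorentz_le (scale X 0 x) 0" by (simp add: lorentz_le_def scale_d_lower)
    have "nrm X (scale X 0 x) \<ge> 0"
      using lorentz_le_coord[OF lorentz_le_nrm[OF sc], of 0] norm_ge_zero order_trans by blast
    then show ?thesis using z nrm_X_le_iff[OF sc, of 0 0] True by simp
  next
    case False
    have "scale X (inverse c) (scale X c x) = x" using False by (auto simp: scale_d_lower)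
    then have "nrm X x \<le> norm (inverse c) * nrm X (scale X c x)"
      using le[OF sc, of "inverse c" c] x by simp
    then have "norm c * nrm X x \<le> nrm X (scale X c x)"
      using False by (simp add: norm_inverse norm_divide field_simps)
    then show ?thesis using le[OF x sc, of c] by simp
  qed
  fix y :: "nat \<Rightarrow> 'k" assume y: "y \<in> carrier X"
  show xy: "x + y \<in> carrier X"
    unfolding mem_X_iff
  proof (intro conjI allI impI)
    show "\<exists>r. lorentz_le (x + y) r"
      using lorentz_le_add[OF lorentz_le_nrm[OF x] lorentz_le_nrm[OF y]] by blast
    fix e :: real assume "e > 0"
    then have e: "e / 2 > 0" by simp
    obtain n0 where n0: "\<And>A. finite A \<Longrightarrow> card A \<ge> n0 \<Longrightarrow> (\<Sum>i\<in>A. norm (x i)) \<le> e / 2 * W (card A)"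
      using x e unfolding mem_X_iff by blast
    obtain n1 where n1: "\<And>A. finite A \<Longrightarrow> card A \<ge> n1 \<Longrightarrow> (\<Sum>i\<in>A. norm (y i)) \<le> e / 2 * W (card A)"
      using y e unfolding mem_X_iff by blast
    have "(\<Sum>i\<in>A. norm ((x + y) i)) \<le> e * W (card A)" if "finite A" "card A \<ge> max n0 n1" for A
    proof -
      have "(\<Sum>i\<in>A. norm ((x + y) i)) \<le> (\<Sum>i\<in>A. norm (x i)) + (\<Sum>i\<in>A. norm (y i))"
        unfolding sum.distrib[symmetric] by (intro sum_mono) (auto intro: norm_triangle_ineq)
      then show ?thesis using n0[of A] n1[of A] that by (simp add: field_simps)
    qed
    then show "\<exists>n0. \<forall>A. finite A \<longrightarrow> card A \<ge> n0 \<longrightarrow> (\<Sum>i\<in>A. norm ((x + y) i)) \<le> e * W (card A)"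
      by blast
  qed
  show "scale X c (x + y) = scale X c x + scale X c y" for c
    by (auto simp: scale_d_lower algebra_simps)
  show "nrm X (x + y) \<le> nrm X x + nrm X y"
    unfolding nrm_X_le_iff[OF xy] by (rule lorentz_le_add[OF lorentz_le_nrm[OF x] lorentz_le_nrm[OF y]])
qed

lemma finite_support_mem:
  fixes x :: "nat \<Rightarrow> 'k::real_normed_field"
  assumes "finite S" "\<And>i. i \<notin> S \<Longrightarrow> x i = 0"
  shows "x \<in> carrier X"
proof -
  define B where "B = (\<Sum>i\<in>S. norm (x i))"
  have B: "B \<ge> 0" unfolding B_def by (intro sum_nonneg) auto
  have le: "(\<Sum>i\<in>A. norm (x i)) \<le> B" if "finite A" for A
  proof -
    have "(\<Sum>i\<in>A. norm (x i)) = (\<Sum>i\<in>A \<inter> S. norm (x i))"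
      using that assms(2) by (intro sum.mono_neutral_right) auto
    also have "\<dots> \<le> B" unfolding B_def using assms(1) by (intro sum_mono2) auto
    finally show ?thesis .
  qed
  show ?thesis
    unfolding mem_X_iff
  proof (intro conjI allI impI)
    have "(\<Sum>i\<in>A. norm (x i)) \<le> B * W (card A)" if "finite A" for A
    proof (cases "card A = 0")
      case False
      then show ?thesis using le[OF that] mult_left_mono[OF W_ge_1[of "card A"] B] by simp
    qed (use that in auto)
    then show "\<exists>r. lorentz_le x r" by (auto simp: lorentz_le_def)
    fix e :: real assume e: "e > 0"
    \<comment> \<open>Here the divergence of the sum of \<open>w\<close> enters: a bounded sum
      becomes negligible against \<open>W\<close>.\<close>
    obtain n0 where n0: "W n0 \<ge> B / e" using W_unbounded by blast
    have "(\<Sum>i\<in>A. norm (x i)) \<le> e * W (card A)" if "finite A" "card A \<ge> n0" for A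
    proof -
      have "B / e \<le> W (card A)" using n0 W_mono[OF that(2)] by simp
      then show ?thesis using le[OF that(1)] e by (simp add: field_simps)
    qed
    then show "\<exists>n0. \<forall>A. finite A \<longrightarrow> card A \<ge> n0 \<longrightarrow> (\<Sum>i\<in>A. norm (x i)) \<le> e * W (card A)" by blast
  qed
qed

lemma trunc_mem [simp]: "trunc n x \<in> carrier X"
  by (rule finite_support_mem[of "{..<n}"]) (auto simp: trunc_def)

lemma unit_seq_mem [simp]: "unit_seq k \<in> carrier X"
  by (rule finite_support_mem[of "{k}"]) (auto simp: unit_seq_def)

lemma trunc_eq_sum: "trunc n x = (\<Sum>i<n. scale X (x i) (unit_seq i))"
proof
  fix i
  have "(\<Sum>j<n. scale X (x j) (unit_seq j)) i = (\<Sum>j<n. if j = i then x j else 0)"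
    unfolding sum_fun_apply scale_d_lower unit_seq_def by (intro sum.cong) auto
  then show "trunc n x i = (\<Sum>j<n. scale X (x j) (unit_seq j)) i" by (simp add: trunc_def)
qed

lemma lorentz_le_trunc: "lorentz_le x r \<Longrightarrow> lorentz_le (trunc n x) r"
  by (rule lorentz_le_dominated) (auto simp: trunc_def)

lemma lorentz_le_unit_seq: "lorentz_le (unit_seq k) 1"
  unfolding lorentz_le_def
proof (intro allI impI)
  fix A :: "nat set" assume A: "finite A"
  have "(\<Sum>i\<in>A. norm (unit_seq k i :: 'a)) = (if k \<in> A then 1 else 0)"
  proof -
    have "norm (unit_seq k i :: 'a) = (if i = k then 1 else 0)" for i by (simp add: unit_seq_def)
    then show ?thesis using A by simp
  qed
  then show "(\<Sum>i\<in>A. norm (unit_seq k i :: 'a)) \<le> 1 * W (card A)"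
    using W_ge_1[of "card A"] A by (auto simp: Suc_le_eq card_gt_0_iff)
qed

text \<open>A set of \<open>n\<close> coordinates of size \<open>r * \<mu>\<close> has sum at least
  \<open>n * (r * \<mu>)\<close>, which exceeds \<open>r * W n\<close> once
  \<open>W n < n * \<mu>\<close>.\<close>

lemma lorentz_le_large_finite:
  assumes "lorentz_le x r" "\<mu> > 0"
  shows "\<exists>K. \<forall>A. finite A \<longrightarrow> (\<forall>i\<in>A. norm (x i) \<ge> r * \<mu>) \<longrightarrow> r > 0 \<longrightarrow> card A < K"
proof -
  obtain K where K: "\<And>n. n \<ge> K \<Longrightarrow> W n < n * \<mu>" using W_sublinear[OF assms(2)] by blast
  have "card A < K" if "finite A" "\<forall>i\<in>A. norm (x i) \<ge> r * \<mu>" "r > 0" for A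
  proof (rule ccontr)
    assume "\<not> card A < K"
    then have "r * W (card A) < r * (card A * \<mu>)" using K that(3) by simp
    moreover have "card A * (r * \<mu>) \<le> (\<Sum>i\<in>A. norm (x i))"
      using sum_mono[of A "\<lambda>_. r * \<mu>" "\<lambda>i. norm (x i)"] that(2) by simp
    ultimately show False using lorentz_leD[OF assms(1) that(1)] by (simp add: algebra_simps)
  qed
  then show ?thesis by blast
qed

lemma lorentz_le_null:
  assumes "lorentz_le x r"
  shows "x \<longlonglongrightarrow> 0"
proof (rule LIMSEQ_I)
  fix e :: real assume e: "e > 0"
  define s where "s = \<bar>r\<bar> + 1"
  have s: "lorentz_le x s" "s > 0" using lorentz_le_mono[OF assms, of s] by (auto simp: s_def)
  then obtain K where K: "\<And>A. finite A \<Longrightarrow> (\<forall>i\<in>A. norm (x i) \<ge> e) \<Longrightarrow> card A < K"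
    using lorentz_le_large_finite[OF s(1), of "e / s"] e by auto
  have "finite {i. norm (x i) \<ge> e}"
  proof (rule ccontr)
    assume "infinite {i. norm (x i) \<ge> e}"
    then obtain A where "A \<subseteq> {i. norm (x i) \<ge> e}" "finite A" "card A = K"
      using infinite_arbitrarily_large by blast
    then show False using K[of A] by auto
  qed
  then obtain n where "\<forall>i\<in>{i. norm (x i) \<ge> e}. i < n" using finite_nat_set_iff_bounded by blast
  then show "\<exists>n0. \<forall>n\<ge>n0. norm (x n - 0) < e" by (intro exI[of _ n]) (force simp: not_le)
qed

text \<open>Sets with at least \<open>n0\<close> elements are controlled by membership in
  \<open>d_lower w\<close>. On smaller ones the tail coordinates, each at most
  \<open>e / (n0 + 1)\<close>, sum to at most \<open>e\<close>.\<close>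

lemma tail_small:
  fixes x :: "nat \<Rightarrow> 'k::real_normed_field"
  assumes "x \<in> carrier X" "e > 0"
  shows "\<exists>m. lorentz_le (x - trunc m x) e"
proof -
  obtain n0 where n0: "\<And>A. finite A \<Longrightarrow> card A \<ge> n0 \<Longrightarrow> (\<Sum>i\<in>A. norm (x i)) \<le> e * W (card A)"
    using assms unfolding mem_X_iff by blast
  have "x \<longlonglongrightarrow> 0" using lorentz_le_null[OF lorentz_le_nrm[OF assms(1)]] .
  moreover have "e / (n0 + 1) > 0" using assms(2) by simp
  ultimately obtain m where m: "\<And>i. i \<ge> m \<Longrightarrow> norm (x i) \<le> e / (n0 + 1)"
    using LIMSEQ_D[of x 0 "e / (n0 + 1)"] by (auto intro: less_imp_le)
  have le: "norm ((x - trunc m x) i) \<le> norm (x i)" "norm ((x - trunc m x) i) \<le> e / (n0 + 1)" for i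
    using m[of i] assms(2) by (auto simp: trunc_def)
  have "lorentz_le (x - trunc m x) e"
    unfolding lorentz_le_def
  proof (intro allI impI)
    fix A :: "nat set" assume A: "finite A"
    show "(\<Sum>i\<in>A. norm ((x - trunc m x) i)) \<le> e * W (card A)"
    proof (cases "card A \<ge> n0")
      case True
      have "(\<Sum>i\<in>A. norm ((x - trunc m x) i)) \<le> (\<Sum>i\<in>A. norm (x i))" by (intro sum_mono le)
      then show ?thesis using n0[OF A True] by simp
    next
      case False
      show ?thesis
      proof (cases "card A = 0")
        case False
        have "(\<Sum>i\<in>A. norm ((x - trunc m x) i)) \<le> (\<Sum>i\<in>A. e / (n0 + 1))" by (intro sum_mono le)
        also have "\<dots> = (card A / (n0 + 1)) * e" by simp
        also have "\<dots> \<le> 1 * e" using \<open>\<not> card A \<ge> n0\<close> assms(2) by (intro mult_right_mono) auto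
        also have "\<dots> \<le> e * W (card A)" using W_ge_1[of "card A"] False assms(2) by simp
        finally show ?thesis .
      qed (use A in auto)
    qed
  qed
  then show ?thesis by blast
qed

end

section \<open>Weak-star approximation by truncations\<close>

lemma finite_pos_lower_bound:
  fixes g :: "'i \<Rightarrow> real"
  assumes "finite S" "\<And>i. i \<in> S \<Longrightarrow> g i > 0"
  shows "\<exists>\<mu>>0. \<forall>i\<in>S. \<mu> \<le> g i"
  using assms
proof (induction S rule: finite_induct)
  case empty
  show ?case by (intro exI[of _ 1]) auto
next
  case (insert a S)
  then obtain \<mu> where "\<mu> > 0" "\<forall>i\<in>S. \<mu> \<le> g i" by auto
  then show ?case using insert.prems[of a] by (intro exI[of _ "min \<mu> (g a)"]) auto
qed

text \<open>The graph of a convex power lies above its tangent at \<open>p\<close>.\<close>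

lemma power_tangent:
  fixes p q :: real
  assumes "p \<ge> 0" "q \<ge> 0"
  shows "p ^ Suc m - q ^ Suc m \<le> Suc m * p ^ m * (p - q)"
proof (induction m)
  case (Suc m)
  \<comment> \<open>The gap in the new inequality is \<open>q\<close> times the old gap plus a
    nonnegative multiple of the square of \<open>p - q\<close>.\<close>
  have "Suc (Suc m) * p ^ Suc m * (p - q) - (p ^ Suc (Suc m) - q ^ Suc (Suc m)) =
      q * (Suc m * p ^ m * (p - q) - (p ^ Suc m - q ^ Suc m)) + Suc m * p ^ m * (p - q)\<^sup>2"
    by (simp add: algebra_simps power2_eq_square)
  also have "\<dots> \<ge> 0" using Suc assms by (intro add_nonneg_nonneg mult_nonneg_nonneg) auto
  finally show ?case by simp
qed simp

definition unimodular :: "'k::real_normed_field \<Rightarrow> 'k" where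
  "unimodular c = (if c = 0 then 1 else of_real (norm c) / c)"

lemma norm_unimodular [simp]: "norm (unimodular c) = 1"
  and unimodular_mult [simp]: "unimodular c * c = of_real (norm c)"
  by (auto simp: unimodular_def norm_divide)

context weight
begin

lemma normed_bidual_X: "normed_bidual (X :: ('k::real_normed_field, nat \<Rightarrow> 'k) nspace)"
  by (simp add: normed_bidual_def normed_space_X)

lemma unit_ball_X_iff: "x \<in> unit_ball X \<longleftrightarrow> x \<in> carrier X \<and> lorentz_le x 1"
  using nrm_X_le_iff by (auto simp: unit_ball_def)

text \<open>The largest of \<open>n + 1\<close> indices is at least \<open>n\<close>, so its weight
  is at most \<open>w n\<close>; remove it and induct.\<close>

lemma sum_w_le_W: "finite B \<Longrightarrow> (\<Sum>i\<in>B. w i) \<le> W (card B)"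
proof (induction "card B" arbitrary: B)
  case (Suc n)
  then have ne: "B \<noteq> {}" by auto
  define b where "b = Max B"
  have b: "b \<in> B" "\<And>i. i \<in> B \<Longrightarrow> i \<le> b" using Suc.prems ne by (auto simp: b_def)
  have "B \<subseteq> {..b}" using b by auto
  then have "card B \<le> Suc b" using card_mono[of "{..b}" B] by simp
  then have "w b \<le> w n" using Suc.hyps(2) by (intro w_antimono) simp
  moreover have "(\<Sum>i\<in>B - {b}. w i) \<le> W n"
    using Suc.hyps(1)[of "B - {b}"] Suc.hyps(2)[symmetric] Suc.prems b(1) by simp
  ultimately show ?case
    using Suc.hyps(2)[symmetric] sum.remove[OF Suc.prems b(1), of w] by (simp add: W_Suc)
qed auto

text \<open>The weights may be placed at any distinct positions, because the norm is invariant under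
  rearrangement. These are the points at which forms are tested below.\<close>

lemma lorentz_le_spread:
  fixes s :: "nat \<Rightarrow> 'k::real_normed_field"
  assumes "inj_on \<kappa> {..<m}" "\<And>i. i < m \<Longrightarrow> norm (s i) \<le> w i"
  shows "lorentz_le (\<Sum>i<m. scale X (s i) (unit_seq (\<kappa> i))) 1"
  unfolding lorentz_le_def
proof (intro allI impI)
  fix A :: "nat set" assume A: "finite A"
  define B where "B = {i \<in> {..<m}. \<kappa> i \<in> A}"
  let ?x = "\<Sum>i<m. scale X (s i) (unit_seq (\<kappa> i))"
  have "norm (?x j) \<le> (\<Sum>i<m. if j = \<kappa> i then w i else 0)" for j
    unfolding sum_fun_apply using assms(2)
    by (intro order_trans[OF norm_sum] sum_mono) (auto simp: scale_d_lower unit_seq_def)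
  then have "(\<Sum>j\<in>A. norm (?x j)) \<le> (\<Sum>j\<in>A. \<Sum>i<m. if j = \<kappa> i then w i else 0)"
    by (intro sum_mono)
  also have "\<dots> = (\<Sum>i<m. \<Sum>j\<in>A. if j = \<kappa> i then w i else 0)" by (rule sum.swap)
  also have "\<dots> = (\<Sum>i<m. if \<kappa> i \<in> A then w i else 0)" using A by (intro sum.cong) auto
  also have "\<dots> = (\<Sum>i\<in>B. w i)" unfolding B_def by (subst sum.inter_filter) auto
  also have "\<dots> \<le> W (card B)" by (rule sum_w_le_W) (simp add: B_def)
  also have "\<dots> \<le> W (card A)"
  proof (intro W_mono card_inj_on_le[of \<kappa>])
    show "inj_on \<kappa> B" using assms(1) by (rule inj_on_subset) (auto simp: B_def)
  qed (use A in \<open>auto simp: B_def\<close>)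
  finally show "(\<Sum>j\<in>A. norm (?x j)) \<le> 1 * W (card A)" by simp
qed

text \<open>By averaging over signs, \<open>\<Sum>\<^sub>i w\<^sub>i\<^sup>N \<bar>\<psi>(e\<^sub>k, \<dots>, e\<^sub>k)\<bar> \<le> C\<close> with \<open>k = k(i)\<close>, for the degree \<open>N\<close>
  of \<open>\<psi>\<close> and every injective choice of \<open>k(i)\<close>.\<close>

lemma form_unit_seq_null:
  fixes \<psi> :: "(nat \<Rightarrow> 'k::real_normed_field) list \<Rightarrow> 'k"
  assumes "multilinear (Suc n) X scalar_space \<psi>" "ball_bounded (Suc n) X scalar_space C \<psi>"
    and ns: "\<not> summable (\<lambda>i. w i ^ Suc n)"
  shows "(\<lambda>k. \<psi> (replicate (Suc n) (unit_seq k))) \<longlonglongrightarrow> 0"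
proof (rule ccontr)
  interpret X: normed_bidual "X :: ('k, nat \<Rightarrow> 'k) nspace" by (rule normed_bidual_X)
  define c where "c k = \<psi> (replicate (Suc n) (unit_seq k))" for k
  assume "\<not> (\<lambda>k. \<psi> (replicate (Suc n) (unit_seq k))) \<longlonglongrightarrow> 0"
  then obtain e where e: "e > 0" "\<And>N. \<exists>k\<ge>N. norm (c k) \<ge> e"
    unfolding LIMSEQ_def c_def dist_norm by (auto simp: not_less)
  define I where "I = {k. norm (c k) \<ge> e}"
  have inf: "infinite I"
    unfolding I_def infinite_nat_iff_unbounded_le using e(2) by auto
  \<comment> \<open>The injective choice of positions: all values along \<open>I\<close> have size
    at least \<open>e\<close>, so the partial sums of \<open>w i ^ Suc n\<close> stay below
    \<open>C / e\<close>.\<close>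
  define \<kappa> where "\<kappa> = enumerate I"
  have \<kappa>: "inj_on \<kappa> A" "norm (c (\<kappa> i)) \<ge> e" for A i
    using strict_mono_enumerate[OF inf] enumerate_in_set[OF inf, of i]
    by (auto simp: \<kappa>_def I_def strict_mono_imp_inj_on strict_mono_on_imp_inj_on intro: inj_on_subset)
  have bound: "(\<Sum>i<m. w i ^ Suc n) \<le> C / e" for m
  proof -
    let ?y = "\<lambda>i. scale X (of_real (w i)) (unit_seq (\<kappa> i)) :: nat \<Rightarrow> 'k"
    have "norm (\<Sum>i<m. unimodular (c (\<kappa> i)) * \<psi> (replicate (Suc n) (?y i))) \<le> C"
    proof (rule X.diagonal_sum_bound[OF assms(1)])
      fix xs assume xs: "length xs = Suc n"
        "\<And>x. x \<in> set xs \<Longrightarrow> \<exists>s. (\<forall>i\<in>{..<m}. norm (s i) = 1) \<and> x = (\<Sum>i<m. scale X (s i) (?y i))"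
      have "x \<in> unit_ball X" if x: "x \<in> set xs" for x
      proof -
        obtain s where s: "\<And>i. i < m \<Longrightarrow> norm (s i) = 1" "x = (\<Sum>i<m. scale X (s i) (?y i))"
          using xs(2)[OF x] by auto
        then have "x = (\<Sum>i<m. scale X (s i * of_real (w i)) (unit_seq (\<kappa> i)))"
          by (simp add: X.scale_scale)
        moreover have "lorentz_le \<dots> 1"
          using \<kappa>(1) s(1) w_nonneg by (intro lorentz_le_spread) (auto simp: norm_mult)
        ultimately show ?thesis by (simp add: unit_ball_X_iff)
      qed
      then show "norm (\<psi> xs) \<le> C" using ball_boundedD[OF assms(2) xs(1)] by auto
    qed auto
    moreover have "\<psi> (replicate (Suc n) (?y i)) = of_real (w i ^ Suc n) * c (\<kappa> i)" for i
    proof -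
      have "[] @ replicate (Suc n) (unit_seq (\<kappa> i)) \<in> tuples (Suc n) X" by (auto simp: tuples_def)
      from X.XS.multilinear_scale_map[OF assms(1) this, of "of_real (w i)"] show ?thesis
        by (simp only: map_replicate append_Nil length_replicate scale_scalar c_def of_real_power)
    qed
    ultimately have "norm (\<Sum>i<m. of_real (w i ^ Suc n) * (unimodular (c (\<kappa> i)) * c (\<kappa> i))) \<le> C"
      by (simp only: mult.left_commute)
    then have "norm (of_real (\<Sum>i<m. w i ^ Suc n * norm (c (\<kappa> i))) :: 'k) \<le> C"
      by (simp only: unimodular_mult of_real_mult[symmetric] of_real_sum)
    then have "(\<Sum>i<m. w i ^ Suc n * norm (c (\<kappa> i))) \<le> C" by (simp only: norm_of_real abs_le_iff)
    moreover have "(\<Sum>i<m. w i ^ Suc n * e) \<le> (\<Sum>i<m. w i ^ Suc n * norm (c (\<kappa> i)))"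
      using \<kappa>(2) w_nonneg by (intro sum_mono mult_left_mono) auto
    ultimately have "(\<Sum>i<m. w i ^ Suc n) * e \<le> C" by (simp only: sum_distrib_right)
    then show ?thesis using e(1) by (simp add: pos_le_divide_eq)
  qed
  have "summable (\<lambda>i. w i ^ Suc n)"
    using w_nonneg bound by (intro summableI_nonneg_bounded[where x = "C / e"]) auto
  then show False using ns by blast
qed

text \<open>The degree 1 case of \<open>form_unit_seq_null\<close>, available since \<open>w\<close>
  is not summable.\<close>

lemma dual_unit_seq_null:
  fixes f :: "(nat \<Rightarrow> 'k::real_normed_field) \<Rightarrow> 'k"
  assumes "f \<in> carrier (dual X)"
  shows "(\<lambda>k. f (unit_seq k)) \<longlonglongrightarrow> 0"
proof -
  interpret X: normed_bidual "X :: ('k, nat \<Rightarrow> 'k) nspace" by (rule normed_bidual_X)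
  obtain C where C: "\<And>x. x \<in> unit_ball X \<Longrightarrow> norm (f x) \<le> C" using X.dual_bound_exists[OF assms] by blast
  have "multilinear (Suc 0) X scalar_space (\<lambda>xs. f (hd xs))"
    by (rule multilinear_one) (simp_all only: X.dual_add[OF assms] X.dual_scale[OF assms] carrier_scalar scale_scalar UNIV_I)
  moreover have "ball_bounded (Suc 0) X scalar_space C (\<lambda>xs. f (hd xs))"
    using C by (auto simp: ball_bounded_def length_Suc_conv)
  ultimately show ?thesis using form_unit_seq_null[of 0 "\<lambda>xs. f (hd xs)" C] w_not_summable by simp
qed

text \<open>Two regimes for the set \<open>A\<close>: up to size \<open>L\<close> the flat vector
  \<open>y\<close> contributes at most 1/4, and beyond it \<open>x\<close>, supported in
  \<open>m\<close> places, contributes at most \<open>W m\<close>, a quarter of \<open>W L\<close>.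
  Hence the sum of two unit vectors has norm 5/4 instead of 2.\<close>

lemma lorentz_le_sum_flat:
  fixes x y :: "nat \<Rightarrow> 'k::real_normed_field"
  assumes x: "lorentz_le x 1" "\<And>i. i \<ge> m \<Longrightarrow> x i = 0" and y: "lorentz_le y 1"
    and L: "W L \<ge> 4 * W m" "L \<ge> 1" and flat: "\<And>i. norm (y i) \<le> 1 / (4 * real L)"
  shows "lorentz_le (x + y) (5 / 4)"
  unfolding lorentz_le_def
proof (intro allI impI)
  fix A :: "nat set" assume A: "finite A"
  have "(\<Sum>i\<in>A. norm ((x + y) i)) \<le> (\<Sum>i\<in>A. norm (x i)) + (\<Sum>i\<in>A. norm (y i))"
    unfolding sum.distrib[symmetric] by (intro sum_mono) (auto intro: norm_triangle_ineq)
  also have "\<dots> \<le> 5 / 4 * W (card A)"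
  proof (cases "card A \<le> L")
    case True
    have "(\<Sum>i\<in>A. norm (y i)) \<le> (\<Sum>i\<in>A. 1 / (4 * real L))" by (intro sum_mono flat)
    also have "\<dots> = (card A / L) * (1 / 4)" by simp
    also have "\<dots> \<le> 1 * (1 / 4)" using True L(2) by (intro mult_right_mono) (auto simp: field_simps)
    finally have "(\<Sum>i\<in>A. norm (y i)) \<le> 1 / 4" by simp
    then show ?thesis using lorentz_leD[OF x(1) A] W_ge_1[of "card A"] A by (cases "A = {}") (auto simp: Suc_le_eq card_gt_0_iff)
  next
    case False
    have "(\<Sum>i\<in>A. norm (x i)) = (\<Sum>i\<in>A \<inter> {..<m}. norm (x i))"
      using A x(2) by (intro sum.mono_neutral_right) (auto simp: not_less)
    also have "\<dots> \<le> W (card (A \<inter> {..<m}))" using lorentz_leD[OF x(1), of "A \<inter> {..<m}"] A by simp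
    also have "\<dots> \<le> W m" using card_mono[of "{..<m}" "A \<inter> {..<m}"] by (intro W_mono) simp
    also have "\<dots> \<le> W (card A) / 4" using L(1) W_mono[of L "card A"] False by simp
    finally show ?thesis using lorentz_leD[OF y A] by simp
  qed
  finally show "(\<Sum>i\<in>A. norm ((x + y) i)) \<le> 5 / 4 * W (card A)" .
qed

text \<open>Fewer than \<open>K\<close> coordinates of a point of the ball exceed
  \<open>\<eta>\<close>, with \<open>K\<close> independent of the point. Far out \<open>f\<close> is
  at most \<open>e / (K + 1)\<close> on unit vectors, so deleting these coordinates costs at most
  \<open>e\<close>.\<close>

lemma discard_large_coordinates:
  fixes f :: "(nat \<Rightarrow> 'k::real_normed_field) \<Rightarrow> 'k"
  assumes f: "f \<in> carrier (dual X)" and "e > 0" "(\<eta> :: real) > 0"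
  shows "\<exists>n. \<forall>x\<in>unit_ball X. (\<forall>i<n. x i = 0) \<longrightarrow> (\<exists>B. norm (f x - f (\<lambda>i. if i \<in> B then 0 else x i)) \<le> e \<and>
      (\<forall>i. i \<notin> B \<longrightarrow> norm (x i) \<le> \<eta>) \<and> finite B)"
proof -
  interpret X: normed_bidual "X :: ('k, nat \<Rightarrow> 'k) nspace" by (rule normed_bidual_X)
  obtain K where K: "\<And>m. m \<ge> K \<Longrightarrow> W m < m * \<eta>" using W_sublinear[OF assms(3)] by blast
  have "e / (K + 1) > 0" using assms(2) by simp
  then obtain n where n: "\<And>i. i \<ge> n \<Longrightarrow> norm (f (unit_seq i)) < e / (K + 1)"
    using LIMSEQ_D[OF dual_unit_seq_null[OF f], of "e / (K + 1)"] by auto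
  have "\<exists>B. norm (f x - f (\<lambda>i. if i \<in> B then 0 else x i)) \<le> e \<and> (\<forall>i. i \<notin> B \<longrightarrow> norm (x i) \<le> \<eta>) \<and> finite B"
    if x: "x \<in> unit_ball X" "\<forall>i<n. x i = 0" for x
  proof -
    define B where "B = {i. norm (x i) > \<eta>}"
    have xl: "lorentz_le x 1" "x \<in> carrier X" using x by (auto simp: unit_ball_X_iff)
    have small: "card A < K" if "finite A" "A \<subseteq> B" for A
    proof (rule ccontr)
      assume "\<not> card A < K"
      then have "W (card A) < card A * \<eta>" using K by simp
      also have "\<dots> \<le> (\<Sum>i\<in>A. norm (x i))"
        using sum_mono[of A "\<lambda>_. \<eta>" "\<lambda>i. norm (x i)"] that(2) by (force simp: B_def)
      finally show False using lorentz_leD[OF xl(1) that(1)] by simp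
    qed
    have fin: "finite B"
    proof (rule ccontr)
      assume "infinite B"
      then obtain A where "A \<subseteq> B" "finite A" "card A = K" using infinite_arbitrarily_large by blast
      then show False using small[of A] by simp
    qed
    let ?y = "\<lambda>i. if i \<in> B then 0 else x i"
    have split: "x = ?y + (\<Sum>i\<in>B. scale X (x i) (unit_seq i))"
    proof
      fix j
      have "(\<Sum>i\<in>B. scale X (x i) (unit_seq i)) j = (\<Sum>i\<in>B. if i = j then x i else 0)"
        unfolding sum_fun_apply scale_d_lower unit_seq_def by (intro sum.cong) auto
      then show "x j = (?y + (\<Sum>i\<in>B. scale X (x i) (unit_seq i))) j" using fin by simp
    qed
    have sm: "(\<Sum>i\<in>B. scale X (x i) (unit_seq i)) \<in> carrier X" by (intro X.sum_closed X.scale_closed) auto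
    have ym: "?y \<in> carrier X"
    proof -
      have "?y = x - (\<Sum>i\<in>B. scale X (x i) (unit_seq i))" using split by (metis add_diff_cancel_right')
      then show ?thesis using X.diff_closed[OF xl(2) sm] by simp
    qed
    have "f x = f ?y + f (\<Sum>i\<in>B. scale X (x i) (unit_seq i))"
      using X.dual_add[OF f ym sm] split by simp
    then have "f x - f ?y = (\<Sum>i\<in>B. x i * f (unit_seq i))"
      using X.dual_sum[OF f, of B "\<lambda>i. scale X (x i) (unit_seq i)"] X.dual_scale[OF f] by simp
    also have "norm \<dots> \<le> (\<Sum>i\<in>B. 1 * (e / (K + 1)))"
    proof (intro order_trans[OF norm_sum] sum_mono)
      fix i assume "i \<in> B"
      then have "x i \<noteq> 0" using assms(3) by (auto simp: B_def)
      then have "i \<ge> n" using x(2) not_le by blast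
      then show "norm (x i * f (unit_seq i)) \<le> 1 * (e / (K + 1))"
        unfolding norm_mult using lorentz_le_coord[OF xl(1)] n by (intro mult_mono) (auto intro: less_imp_le)
    qed
    also have "\<dots> = (card B / (K + 1)) * e" by simp
    also have "\<dots> \<le> 1 * e" using small[OF fin] assms(2) by (intro mult_right_mono) auto
    finally show ?thesis using fin by (intro exI[of _ B]) (auto simp: B_def)
  qed
  then show ?thesis by blast
qed

text \<open>Gliding hump: were \<open>f\<close> not small on tails, two far blocks with nearly
  maximal values could be added at the price of a norm 5/4 only, and the normalised sum would beat
  the supremum.\<close>

lemma shrinking:
  fixes f :: "(nat \<Rightarrow> 'k::real_normed_field) \<Rightarrow> 'k"
  assumes f: "f \<in> carrier (dual X)" and e: "e > 0"
  shows "\<exists>n. \<forall>x\<in>unit_ball X. (\<forall>i<n. x i = 0) \<longrightarrow> norm (f x) \<le> e"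
proof (rule ccontr)
  interpret X: normed_bidual "X :: ('k, nat \<Rightarrow> 'k) nspace" by (rule normed_bidual_X)
  assume neg: "\<not> ?thesis"
  obtain C where C: "C > 0" "\<And>x. x \<in> unit_ball X \<Longrightarrow> norm (f x) \<le> C" using X.dual_bound_exists[OF f] by blast
  \<comment> \<open>The levels that \<open>f\<close> exceeds on finitely supported points of the
    ball arbitrarily far out; finite support leaves room for a second block.\<close>
  define T where "T = {t. \<forall>n. \<exists>x m. lorentz_le x 1 \<and> (\<forall>i\<ge>m. x i = 0) \<and> (\<forall>i<n. x i = 0) \<and> norm (f x) > t}"
  have mem: "x \<in> unit_ball X" if "lorentz_le x 1" "\<forall>i\<ge>m. x i = 0" for x :: "nat \<Rightarrow> 'k" and m
    using that finite_support_mem[of "{..<m}" x] by (auto simp: unit_ball_X_iff)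
  have "e \<in> T"
    unfolding T_def
  proof (intro CollectI allI)
    fix n
    obtain x where x: "x \<in> unit_ball X" "\<forall>i<n. x i = 0" "norm (f x) > e" using neg by (auto simp: not_le)
    have xl: "x \<in> carrier X" "lorentz_le x 1" using x by (auto simp: unit_ball_X_iff)
    define d where "d = (norm (f x) - e) / (2 * C)"
    have d: "d > 0" using x(3) C(1) by (simp add: d_def)
    obtain m where m: "lorentz_le (x - trunc m x) d" using tail_small[OF xl(1) d] by blast
    have "x - trunc m x \<in> carrier X" using xl by simp
    from X.dual_bound_scaled[OF f C(2) this _ d] have "norm (f (x - trunc m x)) \<le> C * d"
      using nrm_X_le_iff[OF \<open>x - trunc m x \<in> carrier X\<close>] m by simp
    also have "\<dots> < norm (f x) - e" using C(1) x(3) by (simp add: d_def)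
    finally have "norm (f x - f (trunc m x)) < norm (f x) - e" using X.dual_diff[OF f xl(1)] by simp
    then have "norm (f (trunc m x)) > e" using norm_triangle_ineq2[of "f x" "f (trunc m x)"] by simp
    then show "\<exists>x m. lorentz_le x 1 \<and> (\<forall>i\<ge>m. x i = 0) \<and> (\<forall>i<n. x i = 0) \<and> norm (f x) > e"
      using lorentz_le_trunc[OF xl(2), of m] x(2)
      by (intro exI[of _ "trunc m x"] exI[of _ m]) (auto simp: trunc_def)
  qed
  have bdd: "bdd_above T"
  proof (rule bdd_aboveI[of _ C])
    fix t assume "t \<in> T"
    then obtain x m where "lorentz_le x 1" "\<forall>i\<ge>m. x i = 0" "norm (f x) > t" unfolding T_def by blast
    then show "t \<le> C" using C(2)[OF mem] by fastforce
  qed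
  define \<sigma> where "\<sigma> = Sup T"
  have \<sigma>: "\<sigma> > 0" using cSup_upper[OF \<open>e \<in> T\<close> bdd] e by (simp add: \<sigma>_def)
  then obtain t where t: "t \<in> T" "t > 9 / 10 * \<sigma>"
    using less_cSup_iff[of T "9 / 10 * \<sigma>"] bdd \<open>e \<in> T\<close> by (auto simp: \<sigma>_def)
  \<comment> \<open>The blocks have values above \<open>9/10 * \<sigma>\<close> and
    \<open>85/100 * \<sigma>\<close>, in total \<open>7/4 * \<sigma>\<close>. Division by the norm
    5/4 leaves \<open>7/5 * \<sigma>\<close>, well above \<open>6/5 * \<sigma>\<close>.\<close>
  have "6 / 5 * \<sigma> \<in> T"
    unfolding T_def
  proof (intro CollectI allI)
    fix n
    obtain x m where x: "lorentz_le x 1" "\<forall>i\<ge>m. x i = 0" "\<forall>i<n. x i = 0" "norm (f x) > t"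
      using t(1) unfolding T_def by blast
    \<comment> \<open>\<open>L\<close> depends on the support of the first block. The second block
      is then taken so far out that dropping its coordinates above \<open>1 / (4 * L)\<close> costs
      at most \<open>\<sigma> / 20\<close>.\<close>
    obtain L where L: "L \<ge> 1" "W L \<ge> 4 * W m" using W_unbounded by blast
    have "1 / (4 * real L) > 0" "\<sigma> / 20 > 0" using L \<sigma> by auto
    from discard_large_coordinates[OF f this(2,1)] obtain n' where n': "\<And>x. x \<in> unit_ball X \<Longrightarrow> \<forall>i<n'. x i = 0 \<Longrightarrow>
      \<exists>B. norm (f x - f (\<lambda>i. if i \<in> B then 0 else x i)) \<le> \<sigma> / 20 \<and>
        (\<forall>i. i \<notin> B \<longrightarrow> norm (x i) \<le> 1 / (4 * real L)) \<and> finite B" by blast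
    obtain x' m' where x': "lorentz_le x' 1" "\<forall>i\<ge>m'. x' i = 0" "\<forall>i<max n n'. x' i = 0" "norm (f x') > t"
      using t(1) unfolding T_def by blast
    obtain B where B: "norm (f x' - f (\<lambda>i. if i \<in> B then 0 else x' i)) \<le> \<sigma> / 20"
        "\<And>i. i \<notin> B \<Longrightarrow> norm (x' i) \<le> 1 / (4 * real L)"
      using n'[OF mem[OF x'(1,2)]] x'(3) by auto
    define y where "y = (\<lambda>i. if i \<in> B then 0 else x' i)"
    have y: "lorentz_le y 1" "\<forall>i\<ge>m'. y i = 0" "\<forall>i<n. y i = 0" "\<And>i. norm (y i) \<le> 1 / (4 * real L)"
      using lorentz_le_dominated[OF x'(1), of y] x'(2,3) B(2) by (auto simp: y_def)
    have fy: "norm (f y) > 85 / 100 * \<sigma>"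
      using norm_triangle_ineq2[of "f x'" "f y"] B(1) x'(4) t(2) unfolding y_def[symmetric] by simp
    \<comment> \<open>Rotates the second block so that the two values of \<open>f\<close> have the
      same phase and their moduli add.\<close>
    define \<theta> where "\<theta> = unimodular (f y) / unimodular (f x)"
    have \<theta>: "norm \<theta> = 1" by (simp add: \<theta>_def norm_divide)
    define z where "z = x + (\<lambda>i. \<theta> * y i)"
    have "unimodular (f x) \<noteq> 0" using norm_unimodular[of "f x"] by force
    then have eq: "unimodular (f x) * (f x + \<theta> * f y) = of_real (norm (f x) + norm (f y))"
      by (simp add: \<theta>_def distrib_left)
    have \<theta>y: "lorentz_le (\<lambda>i. \<theta> * y i) 1" "\<And>i. norm (\<theta> * y i) \<le> 1 / (4 * real L)"
      using lorentz_le_scale[OF y(1), of \<theta>] y(4) by (simp_all add: \<theta> norm_mult)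
    have "lorentz_le z (5 / 4)"
      unfolding z_def using x(1,2) \<theta>y L by (intro lorentz_le_sum_flat[of x m _ L]) auto
    define v where "v = (\<lambda>i. of_real (4 / 5) * z i)"
    have v1: "lorentz_le v 1"
      using lorentz_le_scale[OF \<open>lorentz_le z (5 / 4)\<close>, of "of_real (4 / 5)"]
      unfolding v_def by (simp add: norm_divide)
    have fv: "f v = of_real (4 / 5) * (f x + \<theta> * f y)"
    proof -
      have c: "x \<in> carrier X" "y \<in> carrier X"
        using mem[OF x(1,2)] mem[OF y(1,2)] by (auto simp: X.unit_ball_iff)
      then have "f z = f x + \<theta> * f y"
        using X.dual_add[OF f c(1) X.scale_closed[OF c(2)], of \<theta>] X.dual_scale[OF f c(2), of \<theta>]
        by (simp add: z_def scale_d_lower)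
      moreover have "z \<in> carrier X"
        using X.add_closed[OF c(1) X.scale_closed[OF c(2)], of \<theta>] by (simp add: z_def scale_d_lower)
      ultimately show ?thesis using X.dual_scale[OF f, of z "of_real (4 / 5)"] by (simp only: scale_d_lower v_def)
    qed
    have "norm (f v) > 6 / 5 * \<sigma>"
    proof -
      have "norm (f x + \<theta> * f y) = norm (unimodular (f x) * (f x + \<theta> * f y))" by (simp add: norm_mult)
      also have "\<dots> = norm (f x) + norm (f y)" unfolding eq norm_of_real by simp
      finally have "norm (f x + \<theta> * f y) > 175 / 100 * \<sigma>" using x(4) t(2) fy by simp
      then show ?thesis using \<sigma> unfolding fv norm_mult norm_of_real by simp
    qed
    moreover have "\<forall>i\<ge>max m m'. v i = 0" "\<forall>i<n. v i = 0"
      using x(2,3) y(2,3) by (auto simp: v_def z_def)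
    ultimately show "\<exists>x m. lorentz_le x 1 \<and> (\<forall>i\<ge>m. x i = 0) \<and> (\<forall>i<n. x i = 0) \<and> norm (f x) > 6 / 5 * \<sigma>"
      using v1 by (intro exI[of _ v] exI[of _ "max m m'"]) simp
  qed
  then have "6 / 5 * \<sigma> \<le> \<sigma>" unfolding \<sigma>_def using bdd by (intro cSup_upper)
  then show False using \<sigma> by simp
qed

text \<open>Weak majorization passes to convex increasing functions (Hardy--Littlewood--Polya). So
  truncations of \<open>w\<close> come arbitrarily close to the supremum of power sums over the unit
  ball.\<close>

lemma majorization:
  fixes x :: "nat \<Rightarrow> 'k::real_normed_field"
  assumes x: "lorentz_le x 1"
  shows "finite A \<Longrightarrow> (\<Sum>i\<in>A. norm (x i) ^ Suc m) \<le> (\<Sum>i<card A. w i ^ Suc m)"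
proof -
  text \<open>Convexity of \<open>t\<^sup>m\<^sup>+\<^sup>1\<close> and summation by parts along the decreasing order of \<open>x\<close>.\<close>
  have "(\<Sum>i\<in>A. norm (x i) ^ Suc m) - (\<Sum>i<card A. w i ^ Suc m) \<le>
      Suc m * \<mu> ^ m * ((\<Sum>i\<in>A. norm (x i)) - W (card A))"
    if "finite A" "\<mu> \<ge> 0" "\<And>i. i \<in> A \<Longrightarrow> \<mu> \<le> norm (x i)" for A and \<mu> :: real
    using that
  proof (induction "card A" arbitrary: A \<mu>)
    case (Suc n)
    then have ne: "A \<noteq> {}" by auto
    define a where "a = arg_min_on (\<lambda>i. norm (x i)) A"
    have a: "a \<in> A" "\<And>i. i \<in> A \<Longrightarrow> norm (x a) \<le> norm (x i)"
      unfolding a_def using arg_min_if_finite(1)[OF Suc.prems(1) ne] arg_min_least[OF Suc.prems(1) ne] by auto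
    have cA: "card A = Suc n" using Suc.hyps(2) by simp
    have IH: "(\<Sum>i\<in>A - {a}. norm (x i) ^ Suc m) - (\<Sum>i<n. w i ^ Suc m) \<le>
        Suc m * norm (x a) ^ m * ((\<Sum>i\<in>A - {a}. norm (x i)) - W n)"
      using Suc.hyps(1)[of "A - {a}" "norm (x a)"] cA Suc.prems(1) a by simp
    have step: "norm (x a) ^ Suc m - w n ^ Suc m \<le> Suc m * norm (x a) ^ m * (norm (x a) - w n)"
      using power_tangent w_nonneg by simp
    have "(\<Sum>i\<in>A. norm (x i) ^ Suc m) - (\<Sum>i<card A. w i ^ Suc m) =
        ((\<Sum>i\<in>A - {a}. norm (x i) ^ Suc m) - (\<Sum>i<n. w i ^ Suc m)) + (norm (x a) ^ Suc m - w n ^ Suc m)"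
      using sum.remove[OF Suc.prems(1) a(1), of "\<lambda>i. norm (x i) ^ Suc m"] cA by simp
    also have "\<dots> \<le> Suc m * norm (x a) ^ m * ((\<Sum>i\<in>A - {a}. norm (x i)) - W n) +
        Suc m * norm (x a) ^ m * (norm (x a) - w n)"
      using IH step by (rule add_mono)
    also have "\<dots> = Suc m * norm (x a) ^ m * ((\<Sum>i\<in>A. norm (x i)) - W (card A))"
      using sum.remove[OF Suc.prems(1) a(1), of "\<lambda>i. norm (x i)"] cA
      by (simp only: W_Suc) (simp add: algebra_simps)
    \<comment> \<open>The bracket is nonpositive, so lowering the slope from that at
      \<open>norm (x a)\<close> to that at \<open>\<mu>\<close> enlarges the product.\<close>
    also have "\<dots> \<le> Suc m * \<mu> ^ m * ((\<Sum>i\<in>A. norm (x i)) - W (card A))"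
      using Suc.prems(2,3) a(1) lorentz_leD[OF x Suc.prems(1)]
      by (intro mult_right_mono_neg mult_left_mono power_mono) auto
    finally show ?case .
  qed simp
  note main = this
  show "(\<Sum>i\<in>A. norm (x i) ^ Suc m) \<le> (\<Sum>i<card A. w i ^ Suc m)" if A: "finite A"
  proof -
    have "real (Suc m) * 0 ^ m * ((\<Sum>i\<in>A. norm (x i)) - W (card A)) \<le> 0"
      using lorentz_leD[OF x A] by (intro mult_nonneg_nonpos) auto
    moreover have "(\<Sum>i\<in>A. norm (x i) ^ Suc m) - (\<Sum>i<card A. w i ^ Suc m) \<le>
        real (Suc m) * 0 ^ m * ((\<Sum>i\<in>A. norm (x i)) - W (card A))"
      by (rule main[OF A]) auto
    ultimately show ?thesis by linarith
  qed
qed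

section \<open>Coordinates of bidual elements\<close>

definition coord :: "nat \<Rightarrow> (nat \<Rightarrow> 'k::real_normed_field) \<Rightarrow> 'k" where
  "coord i = (\<lambda>x. if x \<in> carrier X then x i else 0)"

lemma coord_dual: "coord i \<in> carrier (dual (X :: ('k::real_normed_field, nat \<Rightarrow> 'k) nspace))"
proof -
  interpret X: normed_bidual "X :: ('k, nat \<Rightarrow> 'k) nspace" by (rule normed_bidual_X)
  show ?thesis
  proof (rule X.dualI[where C = 1])
    fix x :: "nat \<Rightarrow> 'k" assume "x \<in> unit_ball X"
    then show "norm (coord i x) \<le> 1" using lorentz_le_coord[of x 1 i] by (auto simp: coord_def unit_ball_X_iff)
  next
    fix x y :: "nat \<Rightarrow> 'k" assume "x \<in> carrier X" "y \<in> carrier X"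
    then show "coord i (x + y) = coord i x + coord i y" using X.add_closed[of x y] by (simp add: coord_def)
  next
    fix c and x :: "nat \<Rightarrow> 'k" assume "x \<in> carrier X"
    then show "coord i (scale X c x) = c * coord i x"
      using X.scale_closed[of x c] by (simp add: coord_def) (simp add: scale_d_lower)
  qed (simp add: coord_def)
qed

text \<open>Test \<open>z\<close> against the sum over \<open>A\<close> of the coordinate
  functionals rotated to give nonnegative values; its norm is at most \<open>W (card A)\<close>.
  This gives the map from the bidual to \<open>d_upper w\<close>, without increase of norm.\<close>

lemma lorentz_le_bidual:
  fixes z :: "((nat \<Rightarrow> 'k::real_normed_field) \<Rightarrow> 'k) \<Rightarrow> 'k"
  assumes z: "z \<in> carrier (bidual X)" "nrm (bidual X) z \<le> r"
  shows "lorentz_le (\<lambda>i. z (coord i)) r"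
  unfolding lorentz_le_def
proof (intro allI impI)
  interpret X: normed_bidual "X :: ('k, nat \<Rightarrow> 'k) nspace" by (rule normed_bidual_X)
  fix A :: "nat set" assume A: "finite A"
  define \<theta> where "\<theta> i = unimodular (z (coord i))" for i
  define f where "f = (\<Sum>i\<in>A. scale (dual X) (\<theta> i) (coord i))"
  have f: "f \<in> carrier (dual X)" unfolding f_def using coord_dual X.D.scale_closed by (intro X.D.sum_closed) blast
  have "norm (f x) \<le> W (card A)" if x: "x \<in> unit_ball X" for x
  proof -
    have xl: "x \<in> carrier X" "lorentz_le x 1" using x by (auto simp: unit_ball_X_iff)
    have "norm (f x) \<le> (\<Sum>i\<in>A. norm (\<theta> i * coord i x))"
      unfolding f_def sum_fun_apply X.scale_dual by (rule norm_sum)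
    also have "\<dots> = (\<Sum>i\<in>A. norm (x i))" using xl(1) by (simp add: norm_mult \<theta>_def coord_def)
    also have "\<dots> \<le> W (card A)" using lorentz_leD[OF xl(2) A] by simp
    finally show ?thesis .
  qed
  then have fn: "nrm (dual X) f \<le> W (card A)" by (rule X.dual_nrm_leI)
  have "z f = (\<Sum>i\<in>A. \<theta> i * z (coord i))"
    unfolding f_def using X.D.dual_sum[OF z(1), of A "\<lambda>i. scale (dual X) (\<theta> i) (coord i)"]
      X.D.dual_scale[OF z(1) coord_dual] X.D.scale_closed[OF coord_dual] by simp
  also have "\<dots> = of_real (\<Sum>i\<in>A. norm (z (coord i)))" by (simp add: \<theta>_def)
  finally have "(\<Sum>i\<in>A. norm (z (coord i))) \<le> norm (z f)" by (simp only: norm_of_real abs_ge_self)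
  also have "\<dots> \<le> nrm (bidual X) z * nrm (dual X) f" by (rule X.D.dual_le[OF z(1) f])
  also have "\<dots> \<le> r * W (card A)"
    using z(2) fn X.B.nrm_nonneg[OF z(1)] X.D.nrm_nonneg[OF f] by (intro mult_mono) auto
  finally show "(\<Sum>i\<in>A. norm (z (coord i))) \<le> r * W (card A)" .
qed

text \<open>By \<open>shrinking\<close>, \<open>f\<close> is the norm limit of its finite parts,
  which involve finitely many coordinate functionals. On such a part \<open>z\<close> is determined
  by its coordinates.\<close>

lemma trunc_wstar_tendsto:
  fixes z :: "((nat \<Rightarrow> 'k::real_normed_field) \<Rightarrow> 'k) \<Rightarrow> 'k"
  assumes z: "z \<in> carrier (bidual X)" and f: "f \<in> carrier (dual X)"
  shows "(\<lambda>n. f (trunc n (\<lambda>i. z (coord i)))) \<longlonglongrightarrow> z f"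
proof (rule LIMSEQ_I)
  interpret X: normed_bidual "X :: ('k, nat \<Rightarrow> 'k) nspace" by (rule normed_bidual_X)
  fix e :: real assume e: "e > 0"
  define R where "R = nrm (bidual X) z + 1"
  have R: "R > 0" using X.B.nrm_nonneg[OF z] by (simp add: R_def)
  then have "e / (2 * R) > 0" using e by simp
  from shrinking[OF f this] obtain n0 where
    n0: "\<And>x. x \<in> unit_ball X \<Longrightarrow> \<forall>i<n0. x i = 0 \<Longrightarrow> norm (f x) \<le> e / (2 * R)" by blast
  have "norm (f (trunc n (\<lambda>i. z (coord i))) - z f) < e" if n: "n \<ge> n0" for n
  proof -
    define h where "h = (\<Sum>i<n. scale (dual X) (f (unit_seq i)) (coord i))"
    have hc: "scale (dual X) (f (unit_seq i)) (coord i) \<in> carrier (dual X)" for i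
      by (rule X.D.scale_closed[OF coord_dual])
    have h: "h \<in> carrier (dual X)" unfolding h_def using hc by (intro X.D.sum_closed) blast
    have ft: "f (trunc n x) = (\<Sum>i<n. x i * f (unit_seq i))" for x
      unfolding trunc_eq_sum using X.dual_sum[OF f, of "{..<n}" "\<lambda>i. scale X (x i) (unit_seq i)"]
        X.dual_scale[OF f unit_seq_mem] X.scale_closed[OF unit_seq_mem] by simp
    have "norm ((f - h) x) \<le> e / (2 * R)" if x: "x \<in> unit_ball X" for x
    proof -
      have xl: "x \<in> carrier X" "lorentz_le x 1" using x by (auto simp: unit_ball_X_iff)
      have "h x = f (trunc n x)"
        unfolding h_def sum_fun_apply ft X.scale_dual using xl(1) by (simp add: coord_def mult.commute)
      then have "(f - h) x = f (x - trunc n x)" using X.dual_diff[OF f xl(1) trunc_mem] by simp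
      moreover have "x - trunc n x \<in> unit_ball X"
        unfolding unit_ball_X_iff using xl lorentz_le_dominated[OF xl(2), of "x - trunc n x"]
        by (auto simp: trunc_def X.diff_closed trunc_mem[unfolded trunc_def])
      moreover have "\<forall>i<n0. (x - trunc n x) i = 0" using n by (simp add: trunc_def)
      ultimately show ?thesis using n0[of "x - trunc n x"] by simp
    qed
    then have "nrm (dual X) (f - h) \<le> e / (2 * R)" by (rule X.dual_nrm_leI)
    then have "norm (z (f - h)) \<le> nrm (bidual X) z * (e / (2 * R))"
      using X.D.dual_le[OF z X.D.diff_closed[OF f h]] X.B.nrm_nonneg[OF z]
      by (meson mult_left_mono order_trans)
    also have "\<dots> \<le> R * (e / (2 * R))" using e R by (intro mult_right_mono) (auto simp: R_def)
    also have "\<dots> < e" using e R by simp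
    finally have "norm (z f - z h) < e" using X.D.dual_diff[OF z f h] by simp
    moreover have "z h = f (trunc n (\<lambda>i. z (coord i)))"
      unfolding h_def ft using X.D.dual_sum[OF z, of "{..<n}" "\<lambda>i. scale (dual X) (f (unit_seq i)) (coord i)"]
        hc X.D.dual_scale[OF z coord_dual] by (simp add: mult.commute)
    ultimately show ?thesis by (simp add: norm_minus_commute)
  qed
  then show "\<exists>n0. \<forall>n\<ge>n0. norm (f (trunc n (\<lambda>i. z (coord i))) - z f) < e" by blast
qed

lemma perturbation:
  fixes x y :: "nat \<Rightarrow> 'k::real_normed_field"
  assumes y: "lorentz_le y 1" and x: "x \<in> carrier X" and yx: "lorentz_le (y - x) \<beta>" and \<beta>: "\<beta> < 1"
  shows "\<exists>\<delta>>0. \<exists>n0. \<forall>k\<ge>n0. \<forall>A. finite A \<longrightarrow> k \<in> A \<longrightarrow> (\<Sum>i\<in>A. norm (y i)) + \<delta> \<le> W (card A)"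
proof -
  \<comment> \<open>Chosen so that \<open>\<beta> + e = 1 - e\<close>.\<close>
  define e where "e = (1 - \<beta>) / 2"
  have e: "e > 0" using \<beta> by (simp add: e_def)
  obtain m where m: "\<And>A. finite A \<Longrightarrow> card A \<ge> m \<Longrightarrow> (\<Sum>i\<in>A. norm (x i)) \<le> e * W (card A)"
    using x e unfolding mem_X_iff by blast
  have large: "(\<Sum>i\<in>A. norm (y i)) + e \<le> W (card A)" if A: "finite A" "card A \<ge> m" "k \<in> A" for A k
  proof -
    have "(\<Sum>i\<in>A. norm (y i)) \<le> (\<Sum>i\<in>A. norm ((y - x) i)) + (\<Sum>i\<in>A. norm (x i))"
      unfolding sum.distrib[symmetric] by (intro sum_mono) (simp add: norm_triangle_sub add.commute)
    also have "\<dots> \<le> \<beta> * W (card A) + e * W (card A)"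
      using lorentz_leD[OF yx A(1)] m[OF A(1,2)] by simp
    also have "\<dots> = W (card A) - e * W (card A)" by (simp add: e_def field_simps)
    also have "\<dots> \<le> W (card A) - e"
      using W_ge_1[of "card A"] A e by (auto simp: Suc_le_eq card_gt_0_iff)
    finally show ?thesis by simp
  qed
  \<comment> \<open>Exchanging \<open>k\<close> for \<open>j\<close> keeps the cardinality and
    raises the sum by at least \<open>d\<close>, yet the new set still obeys the norm bound.\<close>
  have swap: "(\<Sum>i\<in>A. norm (y i)) + d \<le> W (card A)"
    if A: "finite A" "k \<in> A" and j: "j \<notin> A" "norm (y j) \<ge> norm (y k) + d" for A k j d
  proof -
    have "card (insert j (A - {k})) = card A" using A j card_Suc_Diff1[OF A] by simp
    then have "(\<Sum>i\<in>insert j (A - {k}). norm (y i)) \<le> W (card A)"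
      using lorentz_leD[OF y, of "insert j (A - {k})"] A by simp
    then show ?thesis using A j sum.remove[OF A, of "\<lambda>i. norm (y i)"] by simp
  qed
  have null: "\<exists>n0. \<forall>k\<ge>n0. norm (y k) < \<mu>" if "\<mu> > 0" for \<mu>
    using LIMSEQ_D[OF lorentz_le_null[OF y] that] by simp
  show ?thesis
  \<comment> \<open>With \<open>m\<close> nonzero coordinates, a set of fewer than \<open>m\<close>
    indices misses one of them. Otherwise \<open>y\<close> has finite support.\<close>
  proof (cases "\<exists>I. finite I \<and> card I = m \<and> I \<subseteq> {i. y i \<noteq> 0}")
    case True
    then obtain I where I: "finite I" "card I = m" "I \<subseteq> {i. y i \<noteq> 0}" by blast
    then obtain \<mu> where \<mu>: "\<mu> > 0" "\<And>i. i \<in> I \<Longrightarrow> \<mu> \<le> norm (y i)"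
      using finite_pos_lower_bound[OF I(1), of "\<lambda>i. norm (y i)"] by auto
    obtain n0 where n0: "\<And>k. k \<ge> n0 \<Longrightarrow> norm (y k) < \<mu> / 2" using null[of "\<mu> / 2"] \<mu>(1) by auto
    have "(\<Sum>i\<in>A. norm (y i)) + min e (\<mu> / 2) \<le> W (card A)" if k: "k \<ge> n0" "finite A" "k \<in> A" for k A
    proof (cases "card A \<ge> m")
      case True
      then show ?thesis using large[OF k(2) True k(3)] by simp
    next
      case False
      then have "\<not> I \<subseteq> A" using card_mono[OF k(2), of I] I(2) by auto
      then obtain j where "j \<in> I" "j \<notin> A" by blast
      then show ?thesis using swap[OF k(2,3), of j "min e (\<mu> / 2)"] \<mu>(2)[of j] n0[OF k(1)] by simp
    qed
    then show ?thesis using e \<mu>(1) by (intro exI[of _ "min e (\<mu> / 2)"]) auto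
  next
    case False
    define S where "S = {i. y i \<noteq> 0}"
    have S: "finite S" "card S < m"
    proof -
      show "finite S"
        using False infinite_arbitrarily_large[of S m] unfolding S_def by blast
      show "card S < m"
      proof (rule ccontr)
        assume "\<not> card S < m"
        then have "m \<le> card S" by simp
        then obtain I where "I \<subseteq> S" "card I = m" "finite I" by (rule obtain_subset_with_card_n)
        then have "\<exists>I. finite I \<and> card I = m \<and> I \<subseteq> {i. y i \<noteq> 0}"
          unfolding S_def by (intro exI[of _ I]) simp
        then show False using False by simp
      qed
    qed
    obtain \<mu> where \<mu>: "\<mu> > 0" "\<And>i. i \<in> S \<Longrightarrow> \<mu> \<le> norm (y i)"
      using finite_pos_lower_bound[OF S(1), of "\<lambda>i. norm (y i)"] by (auto simp: S_def)
    have "\<exists>n0. \<forall>i\<in>S. i < n0" using S(1) by (simp add: finite_nat_set_iff_bounded)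
    then obtain n0 where n0: "\<And>i. i \<in> S \<Longrightarrow> i < n0" by blast
    \<comment> \<open>A set containing the support \<open>S\<close> and the index \<open>k\<close>
      outside it has the weight \<open>w (card S)\<close> to spare; a set missing a point of
      \<open>S\<close> gains \<open>\<mu>\<close> by the exchange.\<close>
    define d where "d = min \<mu> (w (card S))"
    have "(\<Sum>i\<in>A. norm (y i)) + d \<le> W (card A)" if k: "k \<ge> n0" "finite A" "k \<in> A" for k A
    proof (cases "S \<subseteq> A")
      case True
      have kS: "k \<notin> S" using n0[of k] k(1) by auto
      have "(\<Sum>i\<in>A. norm (y i)) = (\<Sum>i\<in>S. norm (y i))"
        using True k(2) by (intro sum.mono_neutral_right) (auto simp: S_def)
      also have "\<dots> \<le> W (card S)" using lorentz_leD[OF y S(1)] by simp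
      finally have "(\<Sum>i\<in>A. norm (y i)) + d \<le> W (Suc (card S))" by (simp add: W_Suc d_def)
      also have "\<dots> \<le> W (card A)"
        using card_mono[OF k(2), of "insert k S"] True k(3) kS S(1) by (intro W_mono) simp
      finally show ?thesis .
    next
      case False
      then obtain j where j: "j \<in> S" "j \<notin> A" by blast
      have "y k = 0" using n0[of k] k(1) by (auto simp: S_def)
      then show ?thesis using swap[OF k(2,3) j(2), of d] \<mu>(2)[OF j(1)] by (simp add: d_def)
    qed
    then show ?thesis using \<mu>(1) w_pos by (intro exI[of _ d]) (auto simp: d_def)
  qed
qed

text \<open>\<open>\<delta>\<close> and \<open>n0\<close> precede \<open>\<eta>\<close> because they
  come from the coordinates \<open>z\<close> of \<open>a\<close> alone. Each \<open>y\<close> is an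
  average of truncations of \<open>z\<close>, hence dominated by \<open>z\<close>, and the slack of
  \<open>z\<close> is a slack of \<open>y\<close>.\<close>

lemma near_attaining:
  fixes Y :: "('k::real_normed_field, 'y::ab_group_add) nspace" and x :: "nat \<Rightarrow> 'k"
  assumes Y: "normed_space Y" and P: "P \<in> polys N X Y" and a: "a \<in> unit_sphere (bidual X)"
    and Pa: "nrm (bidual Y) (aron_berner N X Y P a) = 1"
    and x: "\<And>i. i \<ge> m \<Longrightarrow> x i = 0" and ax: "nrm (bidual X) (a - canon X x) \<le> \<beta>" and \<beta>: "\<beta> < 1"
  shows "\<exists>\<delta>>0. \<exists>n0. \<forall>\<eta>>0. \<exists>y. y \<in> unit_ball X \<and> (\<exists>m. \<forall>i\<ge>m. y i = 0) \<and> lorentz_le (y - x) \<beta> \<and>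
    (\<forall>t k. 0 \<le> t \<longrightarrow> t \<le> \<delta> \<longrightarrow> n0 \<le> k \<longrightarrow> y + scale X (of_real t) (unit_seq k) \<in> unit_ball X) \<and>
    nrm Y (P y) > 1 - \<eta>"
proof -
  interpret X: normed_bidual "X :: ('k, nat \<Rightarrow> 'k) nspace" by (rule normed_bidual_X)
  interpret Y: normed_bidual Y using Y by (simp add: normed_bidual_def)
  interpret normed_bidual_pair X Y ..
  have ac: "a \<in> carrier (bidual X)" "nrm (bidual X) a = 1" using a by (auto simp: unit_sphere_def)
  have xc: "x \<in> carrier X" using x by (intro finite_support_mem[of "{..<m}"]) auto
  define z where "z i = a (coord i)" for i
  have z1: "lorentz_le z 1" unfolding z_def using lorentz_le_bidual[OF ac(1)] ac(2) by simp
  have zx: "lorentz_le (z - x) \<beta>"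
  proof -
    have "a - canon X x \<in> carrier (bidual X)" by (rule X.B.diff_closed[OF ac(1) X.canon_bidual[OF xc]])
    from lorentz_le_bidual[OF this ax] have "lorentz_le (\<lambda>i. (a - canon X x) (coord i)) \<beta>" .
    moreover have "(a - canon X x) (coord i) = (z - x) i" for i
      using X.canon_apply[OF coord_dual, of x i] xc by (simp add: z_def coord_def)
    then have "(\<lambda>i. (a - canon X x) (coord i)) = z - x" by blast
    ultimately show ?thesis by (simp only:)
  qed
  obtain \<delta> n0 where \<delta>: "\<delta> > 0" "\<And>k A. k \<ge> n0 \<Longrightarrow> finite A \<Longrightarrow> k \<in> A \<Longrightarrow> (\<Sum>i\<in>A. norm (z i)) + \<delta> \<le> W (card A)"
    using perturbation[OF z1 xc zx \<beta>] by blast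
  \<comment> \<open>Cutting beyond the support of \<open>x\<close> keeps \<open>s n - x\<close>
    dominated coordinatewise by \<open>z - x\<close>.\<close>
  define s where "s n = trunc (n + m) z" for n
  have sb: "s n \<in> unit_ball X" for n
    unfolding s_def unit_ball_X_iff using lorentz_le_trunc[OF z1] by simp
  have lim: "(\<lambda>n. f (s n)) \<longlonglongrightarrow> a f" if "f \<in> carrier (dual X)" for f
    using LIMSEQ_ignore_initial_segment[OF trunc_wstar_tendsto[OF ac(1) that], of m] by (simp add: s_def z_def[abs_def])
  have ab: "a \<in> unit_ball (bidual X)" using ac by (simp add: X.B.unit_ball_iff)
  show ?thesis
  proof (intro exI[of _ \<delta>] conjI exI[of _ n0] allI impI)
    fix \<eta> :: real assume \<eta>: "\<eta> > 0"
    \<comment> \<open>Half of \<open>\<eta>\<close> is lost in choosing an almost norming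
      functional, the other half in the averaging.\<close>
    have "\<exists>f\<in>unit_ball (dual Y). norm (aron_berner N X Y P a f) > 1 - \<eta> / 2"
    proof (rule ccontr)
      assume "\<not> ?thesis"
      then have "nrm (bidual Y) (aron_berner N X Y P a) \<le> 1 - \<eta> / 2"
        by (intro Y.D.dual_nrm_leI) (auto simp: not_less)
      then show False using Pa \<eta> by simp
    qed
    then obtain f where f: "f \<in> carrier (dual Y)" "nrm (dual Y) f \<le> 1" "norm (aron_berner N X Y P a f) > 1 - \<eta> / 2"
      by (auto simp: Y.D.unit_ball_iff)
    obtain L ns where L: "L \<ge> (1::nat)" and app:
      "norm (f (P (scale X (of_real (1 / L)) (\<Sum>i<L. s (ns i)))) - aron_berner N X Y P a f) < \<eta> / 2"
      using aron_berner_approx[OF P ab sb lim f(1), of "\<eta> / 2"] \<eta> by auto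
    define y where "y = scale X (of_real (1 / L)) (\<Sum>i<L. s (ns i))"
    have ycoord: "y j = of_real (1 / L) * (\<Sum>i<L. s (ns i) j)" for j
      unfolding y_def scale_d_lower sum_fun_apply ..
    have avg: "norm (of_real (1 / L) * (\<Sum>i<L. u i) :: 'k) \<le> B" if "\<And>i. i < L \<Longrightarrow> norm (u i) \<le> B" for u B
    proof -
      have "norm (\<Sum>i<L. u i) \<le> (\<Sum>i<L. B)" using that by (intro order_trans[OF norm_sum] sum_mono) auto
      then show ?thesis using L unfolding norm_mult norm_of_real by (simp add: field_simps)
    qed
    have yz: "norm (y j) \<le> norm (z j)" for j
      unfolding ycoord by (rule avg) (simp add: s_def trunc_def)
    have "norm ((y - x) j) \<le> norm ((z - x) j)" for j
    proof -
      have "(of_real (1 / L) :: 'k) * (\<Sum>i<L. x j) = x j" using L by simp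
      then have "(y - x) j = of_real (1 / L) * (\<Sum>i<L. s (ns i) j - x j)"
        using ycoord[of j] by (simp only: sum_subtractf right_diff_distrib minus_apply)
      moreover have "norm (s n j - x j) \<le> norm ((z - x) j)" for n
        using x[of j] by (cases "j < n + m") (auto simp: s_def trunc_def)
      ultimately show ?thesis using avg[of "\<lambda>i. s (ns i) j - x j"] by simp
    qed
    then have yx: "lorentz_le (y - x) \<beta>" by (rule lorentz_le_dominated[OF zx])
    have "\<forall>i\<ge>Max (insert 0 (ns ` {..<L})) + m. y i = 0"
    proof (intro allI impI)
      fix j assume j: "j \<ge> Max (insert 0 (ns ` {..<L})) + m"
      have "s (ns i) j = 0" if "i < L" for i
      proof -
        have "ns i \<le> Max (insert 0 (ns ` {..<L}))" using that by (intro Max_ge) auto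
        then show ?thesis using j by (simp add: s_def trunc_def)
      qed
      then show "y j = 0" unfolding ycoord by simp
    qed
    then obtain M where M: "\<forall>i\<ge>M. y i = 0" by blast
    have yc: "y \<in> carrier X" using M by (intro finite_support_mem[of "{..<M}"]) auto
    have yb: "y \<in> unit_ball X" using yc lorentz_le_dominated[OF z1 yz] by (simp add: unit_ball_X_iff)
    have pert: "y + scale X (of_real t) (unit_seq k) \<in> unit_ball X" if t: "0 \<le> t" "t \<le> \<delta>" "n0 \<le> k" for t k
    proof -
      have le: "norm ((y + scale X (of_real t) (unit_seq k)) i) \<le> norm (z i) + (if i = k then t else 0)" for i
        using yz[of i] norm_triangle_ineq[of "y i" "of_real t"] t(1)
        by (auto simp: scale_d_lower unit_seq_def)
      have "lorentz_le (y + scale X (of_real t) (unit_seq k)) 1"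
        unfolding lorentz_le_def
      proof (intro allI impI)
        fix A :: "nat set" assume A: "finite A"
        have "(\<Sum>i\<in>A. norm ((y + scale X (of_real t) (unit_seq k)) i)) \<le>
            (\<Sum>i\<in>A. norm (z i)) + (\<Sum>i\<in>A. if i = k then t else 0)"
          unfolding sum.distrib[symmetric] by (intro sum_mono le)
        also have "\<dots> \<le> W (card A)"
          using \<delta>(2)[OF t(3) A] lorentz_leD[OF z1 A] A t(2) by (cases "k \<in> A") auto
        finally show "(\<Sum>i\<in>A. norm ((y + scale X (of_real t) (unit_seq k)) i)) \<le> 1 * W (card A)" by simp
      qed
      moreover have "y + scale X (of_real t) (unit_seq k) \<in> carrier X"
        by (rule X.add_closed[OF yc X.scale_closed[OF unit_seq_mem]])
      ultimately show ?thesis by (simp add: unit_ball_X_iff)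
    qed
    have "replicate N y \<in> tuples N X" using yc by (auto simp: tuples_def)
    then have Py: "P y \<in> carrier Y"
      using XY.assoc_sym(4)[OF P yc] multilinear_closed[OF XY.assoc_sym(1)[OF P]] by simp
    have "1 - \<eta> < norm (f (P y))"
      using app[folded y_def] f(3) norm_triangle_ineq3[of "f (P y)" "aron_berner N X Y P a f"] by linarith
    also have "\<dots> \<le> nrm (dual Y) f * nrm Y (P y)" by (rule Y.dual_le[OF f(1) Py])
    also have "\<dots> \<le> nrm Y (P y)" using f(2) Y.nrm_nonneg[OF Py] by (simp add: mult_left_le_one_le Y.D.nrm_nonneg[OF f(1)])
    finally have "nrm Y (P y) > 1 - \<eta>" .
    then show "\<exists>y. y \<in> unit_ball X \<and> (\<exists>m. \<forall>i\<ge>m. y i = 0) \<and> lorentz_le (y - x) \<beta> \<and>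
      (\<forall>t k. 0 \<le> t \<longrightarrow> t \<le> \<delta> \<longrightarrow> n0 \<le> k \<longrightarrow> y + scale X (of_real t) (unit_seq k) \<in> unit_ball X) \<and>
      nrm Y (P y) > 1 - \<eta>"
      using yb M yx pert by (intro exI[of _ y]) blast
  qed (rule \<delta>(1))
qed

end

section \<open>The spaces \<open>\<ell>\<^sub>M\<close>\<close>

lemma carrier_ell: "x \<in> carrier (ell M) \<longleftrightarrow> summable (\<lambda>i. norm (x i) ^ M)"
  and scale_ell: "scale (ell M) c x = (\<lambda>i. c * x i)"
  and nrm_ell: "nrm (ell M) x = root M (\<Sum>i. norm (x i) ^ M)"
  by (simp_all add: ell_def)

lemma nrm_ell_nonneg: "x \<in> carrier (ell M) \<Longrightarrow> nrm (ell M) x \<ge> 0"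
  by (cases "M = 0") (simp_all add: nrm_ell carrier_ell suminf_nonneg real_root_ge_zero)

lemma nrm_ell_power: "x \<in> carrier (ell M) \<Longrightarrow> M \<ge> 1 \<Longrightarrow> nrm (ell M) x ^ M = (\<Sum>i. norm (x i) ^ M)"
  by (simp add: nrm_ell carrier_ell suminf_nonneg real_root_pow_pos2)

lemma power_le_cancel: "a ^ M \<le> b ^ M \<Longrightarrow> a \<ge> 0 \<Longrightarrow> b \<ge> 0 \<Longrightarrow> M \<ge> 1 \<Longrightarrow> a \<le> b" for a b :: real
  using power_mono_iff[of a b M] by simp

lemma nrm_ell_leI:
  assumes "x \<in> carrier (ell M)" "M \<ge> 1" "r \<ge> 0" "(\<Sum>i. norm (x i) ^ M) \<le> r ^ M"
  shows "nrm (ell M) x \<le> r"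
  using assms nrm_ell_power[OF assms(1,2)] by (metis power_mono_iff nrm_ell_nonneg Suc_le_eq One_nat_def)

text \<open>Take tangents at the convex combination \<open>p\<close>; their weighted linear parts
  cancel.\<close>

lemma power_convex:
  fixes u v t :: real
  assumes "u \<ge> 0" "v \<ge> 0" "0 \<le> t" "t \<le> 1"
  shows "(t * u + (1 - t) * v) ^ Suc m \<le> t * u ^ Suc m + (1 - t) * v ^ Suc m"
proof -
  define p where "p = t * u + (1 - t) * v"
  have p: "p \<ge> 0" using assms by (simp add: p_def)
  have "t * (p ^ Suc m - u ^ Suc m) + (1 - t) * (p ^ Suc m - v ^ Suc m) \<le>
      t * (Suc m * p ^ m * (p - u)) + (1 - t) * (Suc m * p ^ m * (p - v))"
    using power_tangent[OF p assms(1), of m] power_tangent[OF p assms(2), of m] assms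
    by (intro add_mono mult_left_mono) auto
  also have "\<dots> = Suc m * p ^ m * (p - (t * u + (1 - t) * v))" by (simp add: algebra_simps)
  also have "\<dots> = 0" by (simp add: p_def)
  finally show ?thesis unfolding p_def[symmetric] by (simp add: algebra_simps)
qed

text \<open>Minkowski's inequality from convexity: with \<open>t = a / (a + b)\<close>, the quotient
  of \<open>norm (x i) + norm (y i)\<close> by \<open>a + b\<close> is a convex combination of
  \<open>norm (x i) / a\<close> and \<open>norm (y i) / b\<close>. Taking \<open>a\<close> and
  \<open>b\<close> strictly above the norms avoids division by 0.\<close>

lemma ell_add:
  assumes x: "x \<in> carrier (ell (Suc m))" and y: "y \<in> carrier (ell (Suc m))"
  shows "x + y \<in> carrier (ell (Suc m))"
    and "nrm (ell (Suc m)) (x + y) \<le> nrm (ell (Suc m)) x + nrm (ell (Suc m)) y"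
proof -
  let ?M = "Suc m" and ?n = "nrm (ell (Suc m))"
  have *: "x + y \<in> carrier (ell ?M) \<and> ?n (x + y) \<le> a + b"
    if a: "a > ?n x" and b: "b > ?n y" for a b
  proof -
    have ab: "a > 0" "b > 0" using a b nrm_ell_nonneg[OF x] nrm_ell_nonneg[OF y] by auto
    define t where "t = a / (a + b)"
    have t: "0 \<le> t" "t \<le> 1" "1 - t = b / (a + b)" using ab by (auto simp: t_def field_simps)
    define g where "g i = (a + b) ^ ?M * (t * (norm (x i) ^ ?M / a ^ ?M) + (1 - t) * (norm (y i) ^ ?M / b ^ ?M))" for i
    have le: "norm ((x + y) i) ^ ?M \<le> g i" for i
    proof -
      have "(norm (x i) + norm (y i)) / (a + b) = t * (norm (x i) / a) + (1 - t) * (norm (y i) / b)"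
        unfolding t(3) using ab by (simp add: t_def add_divide_distrib)
      then have "((norm (x i) + norm (y i)) / (a + b)) ^ ?M \<le>
          t * (norm (x i) / a) ^ ?M + (1 - t) * (norm (y i) / b) ^ ?M"
        using power_convex[of "norm (x i) / a" "norm (y i) / b" t m] ab t by simp
      then have "(norm (x i) + norm (y i)) ^ ?M \<le> g i"
        using ab unfolding g_def power_divide by (subst (asm) pos_divide_le_eq) (simp_all add: mult.commute)
      moreover have "norm ((x + y) i) ^ ?M \<le> (norm (x i) + norm (y i)) ^ ?M"
        by (intro power_mono) (auto intro: norm_triangle_ineq)
      ultimately show ?thesis by linarith
    qed
    have sx: "summable (\<lambda>i. norm (x i) ^ ?M)" "summable (\<lambda>i. norm (y i) ^ ?M)"
      using x y by (auto simp: carrier_ell)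
    have sg: "summable g" unfolding g_def using sx by (intro summable_mult summable_add summable_divide)
    have cl: "x + y \<in> carrier (ell ?M)"
      unfolding carrier_ell using le by (intro summable_comparison_test'[OF sg, of 0]) auto
    have "(\<Sum>i. norm ((x + y) i) ^ ?M) \<le> (\<Sum>i. g i)"
      using le sg cl by (intro suminf_le) (auto simp: carrier_ell)
    also have "\<dots> = (a + b) ^ ?M * (t * (?n x ^ ?M / a ^ ?M) + (1 - t) * (?n y ^ ?M / b ^ ?M))"
    proof -
      have "(\<lambda>i. norm (x i) ^ ?M) sums (?n x ^ ?M)" "(\<lambda>i. norm (y i) ^ ?M) sums (?n y ^ ?M)"
        using sx nrm_ell_power[OF x] nrm_ell_power[OF y] by (simp_all add: summable_sums del: power_Suc)
      then have "g sums ((a + b) ^ ?M * (t * (?n x ^ ?M / a ^ ?M) + (1 - t) * (?n y ^ ?M / b ^ ?M)))"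
        unfolding g_def by (intro sums_mult sums_add sums_divide)
      then show ?thesis by (rule sums_unique[symmetric])
    qed
    also have "\<dots> \<le> (a + b) ^ ?M * (t * 1 + (1 - t) * 1)"
    proof -
      have "?n x ^ ?M / a ^ ?M \<le> 1" "?n y ^ ?M / b ^ ?M \<le> 1"
        using ab a b nrm_ell_nonneg[OF x] nrm_ell_nonneg[OF y]
        by (auto simp: divide_le_eq_1 simp del: power_Suc intro!: power_mono)
      then show ?thesis using ab t by (intro mult_left_mono add_mono) auto
    qed
    finally have "(\<Sum>i. norm ((x + y) i) ^ ?M) \<le> (a + b) ^ ?M" by simp
    then show ?thesis using cl ab nrm_ell_leI[OF cl, of "a + b"] by simp
  qed
  show "x + y \<in> carrier (ell ?M)" using *[of "?n x + 1" "?n y + 1"] by simp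
  show "?n (x + y) \<le> ?n x + ?n y"
  proof (rule field_le_epsilon)
    fix e :: real assume "e > 0"
    then show "?n (x + y) \<le> ?n x + ?n y + e" using *[of "?n x + e / 2" "?n y + e / 2"] by simp
  qed
qed

lemma normed_space_ell:
  assumes "M \<ge> 1"
  shows "normed_space (ell M :: ('k::real_normed_field, nat \<Rightarrow> 'k) nspace)"
proof -
  obtain m where M: "M = Suc m" using assms by (cases M) auto
  show ?thesis
  proof
    show "(0 :: nat \<Rightarrow> 'k) \<in> carrier (ell M)" using M by (simp add: carrier_ell)
    fix x :: "nat \<Rightarrow> 'k" assume x: "x \<in> carrier (ell M)"
    show sc: "scale (ell M) c x \<in> carrier (ell M)" for c
      using x by (simp add: carrier_ell scale_ell norm_mult power_mult_distrib summable_mult)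
    show "scale (ell M) (c + d) x = scale (ell M) c x + scale (ell M) d x" for c d
      by (auto simp: scale_ell algebra_simps)
    show "scale (ell M) c (scale (ell M) d x) = scale (ell M) (c * d) x" for c d
      by (auto simp: scale_ell algebra_simps)
    show "scale (ell M) 1 x = x" by (simp add: scale_ell)
    show "nrm (ell M) (scale (ell M) c x) = norm c * nrm (ell M) x" for c
      using x M by (simp add: nrm_ell scale_ell norm_mult power_mult_distrib suminf_mult carrier_ell
          real_root_mult real_root_power_cancel del: power_Suc)
    fix y :: "nat \<Rightarrow> 'k" assume y: "y \<in> carrier (ell M)"
    show "x + y \<in> carrier (ell M)" using ell_add(1) x y M by blast
    show "nrm (ell M) (x + y) \<le> nrm (ell M) x + nrm (ell M) y" using ell_add(2) x y M by blast
    show "scale (ell M) c (x + y) = scale (ell M) c x + scale (ell M) c y" for c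
      by (auto simp: scale_ell algebra_simps)
  qed
qed

lemma nrm_ell_finite:
  assumes "M \<ge> 1" "x \<in> carrier (ell M)" "finite A"
  shows "(\<Sum>i\<in>A. norm (x i) ^ M) \<le> nrm (ell M) x ^ M"
  unfolding nrm_ell_power[OF assms(2,1)] using assms(2,3)
  by (intro sum_le_suminf) (auto simp: carrier_ell)

lemma nrm_ell_coord:
  assumes "M \<ge> 1" "x \<in> carrier (ell M)"
  shows "norm (x i) \<le> nrm (ell M) x"
proof -
  have "norm (x i) ^ M \<le> nrm (ell M) x ^ M" using nrm_ell_finite[OF assms, of "{i}"] by simp
  then show ?thesis using assms nrm_ell_nonneg[OF assms(2)] by (simp add: power_mono_iff)
qed

lemma trunc_ell: "M \<ge> 1 \<Longrightarrow> trunc m x \<in> carrier (ell M)"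
  unfolding carrier_ell by (intro summable_finite[of "{..<m}"]) (auto simp: trunc_def)

lemma nrm_ell_trunc: "M \<ge> 1 \<Longrightarrow> nrm (ell M) (trunc m x) ^ M = (\<Sum>i<m. norm (x i) ^ M)"
  unfolding nrm_ell_power[OF trunc_ell]
  by (subst suminf_finite[of "{..<m}"]) (auto simp: trunc_def)

lemma nrm_ell_trunc_le:
  assumes "M \<ge> 1" "x \<in> carrier (ell M)"
  shows "nrm (ell M) (trunc m x) \<le> nrm (ell M) x"
proof -
  have "nrm (ell M) (trunc m x) ^ M \<le> nrm (ell M) x ^ M"
    unfolding nrm_ell_trunc[OF assms(1)] by (rule nrm_ell_finite[OF assms]) simp
  then show ?thesis
    by (rule power_le_cancel[OF _ nrm_ell_nonneg[OF trunc_ell[OF assms(1)]] nrm_ell_nonneg[OF assms(2)] assms(1)])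
qed

lemma nrm_ell_unit_seq:
  assumes M: "M \<ge> 1"
  shows "(unit_seq k :: nat \<Rightarrow> 'a::real_normed_field) \<in> carrier (ell M)"
    and "nrm (ell M) (unit_seq k :: nat \<Rightarrow> 'a) = 1"
proof -
  have e: "norm (unit_seq k i :: 'a) ^ M = (if i = k then 1 else 0)" for i using M by (simp add: unit_seq_def)
  show c: "(unit_seq k :: nat \<Rightarrow> 'a) \<in> carrier (ell M)"
    unfolding carrier_ell e by (intro summable_finite[of "{k}"]) auto
  have "(\<Sum>i. norm (unit_seq k i :: 'a) ^ M) = 1" unfolding e by (subst suminf_finite[of "{k}"]) auto
  then show "nrm (ell M) (unit_seq k :: nat \<Rightarrow> 'a) = 1" unfolding nrm_ell using M by simp
qed

lemma nrm_ell_trunc_le_sum: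
  fixes x :: "nat \<Rightarrow> 'k::real_normed_field"
  assumes "M \<ge> 1"
  shows "nrm (ell M) (trunc m x) \<le> (\<Sum>i<m. norm (x i))"
proof -
  interpret Y: normed_space "ell M :: ('k, nat \<Rightarrow> 'k) nspace" by (rule normed_space_ell[OF assms])
  have "trunc m x = (\<Sum>i<m. scale (ell M) (x i) (unit_seq i))"
  proof
    fix j
    have "(\<Sum>i<m. scale (ell M) (x i) (unit_seq i)) j = (\<Sum>i<m. if i = j then x i else 0)"
      unfolding sum_fun_apply scale_ell unit_seq_def by (intro sum.cong) auto
    then show "trunc m x j = (\<Sum>i<m. scale (ell M) (x i) (unit_seq i)) j" by (simp add: trunc_def)
  qed
  then have "nrm (ell M) (trunc m x) = nrm (ell M) (\<Sum>i<m. scale (ell M) (x i) (unit_seq i))" by simp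
  also have "\<dots> \<le> (\<Sum>i<m. norm (x i))"
    using nrm_ell_unit_seq[OF assms, where 'a = 'k]
    by (intro order_trans[OF Y.nrm_sum] sum_mono) (auto simp: Y.nrm_scale)
  finally show ?thesis .
qed

section \<open>Homogeneous polynomials\<close>

context normed_pair
begin

lemma polysI:
  assumes "multilinear N X Y \<Phi>" "ball_bounded N X Y C \<Phi>" "\<And>x. x \<in> carrier X \<Longrightarrow> P x = \<Phi> (replicate N x)"
  shows "P \<in> polys N X Y"
proof -
  have "ball_bounded N X Y (max 0 C) \<Phi>" using assms(2) unfolding ball_bounded_def by force
  then show ?thesis
    using ball_bounded_imp_continuous[OF assms(1), of "max 0 C"] assms(1,3) unfolding polys_def by auto
qed

lemma polys_form:
  assumes "P \<in> polys N X Y"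
  shows "\<exists>C\<ge>0. ball_bounded N X Y C (assoc_sym N X Y P)"
  using continuous_imp_ball_bounded[OF assoc_sym(1,2)[OF assms]] .

lemma polys_closed: "P \<in> polys N X Y \<Longrightarrow> x \<in> carrier X \<Longrightarrow> P x \<in> carrier Y"
  using assoc_sym(4)[of P N x] multilinear_closed[OF assoc_sym(1)[of P N], of "replicate N x"]
  by (auto simp: tuples_def set_replicate_conv_if)

lemma polys_bdd_above:
  assumes "P \<in> polys N X Y"
  shows "bdd_above ((\<lambda>x. nrm Y (P x)) ` unit_ball X)"
proof -
  obtain C where "ball_bounded N X Y C (assoc_sym N X Y P)" using polys_form[OF assms] by blast
  then have "nrm Y (P x) \<le> C" if "x \<in> unit_ball X" for x
    using assoc_sym(4)[OF assms, of x] ball_boundedD[of N X Y C _ "replicate N x"] that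
    by (auto simp: X.unit_ball_iff set_replicate_conv_if)
  then show ?thesis by (auto intro!: bdd_aboveI2)
qed

lemma poly_norm_upper: "P \<in> polys N X Y \<Longrightarrow> x \<in> unit_ball X \<Longrightarrow> nrm Y (P x) \<le> poly_norm X Y P"
  unfolding poly_norm_def using polys_bdd_above by (intro cSUP_upper) auto

lemma polys_scale:
  assumes "P \<in> polys N X Y" "x \<in> carrier X"
  shows "P (scale X c x) = scale Y (c ^ N) (P x)"
proof -
  have "[] @ replicate N x \<in> tuples N X" using assms(2) by (auto simp: tuples_def)
  from multilinear_scale_map[OF assoc_sym(1)[OF assms(1)] this, of c] show ?thesis
    using assms(2) by (simp add: assoc_sym(4)[OF assms(1)] map_replicate)
qed

lemma polys_diff:
  assumes P: "P \<in> polys N X Y" and Q: "Q \<in> polys N X Y"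
  shows "(\<lambda>x. P x - Q x) \<in> polys N X Y"
proof -
  let ?p = "assoc_sym N X Y P" and ?q = "assoc_sym N X Y Q"
  note p = assoc_sym[OF P] and q = assoc_sym[OF Q]
  obtain C D where b: "ball_bounded N X Y C ?p" "ball_bounded N X Y D ?q"
    using polys_form[OF P] polys_form[OF Q] by blast
  show ?thesis
  proof (rule polysI)
    show "multilinear N X Y (\<lambda>xs. ?p xs - ?q xs)"
    proof (rule multilinearI)
      fix xs ys u v assume t: "xs @ u # ys \<in> tuples N X" and v: "v \<in> carrier X"
      show "?p (xs @ (u + v) # ys) - ?q (xs @ (u + v) # ys) =
          ?p (xs @ u # ys) - ?q (xs @ u # ys) + (?p (xs @ v # ys) - ?q (xs @ v # ys))"
        unfolding multilinear_add[OF p(1) t v] multilinear_add[OF q(1) t v] by simp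
    next
      fix xs ys u assume t: "xs @ u # ys \<in> tuples N X"
      show "?p (xs @ scale X c u # ys) - ?q (xs @ scale X c u # ys) =
          scale Y c (?p (xs @ u # ys) - ?q (xs @ u # ys))" for c
        unfolding multilinear_scale[OF p(1) t] multilinear_scale[OF q(1) t]
        by (rule Y.scale_diff_right[symmetric, OF multilinear_closed[OF p(1) t] multilinear_closed[OF q(1) t]])
    qed (use multilinear_closed[OF p(1)] multilinear_closed[OF q(1)] Y.diff_closed in blast)
    show "ball_bounded N X Y (C + D) (\<lambda>xs. ?p xs - ?q xs)"
      unfolding ball_bounded_def
    proof (intro allI impI)
      fix xs assume xs: "length xs = N \<and> set xs \<subseteq> unit_ball X"
      then have t: "xs \<in> tuples N X" by (auto simp: tuples_def X.unit_ball_iff)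
      show "nrm Y (?p xs - ?q xs) \<le> C + D"
        using Y.nrm_diff[OF multilinear_closed[OF p(1) t] multilinear_closed[OF q(1) t]]
          ball_boundedD[OF b(1), of xs] ball_boundedD[OF b(2), of xs] xs by linarith
    qed
  qed (use p(4) q(4) in auto)
qed

text \<open>The first argument goes to \<open>f\<close>, the others to the form of \<open>P\<close>;
  \<open>polys\<close> asks for some multilinear form, symmetric or not.\<close>

lemma polys_mult_dual:
  assumes P: "P \<in> polys N X Y" and f: "f \<in> carrier (dual X)"
  shows "(\<lambda>x. scale Y (f x) (P x)) \<in> polys (Suc N) X Y"
proof -
  let ?p = "assoc_sym N X Y P"
  note p = assoc_sym[OF P]
  obtain C where C: "C \<ge> 0" "ball_bounded N X Y C ?p" using polys_form[OF P] by blast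
  obtain F where F: "F > 0" "\<And>x. x \<in> unit_ball X \<Longrightarrow> norm (f x) \<le> F" using X.dual_bound_exists[OF f] by blast
  show ?thesis
  proof (rule polysI)
    show "multilinear (Suc N) X Y (\<lambda>xs. scale Y (f (hd xs)) (?p (tl xs)))"
    proof (rule multilinearI)
      fix xs assume "xs \<in> tuples (Suc N) X"
      then have "tl xs \<in> tuples N X" by (cases xs) auto
      then show "scale Y (f (hd xs)) (?p (tl xs)) \<in> carrier Y" using multilinear_closed[OF p(1)] by simp
    next
      fix xs ys u v assume t: "xs @ u # ys \<in> tuples (Suc N) X" and v: "v \<in> carrier X"
      show "scale Y (f (hd (xs @ (u + v) # ys))) (?p (tl (xs @ (u + v) # ys))) =
          scale Y (f (hd (xs @ u # ys))) (?p (tl (xs @ u # ys))) +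
          scale Y (f (hd (xs @ v # ys))) (?p (tl (xs @ v # ys)))"
      proof (cases xs)
        case Nil
        then show ?thesis
          using t v multilinear_closed[OF p(1), of ys] X.dual_add[OF f] by (simp add: Y.scale_add_left)
      next
        case (Cons x xs')
        then have t': "xs' @ u # ys \<in> tuples N X" using t by simp
        then have "xs' @ v # ys \<in> tuples N X" using v by (auto simp: tuples_def)
        then show ?thesis
          using multilinear_add[OF p(1) t' v] multilinear_closed[OF p(1)] t' Cons
          by (simp add: Y.scale_add_right)
      qed
    next
      fix xs ys u c assume t: "xs @ u # ys \<in> tuples (Suc N) X"
      show "scale Y (f (hd (xs @ scale X c u # ys))) (?p (tl (xs @ scale X c u # ys))) =
          scale Y c (scale Y (f (hd (xs @ u # ys))) (?p (tl (xs @ u # ys))))"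
      proof (cases xs)
        case Nil
        then show ?thesis
          using t multilinear_closed[OF p(1), of ys] X.dual_scale[OF f] by (simp add: Y.scale_scale)
      next
        case (Cons x xs')
        then have t': "xs' @ u # ys \<in> tuples N X" using t by simp
        then show ?thesis
          using multilinear_scale[OF p(1) t', of c] multilinear_closed[OF p(1) t'] Cons
          by (simp add: Y.scale_scale mult.commute)
      qed
    qed
    show "ball_bounded (Suc N) X Y (F * C) (\<lambda>xs. scale Y (f (hd xs)) (?p (tl xs)))"
      unfolding ball_bounded_def
    proof (intro allI impI)
      fix xs assume "length xs = Suc N \<and> set xs \<subseteq> unit_ball X"
      then obtain x xs' where xs: "xs = x # xs'" "length xs' = N" "x \<in> unit_ball X" "set xs' \<subseteq> unit_ball X"
        by (cases xs) auto
      then have t: "xs' \<in> tuples N X" by (auto simp: tuples_def X.unit_ball_iff)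
      have "norm (f x) * nrm Y (?p xs') \<le> F * C"
        using F xs ball_boundedD[OF C(2)] multilinear_closed[OF p(1) t] by (intro mult_mono) auto
      then show "nrm Y (scale Y (f (hd xs)) (?p (tl xs))) \<le> F * C"
        using xs multilinear_closed[OF p(1) t] by (simp add: Y.nrm_scale)
    qed
  qed (use p(4) in auto)
qed

lemma polys_mult_dual_power:
  assumes P: "P \<in> polys N X Y" and f: "f \<in> carrier (dual X)"
  shows "(\<lambda>x. scale Y (f x ^ K) (P x)) \<in> polys (K + N) X Y"
proof (induction K)
  case 0
  have "P x = scale Y 1 (P x)" if "x \<in> carrier X" for x using polys_closed[OF P that] by simp
  then show ?case
    using assoc_sym[OF P] unfolding polys_def by auto
next
  case (Suc K)
  have "(\<lambda>x. scale Y (f x) (scale Y (f x ^ K) (P x))) \<in> polys (Suc (K + N)) X Y"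
    by (rule polys_mult_dual[OF Suc f])
  moreover have "scale Y (f x) (scale Y (f x ^ K) (P x)) = scale Y (f x ^ Suc K) (P x)"
    if "x \<in> carrier X" for x using polys_closed[OF P that] by (simp add: Y.scale_scale)
  ultimately show ?case unfolding polys_def by auto
qed

lemma polys_lipschitz:
  assumes P: "P \<in> polys N X Y"
  shows "\<exists>C\<ge>0. \<forall>x\<in>unit_ball X. \<forall>y\<in>unit_ball X. \<forall>d>0. nrm X (y - x) \<le> d \<longrightarrow> nrm Y (P y - P x) \<le> C * d"
proof -
  let ?p = "assoc_sym N X Y P"
  note p = assoc_sym[OF P]
  obtain C where C: "C \<ge> 0" "ball_bounded N X Y C ?p" using polys_form[OF P] by blast
  have "nrm Y (P y - P x) \<le> (N * C) * d"
    if "x \<in> unit_ball X" "y \<in> unit_ball X" "d > 0" "nrm X (y - x) \<le> d" for x y d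
  proof -
    have "nrm Y (?p (replicate N y) - ?p (replicate N x)) \<le> N * C * 1 ^ N * d"
      by (rule multilinear_lipschitz[OF p(1) C(2,1)]) (use that in \<open>auto simp: tuples_def X.unit_ball_iff\<close>)
    then show ?thesis using p(4) that by (simp add: X.unit_ball_iff)
  qed
  then show ?thesis using C(1) by (intro exI[of _ "N * C"]) auto
qed

text \<open>The coefficient of \<open>t ^ j\<close> in \<open>P (y + t e)\<close>, written through
  the symmetric form so that it is visibly a \<open>j\<close>-homogeneous polynomial in
  \<open>e\<close>.\<close>

definition poly_coeff :: "nat \<Rightarrow> ('v \<Rightarrow> 'y) \<Rightarrow> 'v \<Rightarrow> 'v \<Rightarrow> nat \<Rightarrow> 'y" where
  "poly_coeff N P y e j = scale Y (of_nat (N choose j)) (assoc_sym N X Y P (replicate (N - j) y @ replicate j e))"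

lemma poly_coeff_closed:
  assumes "P \<in> polys N X Y" "y \<in> carrier X" "e \<in> carrier X" "j \<le> N"
  shows "poly_coeff N P y e j \<in> carrier Y"
  unfolding poly_coeff_def using assms
  by (intro Y.scale_closed multilinear_closed[OF assoc_sym(1)[OF assms(1)]]) (auto simp: tuples_def)

lemma polys_expand:
  assumes P: "P \<in> polys N X Y" and y: "y \<in> carrier X" and e: "e \<in> carrier X"
  shows "P (y + scale X t e) = (\<Sum>j\<le>N. scale Y (t ^ j) (poly_coeff N P y e j))"
proof -
  note p = assoc_sym[OF P]
  let ?p = "assoc_sym N X Y P"
  have te: "scale X t e \<in> carrier X" using e by simp
  have "P (y + scale X t e) = ?p (replicate N (y + scale X t e) @ [])" using p(4) y te by simp
  also have "\<dots> = (\<Sum>j\<le>N. scale Y (of_nat (N choose j)) (?p (replicate (N - j) y @ replicate j (scale X t e) @ [])))"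
    by (rule symmetric_binomial[OF p(1,3) y te]) auto
  also have "\<dots> = (\<Sum>j\<le>N. scale Y (t ^ j) (poly_coeff N P y e j))"
  proof (intro sum.cong refl)
    fix j assume "j \<in> {..N}"
    then have tup: "replicate (N - j) y @ replicate j e \<in> tuples N X" using y e by (auto simp: tuples_def)
    have "?p (replicate (N - j) y @ replicate j (scale X t e)) =
        scale Y (t ^ j) (?p (replicate (N - j) y @ replicate j e))"
      using multilinear_scale_map[OF p(1) tup, of t] by (simp only: map_replicate length_replicate)
    then show "scale Y (of_nat (N choose j)) (?p (replicate (N - j) y @ replicate j (scale X t e) @ [])) =
        scale Y (t ^ j) (poly_coeff N P y e j)"
      using multilinear_closed[OF p(1) tup] by (simp add: poly_coeff_def Y.scale_scale mult.commute)
  qed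
  finally show ?thesis .
qed

lemma poly_coeff_0:
  assumes "P \<in> polys N X Y" "y \<in> carrier X"
  shows "poly_coeff N P y e 0 = P y"
  using assoc_sym(4)[OF assms] polys_closed[OF assms] by (simp add: poly_coeff_def)

text \<open>For \<open>t\<close> in [0,1] the point \<open>y + t e\<close> has norm at most 2, where
  homogeneity bounds \<open>P\<close> by \<open>2 ^ N * \<epsilon>\<close>;
  \<open>coefficient_bound\<close> does the rest.\<close>

lemma poly_coeff_bound:
  "\<exists>D\<ge>0. \<forall>P\<in>polys N X Y. \<forall>\<epsilon>. (\<forall>x\<in>unit_ball X. nrm Y (P x) \<le> \<epsilon>) \<longrightarrow>
    (\<forall>y\<in>unit_ball X. \<forall>e\<in>unit_ball X. \<forall>j\<le>N. nrm Y (poly_coeff N P y e j) \<le> D * \<epsilon>)"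
proof -
  obtain C where C: "C \<ge> 0" "\<forall>b E. (\<forall>j\<le>N. b j \<in> carrier Y) \<longrightarrow>
     (\<forall>t\<in>{0..1}. nrm Y (\<Sum>j\<le>N. scale Y (of_real (t ^ j)) (b j)) \<le> E) \<longrightarrow>
     (\<forall>j\<le>N. nrm Y (b j) \<le> C * E)" using Y.coefficient_bound by blast
  have "nrm Y (poly_coeff N P y e j) \<le> (C * 2 ^ N) * \<epsilon>"
    if P: "P \<in> polys N X Y" and \<epsilon>: "\<forall>x\<in>unit_ball X. nrm Y (P x) \<le> \<epsilon>"
      and y: "y \<in> unit_ball X" and e: "e \<in> unit_ball X" and j: "j \<le> N" for P \<epsilon> y e j
  proof -
    have yc: "y \<in> carrier X" "e \<in> carrier X" "nrm X y \<le> 1" "nrm X e \<le> 1"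
      using y e by (auto simp: X.unit_ball_iff)
    have "nrm Y (\<Sum>j\<le>N. scale Y (of_real (t ^ j)) (poly_coeff N P y e j)) \<le> 2 ^ N * \<epsilon>" if t: "t \<in> {0..1}" for t
    proof -
      let ?x = "y + scale X (of_real t) e"
      have "t * nrm X e \<le> 1 * 1" using t yc by (intro mult_mono) auto
      then have x: "?x \<in> carrier X" "nrm X ?x \<le> 2"
        using X.nrm_add[OF yc(1) X.scale_closed[OF yc(2)], of "of_real t"] yc t by (auto simp: X.nrm_scale)
      let ?h = "scale X (of_real (1 / 2)) ?x"
      have hb: "?h \<in> unit_ball X" using X.rescale(1)[OF x] by simp
      then have hc: "?h \<in> carrier X" by (simp add: X.unit_ball_iff)
      have "P ?x = scale Y (of_real 2 ^ N) (P ?h)"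
        using X.rescale(2)[OF x] polys_scale[OF P hc, of "of_real 2"] by simp
      then have "nrm Y (P ?x) = 2 ^ N * nrm Y (P ?h)"
        using polys_closed[OF P hc] by (simp add: Y.nrm_scale norm_power)
      also have "\<dots> \<le> 2 ^ N * \<epsilon>" using \<epsilon> hb by (intro mult_left_mono) auto
      finally show ?thesis using polys_expand[OF P yc(1,2), of "of_real t"] by simp
    qed
    then have "nrm Y (poly_coeff N P y e j) \<le> C * (2 ^ N * \<epsilon>)"
      using C(2) poly_coeff_closed[OF P yc(1,2)] j by blast
    then show ?thesis by simp
  qed
  then show ?thesis using C(1) by (intro exI[of _ "C * 2 ^ N"]) auto
qed

end

section \<open>Almost maximal points and perturbations\<close>

text \<open>The product is at most the corresponding power of the largest factor, which is one
  summand on the right.\<close>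

lemma norm_prod_list_le:
  fixes zs :: "'k::real_normed_field list"
  assumes "zs \<noteq> []"
  shows "norm (prod_list zs) \<le> (\<Sum>z\<leftarrow>zs. norm z ^ length zs)"
proof -
  define \<mu> where "\<mu> = Max (norm ` set zs)"
  have \<mu>: "norm z \<le> \<mu>" if "z \<in> set zs" for z unfolding \<mu>_def using that by simp
  have "\<mu> \<in> norm ` set zs" unfolding \<mu>_def using assms by (intro Max_in) auto
  then obtain z where z: "z \<in> set zs" "\<mu> = norm z" by blast
  have "norm (prod_list ys) \<le> \<mu> ^ length ys" if "set ys \<subseteq> set zs" for ys
    using that
  proof (induction ys)
    case (Cons y ys)
    have "norm y * norm (prod_list ys) \<le> \<mu> * \<mu> ^ length ys"
      using Cons \<mu>[of y] by (intro mult_mono) (auto intro: order_trans[OF norm_ge_zero])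
    then show ?case by (simp add: norm_mult)
  qed simp
  then have "norm (prod_list zs) \<le> norm z ^ length zs" using z(2) by blast
  also have "\<dots> \<le> (\<Sum>z\<leftarrow>zs. norm z ^ length zs)"
  proof -
    have mem: "f z \<le> (\<Sum>z\<leftarrow>ys. f z)" if "z \<in> set ys" "\<And>z. f z \<ge> 0" for ys and f :: "'k \<Rightarrow> real"
      using that
    proof (induction ys)
      case (Cons y ys)
      have "(\<Sum>z\<leftarrow>ys. f z) \<ge> 0" using Cons.prems(2) by (intro sum_list_nonneg) auto
      then show ?case using Cons by (auto intro: add_increasing)
    qed simp
    show ?thesis by (rule mem[OF z(1), of "\<lambda>z. norm z ^ length zs"]) simp
  qed
  finally show ?thesis .
qed

lemma sums_sum_list:
  fixes f :: "'i \<Rightarrow> nat \<Rightarrow> 'a::real_normed_vector"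
  shows "(\<And>x. x \<in> set xs \<Longrightarrow> f x sums g x) \<Longrightarrow> (\<lambda>k. \<Sum>x\<leftarrow>xs. f x k) sums (\<Sum>x\<leftarrow>xs. g x)"
  by (induction xs) (auto intro: sums_add)

text \<open>Expand about 1: the errors 1/8, 1/4 and 1/32 leave 19/32. A real inner product treats
  real and complex scalars alike.\<close>

lemma inner_near_one:
  fixes p u :: "'k::{real_normed_field, real_inner}"
  assumes "norm (p - 1) \<le> 1 / 8" "norm (u - 1) \<le> 1 / 4"
  shows "inner p u \<ge> 1 / 2"
proof -
  have "inner p u = inner (1 :: 'k) 1 + inner (p - 1) 1 + inner 1 (u - 1) + inner (p - 1) (u - 1)"
    by (simp add: inner_diff_left inner_diff_right)
  moreover have "inner (1 :: 'k) 1 = 1" by (metis norm_one one_power2 power2_norm_eq_inner)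
  moreover have "\<bar>inner (p - 1) 1\<bar> \<le> 1 / 8" "\<bar>inner 1 (u - 1)\<bar> \<le> 1 / 4"
    using Cauchy_Schwarz_ineq2[of "p - 1" 1] Cauchy_Schwarz_ineq2[of 1 "u - 1"] assms by simp_all
  moreover have "\<bar>inner (p - 1) (u - 1)\<bar> \<le> 1 / 8 * (1 / 4)"
    using Cauchy_Schwarz_ineq2[of "p - 1" "u - 1"] mult_mono[OF assms] by simp
  ultimately show ?thesis by linarith
qed

context weight
begin

definition extremal :: "nat \<Rightarrow> nat \<Rightarrow> 'k::real_normed_field" where
  "extremal n = trunc n (\<lambda>i. of_real (w i))"

lemma extremal_0: "n \<ge> 1 \<Longrightarrow> extremal n 0 = 1"
  by (simp add: extremal_def trunc_def w_0)

lemma extremal_sphere: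
  assumes "n \<ge> 1"
  shows "extremal n \<in> unit_sphere (X :: ('k::real_normed_field, nat \<Rightarrow> 'k) nspace)"
proof -
  have "lorentz_le (\<lambda>i. of_real (w i) :: 'k) 1"
    unfolding lorentz_le_def using sum_w_le_W w_nonneg by simp
  then have l: "lorentz_le (extremal n :: nat \<Rightarrow> 'k) 1" unfolding extremal_def by (rule lorentz_le_trunc)
  have c: "(extremal n :: nat \<Rightarrow> 'k) \<in> carrier X" by (simp add: extremal_def)
  have "1 \<le> nrm X (extremal n :: nat \<Rightarrow> 'k)"
    using lorentz_le_coord[OF lorentz_le_nrm[OF c], of 0] extremal_0[OF assms, where 'a = 'k] by simp
  then show ?thesis using c nrm_X_le_iff[OF c] l by (force simp: unit_sphere_def)
qed

text \<open>The consequences of the property shared by both refutations, with tolerances prescribed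
  in advance: first \<open>\<epsilon>\<close> is taken small enough for both
  \<open>\<epsilon>0\<close> and \<open>\<beta>0\<close>, then \<open>n\<close> so large that
  \<open>extremal n\<close> meets both \<open>e0\<close> and the threshold belonging to
  \<open>\<epsilon>\<close>.\<close>

lemma lindenstrauss_bollobasE:
  fixes Y :: "('k::real_normed_field, 'y::ab_group_add) nspace"
  assumes Y: "normed_space Y" and LB: "lindenstrauss_bollobas N X Y" and Q: "Q \<in> polys N X Y"
    and Q1: "\<And>x. x \<in> unit_ball X \<Longrightarrow> nrm Y (Q x) \<le> 1"
    and Qe: "\<And>e. e > 0 \<Longrightarrow> \<exists>n\<ge>1. nrm Y (Q (extremal n)) > 1 - e"
    and pos: "\<epsilon>0 > 0" "e0 > 0" "\<beta>0 > 0" "\<beta>0 < 1"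
  obtains P n \<delta> n0 where "P \<in> polys N X Y" "n \<ge> 1" "nrm Y (Q (extremal n)) > 1 - e0"
    "\<And>x. x \<in> unit_ball X \<Longrightarrow> nrm Y (P x) \<le> 1"
    "\<And>x. x \<in> unit_ball X \<Longrightarrow> nrm Y (P x - Q x) \<le> \<epsilon>0"
    "\<delta> > 0"
    "\<And>\<eta>. \<eta> > 0 \<Longrightarrow> \<exists>y. y \<in> unit_ball X \<and> (\<exists>m. \<forall>i\<ge>m. y i = 0) \<and> lorentz_le (y - extremal n) \<beta>0 \<and>
      (\<forall>t k. 0 \<le> t \<longrightarrow> t \<le> \<delta> \<longrightarrow> n0 \<le> k \<longrightarrow> y + scale X (of_real t) (unit_seq k) \<in> unit_ball X) \<and>
      nrm Y (P y) > 1 - \<eta>"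
proof -
  interpret X: normed_bidual "X :: ('k, nat \<Rightarrow> 'k) nspace" by (rule normed_bidual_X)
  interpret Y: normed_space Y by (rule Y)
  interpret normed_pair X Y ..
  from LB[unfolded lindenstrauss_bollobas_def] obtain \<eta> \<beta> :: "real \<Rightarrow> real" where
    lb: "(\<forall>\<epsilon>>0. \<eta> \<epsilon> > 0 \<and> \<beta> \<epsilon> > 0) \<and> (\<beta> \<longlongrightarrow> 0) (at_right 0) \<and>
      (\<forall>\<epsilon>>0. \<forall>Q\<in>polys N X Y. \<forall>x\<in>unit_sphere X. poly_norm X Y Q = 1 \<and> nrm Y (Q x) > 1 - \<eta> \<epsilon> \<longrightarrow>
        (\<exists>P\<in>polys N X Y. \<exists>a\<in>unit_sphere (bidual X).
          poly_norm X Y P = 1 \<and> nrm (bidual Y) (aron_berner N X Y P a) = 1 \<and>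
          nrm (bidual X) (a - canon X x) < \<beta> \<epsilon> \<and> poly_norm X Y (\<lambda>u. P u - Q u) < \<epsilon>))"
    by (elim exE)
  have \<eta>\<beta>: "\<And>\<epsilon>. \<epsilon> > 0 \<Longrightarrow> \<eta> \<epsilon> > 0" "(\<beta> \<longlongrightarrow> 0) (at_right 0)" using lb by simp_all
  have "eventually (\<lambda>\<epsilon>. \<beta> \<epsilon> < \<beta>0 \<and> \<epsilon> < \<epsilon>0 \<and> \<epsilon> > 0) (at_right 0)"
    using order_tendstoD(2)[OF \<eta>\<beta>(2) pos(3)] eventually_at_right_real[OF pos(1)]
    by eventually_elim auto
  then obtain \<epsilon> where \<epsilon>: "\<beta> \<epsilon> < \<beta>0" "\<epsilon> < \<epsilon>0" "\<epsilon> > 0"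
    using eventually_happens trivial_limit_at_right_real by blast
  have "min e0 (\<eta> \<epsilon>) > 0" using pos(2) \<eta>\<beta>(1)[OF \<epsilon>(3)] by simp
  from Qe[OF this] obtain n where n: "n \<ge> 1" "nrm Y (Q (extremal n)) > 1 - min e0 (\<eta> \<epsilon>)" by blast
  note sph = extremal_sphere[OF n(1), where 'k = 'k]
  have n\<eta>: "nrm Y (Q (extremal n)) > 1 - \<eta> \<epsilon>" using n(2) by linarith
  have "poly_norm X Y Q = 1"
  proof (rule antisym)
    show "poly_norm X Y Q \<le> 1" unfolding poly_norm_def using Q1 by (intro cSUP_least) auto
    show "1 \<le> poly_norm X Y Q"
    proof (rule field_le_epsilon)
      fix e :: real assume "e > 0"
      then obtain n where n: "n \<ge> 1" "nrm Y (Q (extremal n)) > 1 - e" using Qe by blast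
      have "(extremal n :: nat \<Rightarrow> 'k) \<in> unit_ball X"
        using extremal_sphere[OF n(1), where 'k = 'k] by (simp add: unit_sphere_def X.unit_ball_iff)
      from poly_norm_upper[OF Q this] n(2) show "1 \<le> poly_norm X Y Q + e" by simp
    qed
  qed
  then obtain P a where P: "P \<in> polys N X Y" and a: "a \<in> unit_sphere (bidual X)"
    and P1: "poly_norm X Y P = 1" and Pa: "nrm (bidual Y) (aron_berner N X Y P a) = 1"
    and ax: "nrm (bidual X) (a - canon X (extremal n)) < \<beta> \<epsilon>" and PQ: "poly_norm X Y (\<lambda>u. P u - Q u) < \<epsilon>"
    using lb[THEN conjunct2, THEN conjunct2, rule_format, OF \<epsilon>(3) Q sph] n\<eta> by blast
  have supp: "(extremal n :: nat \<Rightarrow> 'k) i = 0" if "i \<ge> n" for i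
    using that by (simp add: extremal_def trunc_def)
  have ax': "nrm (bidual X) (a - canon X (extremal n)) \<le> \<beta>0" using ax \<epsilon>(1) by simp
  obtain \<delta> n0 where "\<delta> > 0" and
    "\<And>\<eta>. \<eta> > 0 \<Longrightarrow> \<exists>y. y \<in> unit_ball X \<and> (\<exists>m. \<forall>i\<ge>m. y i = 0) \<and> lorentz_le (y - extremal n) \<beta>0 \<and>
      (\<forall>t k. 0 \<le> t \<longrightarrow> t \<le> \<delta> \<longrightarrow> n0 \<le> k \<longrightarrow> y + scale X (of_real t) (unit_seq k) \<in> unit_ball X) \<and>
      nrm Y (P y) > 1 - \<eta>"
    using near_attaining[OF Y P a Pa supp ax' pos(4)] by blast
  moreover have "nrm Y (P x) \<le> 1" if "x \<in> unit_ball X" for x using poly_norm_upper[OF P that] P1 by simp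
  moreover have "nrm Y (P x - Q x) \<le> \<epsilon>0" if "x \<in> unit_ball X" for x
    using poly_norm_upper[OF polys_diff[OF P Q] that] PQ \<epsilon>(2) by simp
  moreover have "nrm Y (Q (extremal n)) > 1 - e0" using n(2) by simp
  ultimately show ?thesis using that[of P n \<delta> n0] P n(1) by blast
qed

text \<open>Freezing \<open>N - j\<close> slots at \<open>y\<close> leaves a form of degree
  \<open>j\<close>, to which \<open>form_unit_seq_null\<close> applies after composition with
  \<open>f\<close>. The limit is only weak: for the inclusion into \<open>ell M\<close> the
  coefficient of degree 1 is the unit vector itself.\<close>

lemma poly_coeff_null:
  fixes Y :: "('k::real_normed_field, 'y::ab_group_add) nspace"
  assumes Y: "normed_space Y" and P: "P \<in> polys N X Y" and y: "y \<in> unit_ball X"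
    and f: "f \<in> carrier (dual Y)" and j: "1 \<le> j" "j \<le> N" "\<not> summable (\<lambda>i. w i ^ j)"
  shows "(\<lambda>k. f (normed_pair.poly_coeff X Y N P y (unit_seq k) j)) \<longlonglongrightarrow> 0"
proof -
  interpret X: normed_bidual "X :: ('k, nat \<Rightarrow> 'k) nspace" by (rule normed_bidual_X)
  interpret Y: normed_bidual Y using Y by (simp add: normed_bidual_def)
  interpret normed_bidual_pair X Y ..
  let ?p = "assoc_sym N X Y P"
  obtain j' where j': "j = Suc j'" using j(1) by (cases j) auto
  let ?us = "replicate (N - j) y"
  note p = XY.assoc_sym[OF P]
  obtain C where C: "C \<ge> 0" "ball_bounded N X Y C ?p" using XY.polys_form[OF P] by blast
  have us: "set ?us \<subseteq> unit_ball X" "set ?us \<subseteq> carrier X" "length ?us + j = N"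
    using y j(2) by (auto simp: X.unit_ball_iff)
  have yc: "y \<in> carrier X" using y by (simp add: X.unit_ball_iff)
  have fm: "X.form N (nrm (dual Y) f * C) (\<lambda>xs. f (?p xs))" by (rule compose_dual[OF p(1) C(2,1) f])
  have "(\<lambda>k. f (?p (?us @ replicate (Suc j') (unit_seq k)))) \<longlonglongrightarrow> 0"
  proof (rule form_unit_seq_null)
    show "multilinear (Suc j') X scalar_space (\<lambda>xs. f (?p (?us @ xs)))"
      using multilinear_append[of ?us "Suc j'" X scalar_space "\<lambda>xs. f (?p xs)"] fm us j' by simp
    show "ball_bounded (Suc j') X scalar_space (nrm (dual Y) f * C) (\<lambda>xs. f (?p (?us @ xs)))"
      using ball_bounded_append[of ?us "Suc j'" X scalar_space _ "\<lambda>xs. f (?p xs)"] fm us j' by simp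
  qed (use j(3) j' in simp)
  then have "(\<lambda>k. of_nat (N choose j) * f (?p (?us @ replicate j (unit_seq k)))) \<longlonglongrightarrow> of_nat (N choose j) * 0"
    unfolding j' by (intro tendsto_mult_left)
  moreover have "f (XY.poly_coeff N P y (unit_seq k) j) = of_nat (N choose j) * f (?p (?us @ replicate j (unit_seq k)))" for k
  proof -
    have "?us @ replicate j (unit_seq k) \<in> tuples N X" using us yc by (auto simp: tuples_def)
    then show ?thesis
      unfolding XY.poly_coeff_def by (rule Y.dual_scale[OF f multilinear_closed[OF p(1)]])
  qed
  ultimately show ?thesis by simp
qed

lemma extremal_power_near_one:
  fixes y :: "nat \<Rightarrow> 'k::real_normed_field"
  assumes "lorentz_le y 1" "n \<ge> 1" "lorentz_le (y - extremal n) \<beta>"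
  shows "norm (y 0 ^ K - 1) \<le> K * \<beta>"
proof -
  have "norm (y 0 ^ K - 1 ^ K) \<le> K * norm (y 0 - 1)"
    using lorentz_le_coord[OF assms(1)] by (intro norm_power_diff) auto
  also have "norm (y 0 - 1) \<le> \<beta>"
    using lorentz_le_coord[OF assms(3), of 0] extremal_0[OF assms(2), where 'a = 'k] by simp
  finally show ?thesis by (simp add: mult_left_mono)
qed

end

text \<open>\<open>Suc m\<close> stands for \<open>M\<close>, so \<open>m\<close> is the largest
  degree for which the coefficients vanish in the limit.\<close>

locale weight_in_ell = weight +
  fixes m :: nat
  assumes summable_w: "summable (\<lambda>i. w i ^ Suc m)"
    and not_summable_w: "1 \<le> j \<Longrightarrow> j \<le> m \<Longrightarrow> \<not> summable (\<lambda>i. w i ^ j)"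
begin

definition S :: real where
  "S = (\<Sum>i. w i ^ Suc m)"

lemma S_ge_1: "S \<ge> 1"
  unfolding S_def using sum_le_suminf[OF summable_w, of "{0}"] w_nonneg by (simp add: w_0)

lemma unit_ball_ell:
  assumes "x \<in> unit_ball X"
  shows "summable (\<lambda>i. norm (x i) ^ Suc m)" "(\<Sum>i. norm (x i) ^ Suc m) \<le> S"
proof -
  have x: "lorentz_le x 1" using assms by (simp add: unit_ball_X_iff)
  have le: "(\<Sum>i<n. norm (x i) ^ Suc m) \<le> S" for n
  proof -
    have "(\<Sum>i<n. norm (x i) ^ Suc m) \<le> (\<Sum>i<n. w i ^ Suc m)" using majorization[OF x, of "{..<n}"] by simp
    also have "\<dots> \<le> S"
      unfolding S_def using w_nonneg by (intro sum_le_suminf[OF summable_w]) auto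
    finally show ?thesis .
  qed
  show s: "summable (\<lambda>i. norm (x i) ^ Suc m)"
    by (rule summableI_nonneg_bounded[OF _ le]) auto
  show "(\<Sum>i. norm (x i) ^ Suc m) \<le> S" by (rule suminf_le_const[OF s le])
qed

lemma X_subset_ell:
  fixes x :: "nat \<Rightarrow> 'k::real_normed_field"
  assumes "x \<in> carrier X"
  shows "x \<in> carrier (ell (Suc m))"
proof -
  interpret X: normed_bidual "X :: ('k, nat \<Rightarrow> 'k) nspace" by (rule normed_bidual_X)
  interpret Y: normed_space "ell (Suc m) :: ('k, nat \<Rightarrow> 'k) nspace" by (rule normed_space_ell) simp
  define r where "r = nrm X x + 1"
  have r: "r > 0" "nrm X x \<le> r" using X.nrm_nonneg[OF assms] by (auto simp: r_def)
  note res = X.rescale[OF assms r(2,1)]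
  have "scale X (of_real (1 / r)) x \<in> carrier (ell (Suc m))"
    unfolding carrier_ell by (rule unit_ball_ell(1)[OF res(1)])
  then have "scale (ell (Suc m)) (of_real r) (scale X (of_real (1 / r)) x) \<in> carrier (ell (Suc m))"
    by (rule Y.scale_closed)
  then show ?thesis using res(2) by (simp only: scale_ell scale_d_lower)
qed

lemma sum_w_tendsto: "(\<lambda>n. \<Sum>i<n. w i ^ Suc m) \<longlonglongrightarrow> S"
  unfolding S_def using summable_LIMSEQ[OF summable_w] .

text \<open>The polar form of the diagonal power sum. By \<open>norm_prod_list_le\<close> the
  products are dominated by sums of \<open>Suc m\<close>-th powers, summable because
  \<open>d_lower w\<close> lies in \<open>ell (Suc m)\<close>. The constant is crude; the sharp
  bound on the diagonal comes from \<open>unit_ball_ell\<close>.\<close>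

lemma product_sum_multilinear:
  fixes c :: "'k::{real_normed_field, banach}"
  shows "multilinear (Suc m) X scalar_space (\<lambda>xs. c * (\<Sum>k. \<Prod>x\<leftarrow>xs. x k))"
    and "ball_bounded (Suc m) X scalar_space (norm c * (Suc m * S)) (\<lambda>xs. c * (\<Sum>k. \<Prod>x\<leftarrow>xs. x k))"
proof -
  interpret X: normed_bidual "X :: ('k, nat \<Rightarrow> 'k) nspace" by (rule normed_bidual_X)
  have dom: "norm (\<Prod>x\<leftarrow>xs. x k) \<le> (\<Sum>x\<leftarrow>xs. norm (x k) ^ Suc m)" if "length xs = Suc m"
    for xs :: "(nat \<Rightarrow> 'k) list" and k
    using norm_prod_list_le[of "map (\<lambda>x. x k) xs"] that by (cases "xs = []") (auto simp: o_def)
  have sums: "(\<lambda>k. \<Sum>x\<leftarrow>xs. norm (x k) ^ Suc m) sums (\<Sum>x\<leftarrow>xs. \<Sum>k. norm (x k) ^ Suc m)"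
    if "set xs \<subseteq> carrier X" for xs :: "(nat \<Rightarrow> 'k) list"
    using X_subset_ell that unfolding carrier_ell by (intro sums_sum_list summable_sums) auto
  have sm: "summable (\<lambda>k. \<Prod>x\<leftarrow>xs. x k)" if "xs \<in> tuples (Suc m) X" for xs :: "(nat \<Rightarrow> 'k) list"
  proof (rule summable_comparison_test'[of "\<lambda>k. \<Sum>x\<leftarrow>xs. norm (x k) ^ Suc m" 0])
    have xs: "length xs = Suc m" "set xs \<subseteq> carrier X" using that by (auto simp: tuples_def)
    show "summable (\<lambda>k. \<Sum>x\<leftarrow>xs. norm (x k) ^ Suc m)" by (rule sums_summable[OF sums[OF xs(2)]])
    show "norm (\<Prod>x\<leftarrow>xs. x k) \<le> (\<Sum>x\<leftarrow>xs. norm (x k) ^ Suc m)" for k by (rule dom[OF xs(1)])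
  qed
  show "multilinear (Suc m) X scalar_space (\<lambda>xs. c * (\<Sum>k. \<Prod>x\<leftarrow>xs. x k))"
  proof (rule multilinearI)
    fix xs ys and u v :: "nat \<Rightarrow> 'k"
    assume t: "xs @ u # ys \<in> tuples (Suc m) X" and v: "v \<in> carrier X"
    then have t': "xs @ v # ys \<in> tuples (Suc m) X" by (auto simp: tuples_def)
    show "c * (\<Sum>k. \<Prod>x\<leftarrow>xs @ (u + v) # ys. x k) =
        c * (\<Sum>k. \<Prod>x\<leftarrow>xs @ u # ys. x k) + c * (\<Sum>k. \<Prod>x\<leftarrow>xs @ v # ys. x k)"
      unfolding distrib_left[symmetric] suminf_add[OF sm[OF t] sm[OF t']]
      by (simp add: distrib_left distrib_right)
  next
    fix xs ys d and u :: "nat \<Rightarrow> 'k" assume t: "xs @ u # ys \<in> tuples (Suc m) X"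
    have "(\<Sum>k. \<Prod>x\<leftarrow>xs @ scale X d u # ys. x k) = (\<Sum>k. d * (\<Prod>x\<leftarrow>xs @ u # ys. x k))"
      by (simp add: scale_d_lower mult_ac)
    then show "c * (\<Sum>k. \<Prod>x\<leftarrow>xs @ scale X d u # ys. x k) =
        scale scalar_space d (c * (\<Sum>k. \<Prod>x\<leftarrow>xs @ u # ys. x k))"
      using suminf_mult[OF sm[OF t], of d] by (simp add: mult.left_commute)
  qed simp
  show "ball_bounded (Suc m) X scalar_space (norm c * (Suc m * S)) (\<lambda>xs. c * (\<Sum>k. \<Prod>x\<leftarrow>xs. x k))"
    unfolding ball_bounded_def
  proof (intro allI impI)
    fix xs :: "(nat \<Rightarrow> 'k) list" assume xs: "length xs = Suc m \<and> set xs \<subseteq> unit_ball X"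
    then have sub: "set xs \<subseteq> carrier X" by (auto simp: X.unit_ball_iff)
    have "norm (\<Sum>k. \<Prod>x\<leftarrow>xs. x k) \<le> (\<Sum>k. \<Sum>x\<leftarrow>xs. norm (x k) ^ Suc m)"
      using xs by (intro norm_suminf_le dom sums_summable[OF sums[OF sub]]) simp
    also have "\<dots> = (\<Sum>x\<leftarrow>xs. \<Sum>k. norm (x k) ^ Suc m)" using sums[OF sub] by (rule sums_unique[symmetric])
    also have "\<dots> \<le> (\<Sum>x\<leftarrow>xs. S)" using unit_ball_ell(2) xs by (intro sum_list_mono) auto
    also have "\<dots> = Suc m * S" using xs by (simp add: sum_list_triv)
    finally show "nrm scalar_space (c * (\<Sum>k. \<Prod>x\<leftarrow>xs. x k)) \<le> norm c * (Suc m * S)"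
      by (simp add: norm_mult mult_left_mono del: of_nat_Suc)
  qed
qed

end

lemma trunc_ell_tendsto:
  assumes "M \<ge> 1" "x \<in> carrier (ell M)"
  shows "(\<lambda>n. nrm (ell M) (trunc n x)) \<longlonglongrightarrow> nrm (ell M) x"
proof -
  have "nrm (ell M) (trunc n x) = root M (\<Sum>i<n. norm (x i) ^ M)" for n
    using nrm_ell_trunc[OF assms(1), of n x] nrm_ell_nonneg[OF trunc_ell[OF assms(1)], of n x] assms(1)
    by (simp add: real_root_power_cancel flip: nrm_ell_trunc[OF assms(1)])
  then show ?thesis
    unfolding nrm_ell using assms(2) by (simp add: carrier_ell tendsto_real_root summable_LIMSEQ)
qed

lemma coordinate_dual_ell:
  assumes "M \<ge> 1"
  shows "(\<lambda>x. if x \<in> carrier (ell M) then x i else 0) \<in> carrier (dual (ell M :: ('k::real_normed_field, nat \<Rightarrow> 'k) nspace))"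
proof -
  interpret Y: normed_space "ell M :: ('k, nat \<Rightarrow> 'k) nspace" by (rule normed_space_ell[OF assms])
  show ?thesis
  proof (rule Y.dualI[where C = 1])
    fix x y :: "nat \<Rightarrow> 'k" assume "x \<in> carrier (ell M)" "y \<in> carrier (ell M)"
    then show "(if x + y \<in> carrier (ell M) then (x + y) i else 0) =
        (if x \<in> carrier (ell M) then x i else 0) + (if y \<in> carrier (ell M) then y i else 0)"
      using Y.add_closed[of x y] by simp
  next
    fix c and x :: "nat \<Rightarrow> 'k" assume "x \<in> carrier (ell M)"
    then show "(if scale (ell M) c x \<in> carrier (ell M) then scale (ell M) c x i else 0) =
        c * (if x \<in> carrier (ell M) then x i else 0)"
      using Y.scale_closed[of x c] by simp (simp add: scale_ell)
  next
    fix x :: "nat \<Rightarrow> 'k" assume "x \<in> unit_ball (ell M)"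
    then show "norm (if x \<in> carrier (ell M) then x i else 0) \<le> 1"
      using nrm_ell_coord[OF assms, of x i] by (auto simp: Y.unit_ball_iff)
  qed simp
qed

section \<open>The two refutations\<close>

context weight_in_ell
begin

text \<open>The value at \<open>y + t e_k\<close> is paired with \<open>u = P y\<close>. The pairing
  is at most 1, but the term added by \<open>Q\<close> has positive inner product with
  \<open>u\<close>, since \<open>u\<close> and \<open>y 0 ^ K\<close> are both near 1.\<close>

lemma not_lindenstrauss_bollobas_scalar:
  assumes N: "N \<ge> Suc m"
  shows "\<not> lindenstrauss_bollobas N
    (X :: ('k::{real_normed_field, real_inner, banach}, nat \<Rightarrow> 'k) nspace) scalar_space"
proof
  assume LB: "lindenstrauss_bollobas N (X :: ('k, nat \<Rightarrow> 'k) nspace) scalar_space"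
  interpret X: normed_bidual "X :: ('k, nat \<Rightarrow> 'k) nspace" by (rule normed_bidual_X)
  define K where "K = N - Suc m"
  have NK: "N = K + Suc m" using N by (simp add: K_def)
  define P0 where "P0 x = of_real (1 / S) * (\<Sum>k. x k ^ Suc m)" for x :: "nat \<Rightarrow> 'k"
  define Q where "Q x = scale scalar_space (coord 0 x ^ K) (P0 x)" for x :: "nat \<Rightarrow> 'k"
  have S: "S > 0" "S \<ge> 1" using S_ge_1 by auto
  have "P0 \<in> polys (Suc m) X scalar_space"
    by (rule X.XS.polysI[OF product_sum_multilinear[of "of_real (1 / S)"]])
       (simp add: P0_def del: replicate_Suc power_Suc)
  then have Q: "Q \<in> polys N X scalar_space"
    unfolding Q_def[abs_def] NK by (rule X.XS.polys_mult_dual_power[OF _ coord_dual])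
  have Qx: "Q x = x 0 ^ K * P0 x" if "x \<in> carrier X" for x using that by (simp add: Q_def coord_def)
  have ball: "x \<in> carrier X" "lorentz_le x 1" if "x \<in> unit_ball X" for x :: "nat \<Rightarrow> 'k"
    using that by (auto simp: unit_ball_X_iff)
  have sx: "summable (\<lambda>k. x k ^ Suc m)" if "x \<in> unit_ball X" for x :: "nat \<Rightarrow> 'k"
    using unit_ball_ell(1)[OF that] by (intro summable_norm_cancel[of "\<lambda>k. x k ^ Suc m"]) (simp only: norm_power)
  have Q1: "norm (Q x) \<le> 1" if x: "x \<in> unit_ball X" for x
  proof -
    have "norm (\<Sum>k. x k ^ Suc m) \<le> (\<Sum>k. norm (x k) ^ Suc m)"
      using unit_ball_ell(1)[OF x] summable_norm[of "\<lambda>k. x k ^ Suc m"] by (simp only: norm_power)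
    also have "\<dots> \<le> S" by (rule unit_ball_ell(2)[OF x])
    finally have "norm (P0 x) \<le> 1"
      unfolding P0_def norm_mult norm_of_real using S by (simp add: field_simps del: power_Suc)
    moreover have "norm (x 0 ^ K) \<le> 1"
      unfolding norm_power using lorentz_le_coord[OF ball(2)[OF x]] by (intro power_le_one) auto
    ultimately show ?thesis unfolding Qx[OF ball(1)[OF x]] norm_mult by (intro mult_le_one) auto
  qed
  have Qext: "Q (extremal n) = of_real ((\<Sum>i<n. w i ^ Suc m) / S)" if n: "n \<ge> 1" for n
  proof -
    have "(\<Sum>k. (extremal n k :: 'k) ^ Suc m) = (\<Sum>k<n. extremal n k ^ Suc m)"
      by (rule suminf_finite) (auto simp: extremal_def trunc_def)
    also have "\<dots> = of_real (\<Sum>i<n. w i ^ Suc m)" by (simp add: extremal_def trunc_def)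
    finally have "P0 (extremal n) = of_real (1 / S) * of_real (\<Sum>i<n. w i ^ Suc m)" by (simp only: P0_def)
    moreover have "(extremal n :: nat \<Rightarrow> 'k) \<in> carrier X" by (simp add: extremal_def)
    ultimately show ?thesis using extremal_0[OF n, where 'a = 'k] by (simp add: Qx del: power_Suc)
  qed
  have Qlim: "\<exists>n\<ge>1. nrm scalar_space (Q (extremal n)) > 1 - e" if e: "e > 0" for e
  proof -
    have "(\<lambda>n. (\<Sum>i<n. w i ^ Suc m) / S) \<longlonglongrightarrow> S / S" by (intro tendsto_divide sum_w_tendsto tendsto_const) (use S in auto)
    then have "eventually (\<lambda>n. (\<Sum>i<n. w i ^ Suc m) / S > 1 - e) sequentially"
      using S e by (intro order_tendstoD(1)) auto
    then obtain n where n: "n \<ge> 1" "(\<Sum>i<n. w i ^ Suc m) / S > 1 - e"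
      unfolding eventually_sequentially by (meson nat_le_linear)
    have "norm (Q (extremal n)) \<ge> (\<Sum>i<n. w i ^ Suc m) / S"
      unfolding Qext[OF n(1)] norm_of_real by (rule abs_ge_self)
    then show ?thesis using n by (intro exI[of _ n]) simp
  qed
  obtain CQ where CQ: "CQ \<ge> 0" "\<And>x y d. x \<in> unit_ball X \<Longrightarrow> y \<in> unit_ball X \<Longrightarrow> d > 0 \<Longrightarrow>
      nrm X (y - x) \<le> d \<Longrightarrow> norm (Q y - Q x) \<le> CQ * d"
    using X.XS.polys_lipschitz[OF Q] by auto
  obtain D where D: "D \<ge> 0" "\<And>P \<epsilon> y e j. P \<in> polys N X scalar_space \<Longrightarrow>
      (\<And>x. x \<in> unit_ball X \<Longrightarrow> norm (P x) \<le> \<epsilon>) \<Longrightarrow> y \<in> unit_ball X \<Longrightarrow> e \<in> unit_ball X \<Longrightarrow> j \<le> N \<Longrightarrow>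
      norm (X.XS.poly_coeff N P y e j) \<le> D * \<epsilon>"
    using X.XS.poly_coeff_bound[of N] by auto
  \<comment> \<open>The first bound serves the distance of \<open>u\<close> from 1; the second keeps
    all terms of degree above \<open>m\<close> together below
    \<open>\<tau> / (8 * S)\<close>.\<close>
  define \<epsilon>0 where "\<epsilon>0 = min (1 / 12) (1 / (8 * S * (N * D + 1)))"
  \<comment> \<open>The three summands ensure \<open>\<beta>0 < 1\<close>,
    \<open>K * \<beta>0 \<le> 1 / 8\<close> and \<open>CQ * \<beta>0 \<le> 1 / 12\<close>.\<close>
  define \<beta>0 where "\<beta>0 = 1 / (2 + 8 * K + 12 * CQ)"
  have ND: "N * D \<ge> 0" using D(1) by simp
  have \<epsilon>0: "\<epsilon>0 > 0" "\<epsilon>0 \<le> 1 / 12" "N * D * \<epsilon>0 \<le> 1 / (8 * S)"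
  proof -
    have p: "8 * S * (N * D + 1) > 0" using S ND by (intro mult_pos_pos) auto
    show "\<epsilon>0 > 0" "\<epsilon>0 \<le> 1 / 12" using p by (auto simp: \<epsilon>0_def)
    have "N * D * \<epsilon>0 \<le> N * D * (1 / (8 * S * (N * D + 1)))"
      using ND by (intro mult_left_mono) (auto simp: \<epsilon>0_def)
    also have "\<dots> = (N * D / (N * D + 1)) * (1 / (8 * S))" by simp
    also have "\<dots> \<le> 1 * (1 / (8 * S))" using S ND by (intro mult_right_mono) auto
    finally show "N * D * \<epsilon>0 \<le> 1 / (8 * S)" by simp
  qed
  have \<beta>0: "\<beta>0 > 0" "\<beta>0 < 1" "K * \<beta>0 \<le> 1 / 8" "CQ * \<beta>0 \<le> 1 / 12"
    using CQ(1) by (auto simp: \<beta>0_def field_simps add_nonneg_pos)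
  obtain P n \<delta> n0 where P: "P \<in> polys N X scalar_space" and n: "n \<ge> 1"
    and Qn: "norm (Q (extremal n)) > 1 - 1 / 12"
    and P1: "\<And>x. x \<in> unit_ball X \<Longrightarrow> norm (P x) \<le> 1"
    and PQ: "\<And>x. x \<in> unit_ball X \<Longrightarrow> norm (P x - Q x) \<le> \<epsilon>0"
    and \<delta>: "\<delta> > 0"
    and near: "\<And>\<eta>. \<eta> > 0 \<Longrightarrow> \<exists>y. y \<in> unit_ball X \<and> (\<exists>m. \<forall>i\<ge>m. y i = 0) \<and> lorentz_le (y - extremal n) \<beta>0 \<and>
      (\<forall>t k. 0 \<le> t \<longrightarrow> t \<le> \<delta> \<longrightarrow> n0 \<le> k \<longrightarrow> y + scale X (of_real t) (unit_seq k) \<in> unit_ball X) \<and>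
      norm (P y) > 1 - \<eta>"
    by (rule lindenstrauss_bollobasE[OF normed_space_scalar LB Q _ Qlim \<epsilon>0(1), of "1 / 12" \<beta>0])
       (use Q1 \<beta>0 in auto)
  define R where "R x = P x - Q x" for x
  have R: "R \<in> polys N X scalar_space" unfolding R_def by (rule X.XS.polys_diff[OF P Q])
  \<comment> \<open>The step is fixed before \<open>\<eta>\<close>; being at most 1, it satisfies
    \<open>t ^ j \<le> \<tau>\<close> for all degrees \<open>j\<close> above
    \<open>m\<close>.\<close>
  define t where "t = min \<delta> 1"
  have t: "0 < t" "t \<le> 1" "t \<le> \<delta>" using \<delta> by (auto simp: t_def)
  define \<tau> where "\<tau> = t ^ Suc m"
  have \<tau>: "\<tau> > 0" using t by (simp add: \<tau>_def)
  \<comment> \<open>The loss \<open>2 * \<eta>\<close> then equals \<open>\<tau> / (8 * S)\<close>,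
    a quarter of the guaranteed gain \<open>\<tau> / (2 * S)\<close>.\<close>
  define \<eta> where "\<eta> = \<tau> / (16 * S)"
  have \<eta>: "\<eta> > 0" using \<tau> S by (simp add: \<eta>_def)
  obtain y m0 where y: "y \<in> unit_ball X" "\<And>i. i \<ge> m0 \<Longrightarrow> y i = 0" "lorentz_le (y - extremal n) \<beta>0"
    "\<And>t k. 0 \<le> t \<Longrightarrow> t \<le> \<delta> \<Longrightarrow> n0 \<le> k \<Longrightarrow> y + scale X (of_real t) (unit_seq k) \<in> unit_ball X"
    "norm (P y) > 1 - \<eta>" using near[OF \<eta>] by blast
  note yc = ball[OF y(1)]
  define u where "u = P y"
  define p where "p = y 0 ^ K"
  define b where "b k j = X.XS.poly_coeff N R y (unit_seq k) j" for k j
  have ext: "(extremal n :: nat \<Rightarrow> 'k) \<in> unit_ball X"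
    using extremal_sphere[OF n, where 'k = 'k] by (simp add: unit_sphere_def X.unit_ball_iff)
  have "norm (p - 1) \<le> 1 / 8"
    using extremal_power_near_one[OF yc(2) n y(3), of K] \<beta>0(3) by (simp add: p_def)
  \<comment> \<open>Three errors of 1/12: from \<open>P\<close> to \<open>Q\<close>, from
    \<open>y\<close> to \<open>extremal n\<close>, and from the value there to 1.\<close>
  moreover have "norm (u - 1) \<le> 1 / 4"
  proof -
    have "y - extremal n \<in> carrier X" using yc(1) ext by (simp add: X.unit_ball_iff)
    then have "norm (Q y - Q (extremal n)) \<le> CQ * \<beta>0"
      using nrm_X_le_iff y(3) by (intro CQ(2)[OF ext y(1) \<beta>0(1)]) blast
    moreover have "norm (u - Q y) \<le> \<epsilon>0" unfolding u_def by (rule PQ[OF y(1)])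
    moreover have "norm (Q (extremal n) - 1) \<le> 1 / 12"
    proof -
      define q where "q = (\<Sum>i<n. w i ^ Suc m) / S"
      have q: "Q (extremal n) = of_real q" "q \<ge> 0"
        unfolding q_def using Qext[OF n] w_nonneg S by (auto intro!: divide_nonneg_nonneg sum_nonneg)
      then have "q > 1 - 1 / 12" "q \<le> 1" using Qn Q1[OF ext] by auto
      then have "norm (of_real (q - 1) :: 'k) \<le> 1 / 12" unfolding norm_of_real by auto
      then show ?thesis by (simp add: q(1))
    qed
    moreover have "u - 1 = (u - Q y) + (Q y - Q (extremal n)) + (Q (extremal n) - 1)" by simp
    ultimately show ?thesis
      using norm_triangle_ineq[of "(u - Q y) + (Q y - Q (extremal n))" "Q (extremal n) - 1"]
        norm_triangle_ineq[of "u - Q y" "Q y - Q (extremal n)"] \<beta>0(4) \<epsilon>0(2) by simp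
  qed
  ultimately have pu: "inner p u \<ge> 1 / 2" by (rule inner_near_one)
  have u1: "norm u \<le> 1" "norm u > 1 - \<eta>" using P1[OF y(1)] y(5) by (auto simp: u_def)
  have main: "\<tau> / (2 * S) \<le> 2 * \<eta> + (\<Sum>j\<in>{1..m}. norm (b k j)) + \<tau> / (8 * S)"
    if k: "k \<ge> n0" "k \<ge> m0" "k \<ge> 1" for k
  proof -
    let ?x = "y + scale X (of_real t) (unit_seq k)"
    have x: "?x \<in> unit_ball X" using y(4)[OF _ t(3) k(1)] t(1) by simp
    note xc = ball[OF x]
    have eb: "(unit_seq k :: nat \<Rightarrow> 'k) \<in> unit_ball X" using lorentz_le_unit_seq by (simp add: unit_ball_X_iff)
    have bb: "norm (b k j) \<le> D * \<epsilon>0" if "j \<le> N" for j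
      unfolding b_def using PQ by (intro D(2)[OF R _ y(1) eb that]) (simp add: R_def)
    \<comment> \<open>Since \<open>y k = 0\<close> and \<open>k\<close> is not 0, the increment
      leaves the factor \<open>y 0 ^ K\<close> alone and adds a single new power to the sum.\<close>
    have "Q ?x = Q y + of_real (\<tau> / S) * p"
    proof -
      have "?x i ^ Suc m = y i ^ Suc m + (if i = k then of_real \<tau> else 0)" for i
        using y(2)[OF k(2)] by (auto simp: scale_d_lower unit_seq_def \<tau>_def)
      then have "(\<Sum>i. ?x i ^ Suc m) = (\<Sum>i. y i ^ Suc m + (if i = k then of_real \<tau> else 0))" by simp
      also have "\<dots> = (\<Sum>i. y i ^ Suc m) + of_real \<tau>"
        using sums_add[OF summable_sums[OF sx[OF y(1)]] sums_single[of k "\<lambda>_. of_real \<tau>"]]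
        by (rule sums_unique[symmetric])
      finally have "P0 ?x = P0 y + of_real (1 / S) * of_real \<tau>"
        unfolding P0_def by (simp only: distrib_left)
      moreover have "?x 0 = y 0" using k(3) by (simp add: scale_d_lower unit_seq_def)
      ultimately show ?thesis
        unfolding Qx[OF xc(1)] Qx[OF yc(1)] p_def by (simp add: algebra_simps)
    qed
    moreover have "R ?x = R y + (\<Sum>j\<in>{1..N}. of_real (t ^ j) * b k j)"
    proof -
      have "R ?x = (\<Sum>j\<le>N. of_real t ^ j * b k j)"
        using X.XS.polys_expand[OF R yc(1) unit_seq_mem, of "of_real t" k] by (simp add: b_def)
      also have "{..N} = insert 0 {1..N}" by auto
      also have "(\<Sum>j\<in>insert 0 {1..N}. of_real t ^ j * b k j) = R y + (\<Sum>j\<in>{1..N}. of_real (t ^ j) * b k j)"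
        using X.XS.poly_coeff_0[OF R yc(1)] by (simp add: b_def)
      finally show ?thesis .
    qed
    ultimately have Px: "P ?x = u + of_real (\<tau> / S) * p + (\<Sum>j\<in>{1..N}. of_real (t ^ j) * b k j)"
      unfolding R_def u_def by (simp add: algebra_simps)
    have "inner (P ?x) u \<le> norm (P ?x) * norm u" by (rule norm_cauchy_schwarz)
    also have "\<dots> \<le> 1" using P1[OF x] u1 by (intro mult_le_one) auto
    finally have "inner (P ?x) u \<le> 1" .
    moreover have "inner (P ?x) u = (norm u)\<^sup>2 + \<tau> / S * inner p u + (\<Sum>j\<in>{1..N}. t ^ j * inner (b k j) u)"
    proof -
      have "inner (of_real r * z) u = r * inner z u" for r and z :: 'k
        by (simp flip: scaleR_conv_of_real)
      then show ?thesis unfolding Px by (simp only: inner_add_left inner_sum_left power2_norm_eq_inner)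
    qed
    moreover have "(norm u)\<^sup>2 \<ge> 1 - 2 * \<eta>"
    proof -
      have "0 \<le> (1 - norm u)\<^sup>2" by simp
      then show ?thesis using u1 by (simp add: power2_eq_square algebra_simps)
    qed
    moreover have "\<tau> / S * inner p u \<ge> \<tau> / S * (1 / 2)" using pu \<tau> S by (intro mult_left_mono) auto
    \<comment> \<open>Low degrees are kept as coefficients that vanish as \<open>k\<close> grows;
      high degrees are paid for by \<open>t ^ j \<le> \<tau>\<close> and the smallness of
      \<open>P - Q\<close>.\<close>
    moreover have "(\<Sum>j\<in>{1..N}. t ^ j * inner (b k j) u) \<ge>
        - ((\<Sum>j\<in>{1..m}. norm (b k j)) + N * (\<tau> * (D * \<epsilon>0)))"
    proof -
      have in_le: "\<bar>inner (b k j) u\<bar> \<le> norm (b k j)" for j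
        using Cauchy_Schwarz_ineq2[of "b k j" u] mult_left_mono[OF u1(1), of "norm (b k j)"] by simp
      have "- (t ^ j * inner (b k j) u) \<le> (if j \<le> m then norm (b k j) else 0) + \<tau> * (D * \<epsilon>0)"
        if j: "j \<in> {1..N}" for j
      proof -
        have "- (t ^ j * inner (b k j) u) \<le> t ^ j * norm (b k j)"
          using mult_left_mono[of "- inner (b k j) u" "norm (b k j)" "t ^ j"] in_le[of j] t by simp
        also have "\<dots> \<le> (if j \<le> m then norm (b k j) else 0) + \<tau> * (D * \<epsilon>0)"
        proof (cases "j \<le> m")
          case True
          have "t ^ j * norm (b k j) \<le> 1 * norm (b k j)" using t by (intro mult_right_mono power_le_one) auto
          then show ?thesis using True \<tau> D(1) \<epsilon>0(1) by (simp add: add_increasing2)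
        next
          case False
          have "t ^ j \<le> \<tau>" unfolding \<tau>_def using False t by (intro power_decreasing) auto
          then show ?thesis using False bb[of j] j \<tau> by (simp add: mult_mono)
        qed
        finally show ?thesis .
      qed
      then have "(\<Sum>j\<in>{1..N}. - (t ^ j * inner (b k j) u)) \<le>
          (\<Sum>j\<in>{1..N}. (if j \<le> m then norm (b k j) else 0) + \<tau> * (D * \<epsilon>0))" by (rule sum_mono)
      also have "\<dots> = (\<Sum>j\<in>{1..m}. norm (b k j)) + N * (\<tau> * (D * \<epsilon>0))"
      proof -
        have "(\<Sum>j\<in>{1..N}. if j \<le> m then norm (b k j) else 0) = (\<Sum>j\<in>{j \<in> {1..N}. j \<le> m}. norm (b k j))"
          by (rule sum.inter_filter[symmetric]) simp
        moreover have "{j \<in> {1..N}. j \<le> m} = {1..m}" using N by auto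
        ultimately show ?thesis by (simp add: sum.distrib)
      qed
      finally show ?thesis by (simp add: sum_negf)
    qed
    moreover have "N * (\<tau> * (D * \<epsilon>0)) \<le> \<tau> / (8 * S)"
      using mult_left_mono[OF \<epsilon>0(3), of \<tau>] \<tau> by (simp add: mult_ac)
    ultimately show ?thesis by (simp add: field_simps)
  qed
  have "(\<lambda>k. 2 * \<eta> + (\<Sum>j\<in>{1..m}. norm (b k j)) + \<tau> / (8 * S)) \<longlonglongrightarrow> 2 * \<eta> + (\<Sum>j\<in>{1..m}. 0) + \<tau> / (8 * S)"
  proof (intro tendsto_add tendsto_const tendsto_sum)
    fix j assume j: "j \<in> {1..m}"
    have "(\<lambda>x::'k. x) \<in> carrier (dual scalar_space)"
      by (rule X.S.dualI[where C = 1]) (auto simp: X.S.unit_ball_iff)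
    from poly_coeff_null[OF normed_space_scalar R y(1) this, of j] show "(\<lambda>k. norm (b k j)) \<longlonglongrightarrow> 0"
      using j N not_summable_w[of j] unfolding b_def by (intro tendsto_norm_zero) auto
  qed
  moreover have "eventually (\<lambda>k. \<tau> / (2 * S) \<le> 2 * \<eta> + (\<Sum>j\<in>{1..m}. norm (b k j)) + \<tau> / (8 * S)) sequentially"
    using eventually_ge_at_top[of "max (max n0 m0) 1"] by eventually_elim (use main in auto)
  \<comment> \<open>The right side is only \<open>\<tau> / (4 * S)\<close>.\<close>
  ultimately have "\<tau> / (2 * S) \<le> 2 * \<eta> + (\<Sum>j\<in>{1..m}. 0) + \<tau> / (8 * S)"
    by (intro tendsto_lowerbound[where F = sequentially]) auto
  then show False using \<tau> S by (simp add: \<eta>_def field_simps)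
qed

text \<open>The norm of the perturbed value is bounded below on two disjoint sets: the first
  \<open>m1\<close> coordinates, which carry almost all of \<open>P y\<close>, and coordinate
  \<open>k\<close>, where \<open>Q\<close> adds a term of size comparable to \<open>t\<close>. Their
  \<open>M\<close>-th powers add up to more than 1.\<close>

lemma not_lindenstrauss_bollobas_ell:
  assumes N: "N \<ge> 1" and m: "m \<ge> 1"
  shows "\<not> lindenstrauss_bollobas N
    (X :: ('k::real_normed_field, nat \<Rightarrow> 'k) nspace) (ell (Suc m))"
proof
  let ?Y = "ell (Suc m) :: ('k, nat \<Rightarrow> 'k) nspace"
  let ?n = "nrm ?Y"
  assume LB: "lindenstrauss_bollobas N (X :: ('k, nat \<Rightarrow> 'k) nspace) ?Y"
  interpret X: normed_bidual "X :: ('k, nat \<Rightarrow> 'k) nspace" by (rule normed_bidual_X)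
  have Ysp: "normed_space ?Y" by (rule normed_space_ell) simp
  interpret Y: normed_bidual ?Y using Ysp by (simp add: normed_bidual_def)
  interpret XY: normed_pair "X :: ('k, nat \<Rightarrow> 'k) nspace" ?Y ..
  define K where "K = N - 1"
  have NK: "N = K + 1" using N by (simp add: K_def)
  \<comment> \<open>The norm of the inclusion of \<open>d_lower w\<close> into
    \<open>ell (Suc m)\<close>, approached along \<open>extremal n\<close>; \<open>c\<close>
    normalises it to 1.\<close>
  define r where "r = root (Suc m) S"
  have r: "r > 0" "r \<ge> 1" "r ^ Suc m = S"
    using S_ge_1 by (auto simp: r_def real_root_ge_1_iff real_root_gt_zero simp del: power_Suc)
  define c where "c = 1 / r"
  have c: "c > 0" "c \<le> 1" using r by (auto simp: c_def)
  define P0 where "P0 x = scale ?Y (of_real c) x" for x :: "nat \<Rightarrow> 'k"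
  define Q where "Q x = scale ?Y (coord 0 x ^ K) (P0 x)" for x :: "nat \<Rightarrow> 'k"
  have ball: "x \<in> carrier X" "lorentz_le x 1" if "x \<in> unit_ball X" for x :: "nat \<Rightarrow> 'k"
    using that by (auto simp: unit_ball_X_iff)
  have P0c: "P0 x \<in> carrier ?Y" if "x \<in> carrier X" for x
    unfolding P0_def by (rule Y.scale_closed[OF X_subset_ell[OF that]])
  have P01: "?n (P0 x) \<le> 1" if x: "x \<in> unit_ball X" for x
  proof -
    have xe: "x \<in> carrier ?Y" by (rule X_subset_ell[OF ball(1)[OF x]])
    have "?n x \<le> r" using unit_ball_ell(2)[OF x] r by (intro nrm_ell_leI[OF xe]) auto
    then show ?thesis using xe r(1) c(1) by (simp add: P0_def Y.nrm_scale c_def norm_divide)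
  qed
  have "P0 \<in> polys (Suc 0) X ?Y"
  proof (rule XY.polysI)
    show "multilinear (Suc 0) X ?Y (\<lambda>xs. P0 (hd xs))"
    proof (rule multilinear_one)
      show "P0 x \<in> carrier ?Y" if "x \<in> carrier X" for x by (rule P0c[OF that])
    qed (auto simp: P0_def scale_ell scale_d_lower distrib_left mult.left_commute)
    show "ball_bounded (Suc 0) X ?Y 1 (\<lambda>xs. P0 (hd xs))"
      using P01 by (auto simp: ball_bounded_def length_Suc_conv)
  qed simp
  then have "Q \<in> polys (K + Suc 0) X ?Y"
    unfolding Q_def[abs_def] by (rule XY.polys_mult_dual_power[OF _ coord_dual])
  then have Q: "Q \<in> polys N X ?Y" by (simp add: NK)
  have Qx: "Q x = (\<lambda>i. x 0 ^ K * (of_real c * x i))" if "x \<in> carrier X" for x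
    using that by (simp add: Q_def coord_def P0_def scale_ell)
  have Q1: "?n (Q x) \<le> 1" if x: "x \<in> unit_ball X" for x
  proof -
    have "norm (coord 0 x ^ K) \<le> 1"
      unfolding norm_power using lorentz_le_coord[OF ball(2)[OF x]] ball(1)[OF x]
      by (intro power_le_one) (auto simp: coord_def)
    then show ?thesis
      using P0c[OF ball(1)[OF x]] P01[OF x] unfolding Q_def by (simp add: Y.nrm_scale mult_le_one)
  qed
  have Qlim: "\<exists>n\<ge>1. ?n (Q (extremal n)) > 1 - e" if e: "e > 0" for e
  proof -
    have Qn: "?n (Q (extremal n)) = c * root (Suc m) (\<Sum>i<n. w i ^ Suc m)" if n: "n \<ge> 1" for n
    proof -
      have ec: "(extremal n :: nat \<Rightarrow> 'k) \<in> carrier X" by (simp add: extremal_def)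
      have "Q (extremal n) = scale ?Y (of_real c) (extremal n)"
        unfolding Qx[OF ec] using extremal_0[OF n, where 'a = 'k] by (simp add: scale_ell)
      moreover have "?n (extremal n) = root (Suc m) (\<Sum>i<n. w i ^ Suc m)"
      proof -
        have "(\<Sum>i. norm (extremal n i :: 'k) ^ Suc m) = (\<Sum>i<n. norm (extremal n i :: 'k) ^ Suc m)"
          by (rule suminf_finite) (auto simp: extremal_def trunc_def)
        also have "\<dots> = (\<Sum>i<n. w i ^ Suc m)" using w_nonneg by (simp add: extremal_def trunc_def)
        finally show ?thesis by (simp only: nrm_ell)
      qed
      ultimately show ?thesis using c X_subset_ell[OF ec] by (simp add: Y.nrm_scale)
    qed
    have "(\<lambda>n. c * root (Suc m) (\<Sum>i<n. w i ^ Suc m)) \<longlonglongrightarrow> c * root (Suc m) S"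
      by (intro tendsto_mult_left tendsto_real_root sum_w_tendsto)
    then have "eventually (\<lambda>n. c * root (Suc m) (\<Sum>i<n. w i ^ Suc m) > 1 - e) sequentially"
      using r e by (intro order_tendstoD(1)) (auto simp: c_def r_def[symmetric])
    then obtain n where n: "n \<ge> 1" "c * root (Suc m) (\<Sum>i<n. w i ^ Suc m) > 1 - e"
      unfolding eventually_sequentially by (meson nat_le_linear)
    then show ?thesis using Qn[OF n(1)] by (intro exI[of _ n]) simp
  qed
  obtain D where D: "D \<ge> 0" "\<And>P \<epsilon> y e j. P \<in> polys N X ?Y \<Longrightarrow>
      (\<And>x. x \<in> unit_ball X \<Longrightarrow> ?n (P x) \<le> \<epsilon>) \<Longrightarrow> y \<in> unit_ball X \<Longrightarrow> e \<in> unit_ball X \<Longrightarrow> j \<le> N \<Longrightarrow>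
      ?n (XY.poly_coeff N P y e j) \<le> D * \<epsilon>"
    using XY.poly_coeff_bound[of N] by blast
  \<comment> \<open>Coordinate \<open>k\<close> retains about \<open>t * c / 4\<close>, whose
    \<open>M\<close>-th power is \<open>\<tau> * h\<close>.\<close>
  define h where "h = (c / 4) ^ Suc m"
  have h: "h > 0" "h \<le> c / 4"
  proof -
    show "h > 0" using c by (simp add: h_def)
    have "h \<le> (c / 4) ^ 1" unfolding h_def using c by (intro power_decreasing) auto
    then show "h \<le> c / 4" by simp
  qed
  \<comment> \<open>The factor \<open>Suc m\<close> anticipates Bernoulli's inequality, which
    multiplies the loss in norm by \<open>M\<close>.\<close>
  define \<epsilon>0 where "\<epsilon>0 = h / (4 * real (Suc m) * (N * D + 1))"
  define \<beta>0 where "\<beta>0 = 1 / (2 + 8 * real K)"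
  have ND: "N * D \<ge> 0" using D(1) by simp
  have \<epsilon>0: "\<epsilon>0 > 0" "N * D * \<epsilon>0 \<le> h / (4 * real (Suc m))"
  proof -
    have p: "4 * real (Suc m) * (N * D + 1) > 0" using ND by (intro mult_pos_pos) auto
    show "\<epsilon>0 > 0" unfolding \<epsilon>0_def using p h(1) by (rule divide_pos_pos[rotated])
    have "N * D * \<epsilon>0 = (N * D / (N * D + 1)) * (h / (4 * real (Suc m)))" by (simp add: \<epsilon>0_def)
    also have "\<dots> \<le> 1 * (h / (4 * real (Suc m)))" using h ND by (intro mult_right_mono) auto
    finally show "N * D * \<epsilon>0 \<le> h / (4 * real (Suc m))" by simp
  qed
  have \<epsilon>0c: "N * D * \<epsilon>0 \<le> c / 4"
  proof -
    have "h / (4 * real (Suc m)) \<le> h / 1" using h by (intro divide_left_mono) auto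
    then show ?thesis using \<epsilon>0(2) h(2) by simp
  qed
  have \<beta>0: "\<beta>0 > 0" "\<beta>0 < 1" "K * \<beta>0 \<le> 1 / 8"
    by (auto simp: \<beta>0_def field_simps add_nonneg_pos)
  obtain P n \<delta> n0 where P: "P \<in> polys N X ?Y" and n: "n \<ge> 1"
    and P1: "\<And>x. x \<in> unit_ball X \<Longrightarrow> ?n (P x) \<le> 1"
    and PQ: "\<And>x. x \<in> unit_ball X \<Longrightarrow> ?n (P x - Q x) \<le> \<epsilon>0"
    and \<delta>: "\<delta> > 0"
    and near: "\<And>\<eta>. \<eta> > 0 \<Longrightarrow> \<exists>y. y \<in> unit_ball X \<and> (\<exists>m. \<forall>i\<ge>m. y i = 0) \<and> lorentz_le (y - extremal n) \<beta>0 \<and>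
      (\<forall>t k. 0 \<le> t \<longrightarrow> t \<le> \<delta> \<longrightarrow> n0 \<le> k \<longrightarrow> y + scale X (of_real t) (unit_seq k) \<in> unit_ball X) \<and>
      ?n (P y) > 1 - \<eta>"
    by (rule lindenstrauss_bollobasE[OF Ysp LB Q _ _ \<epsilon>0(1) zero_less_one \<beta>0(1,2)])
       (rule Q1, assumption, rule Qlim, assumption, (rule that; assumption))
  define R where "R x = P x - Q x" for x
  have R: "R \<in> polys N X ?Y" unfolding R_def by (rule XY.polys_diff[OF P Q])
  define t where "t = min \<delta> 1"
  have t: "0 < t" "t \<le> 1" "t \<le> \<delta>" using \<delta> by (auto simp: t_def)
  define \<tau> where "\<tau> = t ^ Suc m"
  have \<tau>: "\<tau> > 0" using t by (simp add: \<tau>_def)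
  \<comment> \<open>After Bernoulli the loss \<open>2 * \<eta>\<close> becomes
    \<open>\<tau> * h / 8\<close>.\<close>
  define \<eta> where "\<eta> = \<tau> * h / (16 * real (Suc m))"
  have \<eta>: "\<eta> > 0" using \<tau> h by (simp add: \<eta>_def)
  obtain y m0 where y: "y \<in> unit_ball X" "\<And>i. i \<ge> m0 \<Longrightarrow> y i = 0" "lorentz_le (y - extremal n) \<beta>0"
    "\<And>t k. 0 \<le> t \<Longrightarrow> t \<le> \<delta> \<Longrightarrow> n0 \<le> k \<Longrightarrow> y + scale X (of_real t) (unit_seq k) \<in> unit_ball X"
    "?n (P y) > 1 - \<eta>" using near[OF \<eta>] by blast
  note yc = ball[OF y(1)]
  define u where "u = P y"
  define p where "p = y 0 ^ K"
  define b where "b k j = XY.poly_coeff N R y (unit_seq k) j" for k j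
  have uc: "u \<in> carrier ?Y" unfolding u_def by (rule XY.polys_closed[OF P yc(1)])
  have p_half: "norm p \<ge> 1 / 2"
    using extremal_power_near_one[OF yc(2) n y(3), of K] \<beta>0(3) norm_triangle_ineq2[of 1 "1 - p"]
    by (simp add: p_def norm_minus_commute)
  obtain m1 where m1: "?n (trunc m1 u) > 1 - 2 * \<eta>"
  proof -
    have "eventually (\<lambda>i. ?n (trunc i u) > 1 - 2 * \<eta>) sequentially"
      using y(5) \<eta> by (intro order_tendstoD(1)[OF trunc_ell_tendsto[OF _ uc]]) (auto simp: u_def)
    then show ?thesis using that eventually_happens[of _ sequentially] by auto
  qed
  \<comment> \<open>The low degrees, null only coordinatewise as \<open>k\<close> grows; therefore
    they are measured on \<open>m1\<close> coordinates, by \<open>o1\<close>. The minimum covers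
    \<open>N\<close> below \<open>M\<close>.\<close>
  define B1 where "B1 k = (\<Sum>j\<in>{1..min m N}. scale ?Y (of_real (t ^ j)) (b k j))" for k
  define B2 where "B2 k = (\<Sum>j\<in>{Suc m..N}. scale ?Y (of_real (t ^ j)) (b k j))" for k
  define o1 where "o1 k = (\<Sum>i<m1. norm (B1 k i))" for k
  have main: "(max 0 (t * c / 4 - norm (u k))) ^ Suc m \<le> Suc m * (2 * \<eta> + o1 k + \<tau> * (h / (4 * real (Suc m))))"
    if k: "k \<ge> n0" "k \<ge> m0" "k \<ge> m1" "k \<ge> 1" for k
  proof -
    let ?x = "y + scale X (of_real t) (unit_seq k)"
    have x: "?x \<in> unit_ball X" using y(4)[OF _ t(3) k(1)] t(1) by simp
    note xc = ball[OF x]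
    have eb: "(unit_seq k :: nat \<Rightarrow> 'k) \<in> unit_ball X" using lorentz_le_unit_seq by (simp add: unit_ball_X_iff)
    have bc: "b k j \<in> carrier ?Y" if "j \<le> N" for j
      unfolding b_def by (rule XY.poly_coeff_closed[OF R yc(1) unit_seq_mem that])
    have bb: "?n (b k j) \<le> D * \<epsilon>0" if "j \<le> N" for j
      unfolding b_def using PQ by (intro D(2)[OF R _ y(1) eb that]) (simp add: R_def)
    have Bc: "B1 k \<in> carrier ?Y" "B2 k \<in> carrier ?Y"
      unfolding B1_def B2_def using bc by (auto intro!: Y.sum_closed Y.scale_closed)
    have Bn: "?n (\<Sum>j\<in>J. scale ?Y (of_real (t ^ j)) (b k j)) \<le> N * (s * (D * \<epsilon>0))"
      if J: "J \<subseteq> {1..N}" and s: "\<And>j. j \<in> J \<Longrightarrow> t ^ j \<le> s" "s \<ge> 0" for J s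
    proof -
      have "?n (\<Sum>j\<in>J. scale ?Y (of_real (t ^ j)) (b k j)) \<le> (\<Sum>j\<in>J. ?n (scale ?Y (of_real (t ^ j)) (b k j)))"
        using J bc by (intro Y.nrm_sum Y.scale_closed) auto
      also have "\<dots> \<le> (\<Sum>j\<in>J. s * (D * \<epsilon>0))"
      proof (rule sum_mono)
        fix j assume j: "j \<in> J"
        then have jN: "j \<le> N" using J by auto
        have "?n (scale ?Y (of_real (t ^ j)) (b k j)) = t ^ j * ?n (b k j)"
          using Y.nrm_scale[OF bc[OF jN], of "of_real (t ^ j)"] t(1) unfolding norm_of_real by simp
        also have "\<dots> \<le> s * (D * \<epsilon>0)"
          using s j bb[OF jN] Y.nrm_nonneg[OF bc[OF jN]] by (intro mult_mono) auto
        finally show "?n (scale ?Y (of_real (t ^ j)) (b k j)) \<le> s * (D * \<epsilon>0)" .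
      qed
      also have "\<dots> = card J * (s * (D * \<epsilon>0))" by simp
      also have "\<dots> \<le> N * (s * (D * \<epsilon>0))"
        using card_mono[OF _ J] s(2) D(1) \<epsilon>0(1) by (intro mult_right_mono) auto
      finally show ?thesis .
    qed
    define v where "v = P ?x"
    have vc: "v \<in> carrier ?Y" unfolding v_def by (rule XY.polys_closed[OF P xc(1)])
    define z where "z = (\<lambda>i. if i = k then of_real (t * c) * p else 0)"
    have veq: "v = u + z + B1 k + B2 k"
    proof -
      have "Q ?x = Q y + z"
      proof
        fix i
        have x0: "?x 0 = y 0" using k(4) by (simp add: scale_d_lower unit_seq_def)
        show "Q ?x i = (Q y + z) i"
          unfolding Qx[OF xc(1)] Qx[OF yc(1)] x0
          by (simp add: z_def p_def scale_d_lower unit_seq_def algebra_simps)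
      qed
      moreover have "R ?x = R y + (B1 k + B2 k)"
      proof -
        have "R ?x = (\<Sum>j\<le>N. scale ?Y (of_real (t ^ j)) (b k j))"
          using X.scale_closed XY.polys_expand[OF R yc(1) unit_seq_mem, of "of_real t" k]
          unfolding b_def of_real_power by blast
        also have "{..N} = insert 0 ({1..min m N} \<union> {Suc m..N})" by auto
        also have "(\<Sum>j\<in>insert 0 ({1..min m N} \<union> {Suc m..N}). scale ?Y (of_real (t ^ j)) (b k j)) =
            scale ?Y (of_real (t ^ 0)) (b k 0) + (B1 k + B2 k)"
          unfolding B1_def B2_def by (subst sum.insert, simp, simp, subst sum.union_disjoint) auto
        also have "scale ?Y (of_real (t ^ 0)) (b k 0) = R y"
          using XY.poly_coeff_0[OF R yc(1)] XY.polys_closed[OF R yc(1)] by (simp add: b_def)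
        finally show ?thesis .
      qed
      moreover have "v = R ?x + Q ?x" "u = R y + Q y" by (simp_all only: R_def v_def u_def diff_add_cancel)
      ultimately show ?thesis by (simp only: add_ac)
    qed
    have "?n (trunc m1 u) \<le> ?n (trunc m1 v) + o1 k + \<tau> * (h / (4 * real (Suc m)))"
    proof -
      have tc: "trunc m1 s \<in> carrier ?Y" for s by (rule trunc_ell) simp
      have "trunc m1 z = 0" using k(3) by (auto simp: trunc_def z_def)
      then have "trunc m1 v = trunc m1 u + (trunc m1 (B1 k) + trunc m1 (B2 k))"
        unfolding veq trunc_add by (simp only: add_0_right add.assoc)
      from Y.nrm_diff_ge[OF tc[of u] Y.add_closed[OF tc[of "B1 k"] tc[of "B2 k"]]] this
      have "?n (trunc m1 u) \<le> ?n (trunc m1 v) + ?n (trunc m1 (B1 k) + trunc m1 (B2 k))" by simp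
      also have "?n (trunc m1 (B1 k) + trunc m1 (B2 k)) \<le> ?n (trunc m1 (B1 k)) + ?n (trunc m1 (B2 k))"
        by (rule Y.nrm_add[OF tc tc])
      also have "?n (trunc m1 (B1 k)) \<le> o1 k" unfolding o1_def by (rule nrm_ell_trunc_le_sum) simp
      also have "?n (trunc m1 (B2 k)) \<le> ?n (B2 k)" by (rule nrm_ell_trunc_le[OF _ Bc(2)]) simp
      also have "?n (B2 k) \<le> N * (\<tau> * (D * \<epsilon>0))"
        unfolding B2_def \<tau>_def using t by (intro Bn power_decreasing) auto
      also have "N * (\<tau> * (D * \<epsilon>0)) \<le> \<tau> * (h / (4 * real (Suc m)))"
        using mult_left_mono[OF \<epsilon>0(2), of \<tau>] \<tau> by (simp add: mult_ac)
      finally show ?thesis by simp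
    qed
    then have low: "1 - (2 * \<eta> + o1 k + \<tau> * (h / (4 * real (Suc m)))) \<le> ?n (trunc m1 v)" using m1 by simp
    \<comment> \<open>At coordinate \<open>k\<close> the term from \<open>Q\<close> is at least
      \<open>t * c / 2\<close> because \<open>p\<close> has norm at least 1/2, and the terms of
      \<open>P - Q\<close> take away at most \<open>t * c / 4\<close>. The maximum with 0 allows
      raising to a power.\<close>
    have "max 0 (t * c / 4 - norm (u k)) \<le> norm (v k)"
    proof -
      have "{1..min m N} \<union> {Suc m..N} = {1..N}" "{1..min m N} \<inter> {Suc m..N} = {}" by auto
      then have "B1 k + B2 k = (\<Sum>j\<in>{1..N}. scale ?Y (of_real (t ^ j)) (b k j))"
        unfolding B1_def B2_def by (subst sum.union_disjoint[symmetric]) auto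
      then have "?n (B1 k + B2 k) \<le> N * (t * (D * \<epsilon>0))"
        using t Bn[of "{1..N}" t] power_decreasing[of 1 _ t] by auto
      also have "\<dots> \<le> t * (c / 4)" using mult_left_mono[OF \<epsilon>0c, of t] t by (simp add: mult_ac)
      finally have "norm ((B1 k + B2 k) k) \<le> t * (c / 4)"
        using nrm_ell_coord[OF _ Y.add_closed[OF Bc], of k] by simp
      moreover have "v k = u k + of_real (t * c) * p + (B1 k + B2 k) k" unfolding veq by (simp add: z_def)
      moreover have "norm (of_real (t * c) * p) \<ge> t * c * (1 / 2)"
        unfolding norm_mult norm_of_real using p_half t c by (simp add: abs_mult)
      moreover have "norm (of_real (t * c) * p) \<le> norm (u k + of_real (t * c) * p + (B1 k + B2 k) k) +
          norm (u k) + norm ((B1 k + B2 k) k)"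
        using norm_triangle_ineq4[of "u k + of_real (t * c) * p + (B1 k + B2 k) k" "u k + (B1 k + B2 k) k"]
          norm_triangle_ineq[of "u k" "(B1 k + B2 k) k"] by simp
      ultimately show ?thesis by simp
    qed
    then have "(max 0 (t * c / 4 - norm (u k))) ^ Suc m \<le> norm (v k) ^ Suc m" by (rule power_mono) simp
    moreover have "?n (trunc m1 v) ^ Suc m + norm (v k) ^ Suc m \<le> 1"
    proof -
      have "?n (trunc m1 v) ^ Suc m + norm (v k) ^ Suc m = (\<Sum>i\<in>insert k {..<m1}. norm (v i) ^ Suc m)"
        using nrm_ell_trunc[of "Suc m" m1 v] k(3) by (simp del: power_Suc)
      also have "\<dots> \<le> ?n v ^ Suc m" by (rule nrm_ell_finite[OF _ vc]) auto
      also have "\<dots> \<le> 1" using P1[OF x] nrm_ell_nonneg[OF vc] unfolding v_def by (intro power_le_one) auto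
      finally show ?thesis .
    qed
    \<comment> \<open>Bernoulli's inequality turns the lower bound for the norm of the first block
      into one for its power.\<close>
    moreover have "?n (trunc m1 v) ^ Suc m \<ge> 1 - Suc m * (2 * \<eta> + o1 k + \<tau> * (h / (4 * real (Suc m))))"
    proof -
      have "1 - Suc m * (2 * \<eta> + o1 k + \<tau> * (h / (4 * real (Suc m)))) \<le> 1 + Suc m * (?n (trunc m1 v) - 1)"
        using mult_left_mono[OF low, of "real (Suc m)"] by (simp add: right_diff_distrib del: of_nat_Suc)
      also have "\<dots> \<le> (1 + (?n (trunc m1 v) - 1)) ^ Suc m"
        using nrm_ell_nonneg[OF trunc_ell, of "Suc m" m1 v] by (intro Bernoulli_inequality) auto
      finally show ?thesis by simp
    qed
    ultimately show ?thesis by linarith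
  qed
  have u0: "u \<longlonglongrightarrow> 0"
  proof -
    have "(\<lambda>i. norm (u i) ^ Suc m) \<longlonglongrightarrow> 0" using uc by (simp only: carrier_ell summable_LIMSEQ_zero)
    then have "(\<lambda>i. root (Suc m) (norm (u i) ^ Suc m)) \<longlonglongrightarrow> root (Suc m) 0" by (rule tendsto_real_root)
    then have "(\<lambda>i. norm (u i)) \<longlonglongrightarrow> 0" by (simp add: real_root_power_cancel del: power_Suc)
    then show ?thesis by (rule tendsto_norm_zero_cancel)
  qed
  have o1: "o1 \<longlonglongrightarrow> 0"
  proof -
    have "(\<lambda>k. B1 k i) \<longlonglongrightarrow> 0" for i
    proof -
      have "(\<lambda>k. b k j i) \<longlonglongrightarrow> 0" if j: "j \<in> {1..min m N}" for j
      proof -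
        let ?f = "\<lambda>x. if x \<in> carrier ?Y then x i else 0"
        have "?f \<in> carrier (dual ?Y)" by (rule coordinate_dual_ell) simp
        from poly_coeff_null[OF Ysp R y(1) this, of j] have "(\<lambda>k. ?f (b k j)) \<longlonglongrightarrow> 0"
          using j not_summable_w[of j] unfolding b_def by auto
        moreover have "b k j \<in> carrier ?Y" for k
          unfolding b_def using j by (intro XY.poly_coeff_closed[OF R yc(1) unit_seq_mem]) auto
        ultimately show ?thesis by simp
      qed
      then have "(\<lambda>k. \<Sum>j\<in>{1..min m N}. of_real (t ^ j) * b k j i) \<longlonglongrightarrow> (\<Sum>j\<in>{1..min m N}. of_real (t ^ j) * 0)"
        by (intro tendsto_sum tendsto_mult_left)
      then show ?thesis unfolding B1_def sum_fun_apply scale_ell by simp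
    qed
    then have "(\<lambda>k. \<Sum>i<m1. norm (B1 k i)) \<longlonglongrightarrow> (\<Sum>i<m1. 0)"
      by (intro tendsto_sum tendsto_norm_zero)
    then show ?thesis unfolding o1_def[abs_def] by simp
  qed
  have "(\<lambda>k. (max 0 (t * c / 4 - norm (u k))) ^ Suc m) \<longlonglongrightarrow> (max 0 (t * c / 4 - 0)) ^ Suc m"
    by (intro tendsto_power tendsto_max tendsto_diff tendsto_const tendsto_norm_zero u0)
  moreover have "(\<lambda>k. Suc m * (2 * \<eta> + o1 k + \<tau> * (h / (4 * real (Suc m))))) \<longlonglongrightarrow>
      Suc m * (2 * \<eta> + 0 + \<tau> * (h / (4 * real (Suc m))))"
    by (intro tendsto_mult_left tendsto_add tendsto_const o1)
  moreover have "eventually (\<lambda>k. (max 0 (t * c / 4 - norm (u k))) ^ Suc m \<le>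
      Suc m * (2 * \<eta> + o1 k + \<tau> * (h / (4 * real (Suc m))))) sequentially"
    using eventually_ge_at_top[of "max (max n0 m0) (max m1 1)"] by eventually_elim (use main in auto)
  ultimately have "(max 0 (t * c / 4 - 0)) ^ Suc m \<le> Suc m * (2 * \<eta> + 0 + \<tau> * (h / (4 * real (Suc m))))"
    by (intro tendsto_le[OF sequentially_bot])
  moreover have "(max 0 (t * c / 4 - 0)) ^ Suc m = \<tau> * h"
    using t c unfolding \<tau>_def h_def power_mult_distrib[symmetric] by simp
  moreover have "Suc m * (2 * \<eta> + 0 + \<tau> * (h / (4 * real (Suc m)))) = \<tau> * h / 8 + \<tau> * h / 4"
    by (simp add: \<eta>_def field_simps del: of_nat_Suc)
  \<comment> \<open>The limit in \<open>k\<close> removes \<open>norm (u k)\<close> and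
    \<open>o1 k\<close>; what remains is \<open>\<tau> * h\<close> against three eighths of
    itself.\<close>
  ultimately have "\<tau> * h \<le> \<tau> * h / 8 + \<tau> * h / 4" by (simp only:)
  then show False using mult_pos_pos[OF \<tau> h(1)] by simp
qed

end

theorem proposition4p6:
  fixes w :: "nat \<Rightarrow> real" and M :: nat
  assumes "admissible w"
    and "\<exists>m\<ge>1. w \<in> carrier (ell m)"
    and "M = (LEAST m. m \<ge> 1 \<and> w \<in> carrier (ell m))"
  shows
    "(\<forall>N\<ge>M. \<not> lindenstrauss_bollobas N
        (d_lower w :: (real, nat \<Rightarrow> real) nspace) scalar_space) \<and>
     (\<forall>N\<ge>1. \<not> lindenstrauss_bollobas N
        (d_lower w :: (real, nat \<Rightarrow> real) nspace) (ell M :: (real, nat \<Rightarrow> real) nspace)) \<and>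
     (\<forall>N\<ge>M. \<not> lindenstrauss_bollobas N
        (d_lower w :: (complex, nat \<Rightarrow> complex) nspace) scalar_space) \<and>
     (\<forall>N\<ge>1. \<not> lindenstrauss_bollobas N
        (d_lower w :: (complex, nat \<Rightarrow> complex) nspace) (ell M :: (complex, nat \<Rightarrow> complex) nspace))"
proof -
  interpret weight w by unfold_locales (rule assms(1))
  have iff: "w \<in> carrier (ell j) \<longleftrightarrow> summable (\<lambda>i. w i ^ j)" for j
    using w_nonneg by (simp add: carrier_ell)
  have M: "M \<ge> 1" "summable (\<lambda>i. w i ^ M)"
    using LeastI_ex[of "\<lambda>m. m \<ge> 1 \<and> w \<in> carrier (ell m)"] assms(2,3) iff by auto
  have min: "\<not> summable (\<lambda>i. w i ^ j)" if "1 \<le> j" "j < M" for j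
    using not_less_Least[of j "\<lambda>m. m \<ge> 1 \<and> w \<in> carrier (ell m)"] that assms(3) iff by auto
  \<comment> \<open>An admissible weight has divergent sum, which excludes exponent 1.\<close>
  have "M \<noteq> 1" using M(2) w_not_summable by auto
  then obtain m where m: "M = Suc m" "m \<ge> 1" using M(1) by (cases M) auto
  interpret weight_in_ell w m
    by unfold_locales (use M min m in auto)
  show ?thesis
    unfolding m(1)
    by (intro conjI allI impI not_lindenstrauss_bollobas_scalar not_lindenstrauss_bollobas_ell m(2)) simp_all
qed

end
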